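(* Let $(A_1,\dots,A_{p+1})$ be a tuple of diagonalizable matrices in $gl(n,\mathbf{C})$ with $A_1+\dots+A_{p+1}=0$ (resp. $(M_1,\dots,M_{p+1})$ a tuple of diagonalizable matrices in $GL(n,\mathbf{C})$ with $M_1\cdots M_{p+1}=I$) which is block upper-triangular (all matrices of the tuple, with the same sizes of the square diagonal blocks). Suppose that $A_1$ (resp. $M_1$) has $n$ distinct eigenvalues and that the eigenvalues of the tuple are $3$-generic. Then the tuple can be deformed into a tuple of matrices from the same respective conjugacy classes, again with zero sum (resp. with product $I$), and with trivial centralizer.
   Context: A tuple has trivial centralizer if only scalar matrices commute with all matrices of the tuple. "Can be deformed into" a tuple with a given property means that there are tuples with this property (from the same conjugacy classes, satisfying the same sum or product condition) arbitrarily close to the given one. Genericity: let $\lambda_{k,j}$ (resp. $\sigma_{k,j}$), $1\le k\le n$, be the eigenvalues of $A_j$ (resp. $M_j$) repeated with multiplicity. A non-genericity relation ($N$-relation) is an equality $\sum_{j=1}^{p+1}\sum_{k\in\Phi_j}\lambda_{k,j}=0$ (resp. $\prod_{j=1}^{p+1}\prod_{k\in\Phi_j}\sigma_{k,j}=1$), where the sets $\Phi_j\subset\{1,\dots,n\}$ all have the same number $N$ of elements, $0<N<n$. Since an $N$-relation yields an $(n-N)$-relation by taking complements, only relations with $N\le n/2$ are considered. The eigenvalues are $k$-generic if the only non-genericity relations (with $N\le n/2$) which they satisfy are with $N\ge k$. *)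

theory Defs
  imports Complex_Main "Jordan_Normal_Form.Char_Poly"
begin

definition diagonalizable_mat :: "complex mat \<Rightarrow> bool" where
  "diagonalizable_mat A \<longleftrightarrow> (\<exists>D. diagonal_mat D \<and> similar_mat A D)"

definition has_n_distinct_eigenvalues :: "nat \<Rightarrow> complex mat \<Rightarrow> bool" where
  "has_n_distinct_eigenvalues n A \<longleftrightarrow> card {e. eigenvalue A e} = n"

(* l 1, ..., l n is an enumeration of the eigenvalues of A with (algebraic) multiplicity. *)
definition lists_eigenvalues :: "nat \<Rightarrow> complex mat \<Rightarrow> (nat \<Rightarrow> complex) \<Rightarrow> bool" where
  "lists_eigenvalues n A l \<longleftrightarrow> char_poly A = (\<Prod>k = 1..n. [:- l k, 1:])"

(* Tuples of m matrices of size n are functions on {1..m}; values outside are irrelevant. The type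
   of matrices of all sizes is not a monoid, so ordered sums and products are written as folds. *)
definition tuple_sum :: "nat \<Rightarrow> nat \<Rightarrow> (nat \<Rightarrow> complex mat) \<Rightarrow> complex mat" where
  "tuple_sum n m A = foldr (+) (map A [1..<Suc m]) (0\<^sub>m n n)"

definition tuple_prod :: "nat \<Rightarrow> nat \<Rightarrow> (nat \<Rightarrow> complex mat) \<Rightarrow> complex mat" where
  "tuple_prod n m M = foldr (*) (map M [1..<Suc m]) (1\<^sub>m n)"

(* ns is the list of sizes of the square diagonal blocks. There are at least two of them, since
   with a single block every matrix would qualify. The first t blocks occupy the indices
   below sum_list (take t ns). *)
definition block_upper_triangular :: "nat list \<Rightarrow> complex mat \<Rightarrow> bool" where
  "block_upper_triangular ns A \<longleftrightarrow>
     2 \<le> length ns \<and> (\<forall>d \<in> set ns. 0 < d) \<and> A \<in> carrier_mat (sum_list ns) (sum_list ns) \<and>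
     (\<forall>t \<le> length ns. \<forall>r c. sum_list (take t ns) \<le> r \<and> r < sum_list ns \<and> c < sum_list (take t ns)
        \<longrightarrow> A $$ (r, c) = 0)"

(* l k j is the k-th eigenvalue of the j-th matrix. *)
definition additive_relation :: "nat \<Rightarrow> nat \<Rightarrow> (nat \<Rightarrow> nat \<Rightarrow> complex) \<Rightarrow> nat \<Rightarrow> bool" where
  "additive_relation n m l N \<longleftrightarrow> 0 < N \<and> N < n \<and>
     (\<exists>\<Phi>. (\<forall>j \<in> {1..m}. \<Phi> j \<subseteq> {1..n} \<and> card (\<Phi> j) = N) \<and>
          (\<Sum>j = 1..m. \<Sum>k \<in> \<Phi> j. l k j) = 0)"

definition multiplicative_relation :: "nat \<Rightarrow> nat \<Rightarrow> (nat \<Rightarrow> nat \<Rightarrow> complex) \<Rightarrow> nat \<Rightarrow> bool" where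
  "multiplicative_relation n m s N \<longleftrightarrow> 0 < N \<and> N < n \<and>
     (\<exists>\<Phi>. (\<forall>j \<in> {1..m}. \<Phi> j \<subseteq> {1..n} \<and> card (\<Phi> j) = N) \<and>
          (\<Prod>j = 1..m. \<Prod>k \<in> \<Phi> j. s k j) = 1)"

(* Relations are considered for N <= n / 2 only: complements turn N-relations
   into (n - N)-relations. *)
definition additively_generic :: "nat \<Rightarrow> nat \<Rightarrow> nat \<Rightarrow> (nat \<Rightarrow> nat \<Rightarrow> complex) \<Rightarrow> bool" where
  "additively_generic d n m l \<longleftrightarrow>
     (\<forall>N. 2 * N \<le> n \<and> additive_relation n m l N \<longrightarrow> d \<le> N)"

definition multiplicatively_generic :: "nat \<Rightarrow> nat \<Rightarrow> nat \<Rightarrow> (nat \<Rightarrow> nat \<Rightarrow> complex) \<Rightarrow> bool" where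
  "multiplicatively_generic d n m s \<longleftrightarrow>
     (\<forall>N. 2 * N \<le> n \<and> multiplicative_relation n m s N \<longrightarrow> d \<le> N)"

definition trivial_centralizer :: "nat \<Rightarrow> nat \<Rightarrow> (nat \<Rightarrow> complex mat) \<Rightarrow> bool" where
  "trivial_centralizer n m A \<longleftrightarrow>
     (\<forall>X \<in> carrier_mat n n. (\<forall>j \<in> {1..m}. X * A j = A j * X) \<longrightarrow> (\<exists>c. X = c \<cdot>\<^sub>m 1\<^sub>m n))"

(* The matrix type carries no topology; on n x n matrices entrywise closeness is
   closeness in any norm. *)
definition tuples_close :: "nat \<Rightarrow> nat \<Rightarrow> real \<Rightarrow> (nat \<Rightarrow> complex mat) \<Rightarrow> (nat \<Rightarrow> complex mat) \<Rightarrow> bool"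
  where
  "tuples_close n m \<epsilon> A B \<longleftrightarrow>
     (\<forall>j \<in> {1..m}. \<forall>r < n. \<forall>c < n. cmod (B j $$ (r, c) - A j $$ (r, c)) < \<epsilon>)"

(* C is the sum or product condition, P the property to be reached. *)
definition can_be_deformed ::
    "nat \<Rightarrow> nat \<Rightarrow> ((nat \<Rightarrow> complex mat) \<Rightarrow> bool) \<Rightarrow> ((nat \<Rightarrow> complex mat) \<Rightarrow> bool) \<Rightarrow>
     (nat \<Rightarrow> complex mat) \<Rightarrow> bool" where
  "can_be_deformed n m C P A \<longleftrightarrow>
     (\<forall>\<epsilon> > 0. \<exists>B. (\<forall>j \<in> {1..m}. similar_mat (B j) (A j)) \<and> C B \<and> P B \<and> tuples_close n m \<epsilon> A B)"

end

theory Submission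
  imports Defs "Jordan_Normal_Form.Schur_Decomposition"
begin

text \<open>Conjugate the tuple so that its first matrix becomes diagonal with distinct diagonal entries, and
  keep this first matrix fixed. A matrix commuting with the tuple is then diagonal, and it is not
  scalar precisely when it separates the indices into two nonempty sets \<open>S\<close> and \<open>T\<close> between which all
  entries of all matrices vanish: the tuple is a direct sum of tuples on the coordinate spaces of
  \<open>S\<close> and \<open>T\<close>.

  Such a splitting can be destroyed by an arbitrarily small change. For \<open>j \<ge> 2\<close> choose \<open>Y j\<close> with
  entries only in the corner \<open>S \<times> T\<close> and replace \<open>B j\<close> by \<open>B j + \<delta> X j\<close>, where
  \<open>X j = B j * Y j - Y j * B j\<close>. Products of two corner matrices vanish, so this is exactly
  \<open>(1 - \<delta> Y j) * B j * (1 + \<delta> Y j)\<close>, a conjugate of \<open>B j\<close> for every \<open>\<delta>\<close>, and for the same reason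
  both the sum and the product of the tuple are affine in \<open>\<delta>\<close>. The sum or product condition is
  therefore a single linear condition on the \<open>X j\<close> with values in the corner
  (\<open>corner_perturbation_of_split_tuple\<close>). A nonzero solution creates a nonzero entry in the
  corner and destroys none, so among the tuples close to the given one, in the same
  conjugacy classes and with the same first matrix, one with the largest number of nonzero entries
  has trivial centralizer (\<open>deformation_principle\<close>).

  A nonzero solution exists by counting dimensions. Diagonalize \<open>B j\<close> within the splitting, with
  eigenvalues \<open>d j s\<close> for \<open>s \<in> S\<close> and \<open>d j t\<close> for \<open>t \<in> T\<close>. The matrices \<open>X j\<close> form a space whose
  dimension is the number of pairs \<open>(s, t)\<close> with \<open>d j s \<noteq> d j t\<close>, and the linear condition consists of
  \<open>card S * card T\<close> equations; so it suffices that the number of triples \<open>(j, s, t)\<close> with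
  \<open>j \<ge> 2\<close> and \<open>d j s \<noteq> d j t\<close> exceeds \<open>card S * card T\<close>. Here genericity enters through two facts.

  First, the matrices have no common eigenvector, since it would yield a relation with \<open>N = 1\<close>.
  Hence for every choice of numbers \<open>e j\<close> the number of pairs \<open>(j, s)\<close> with \<open>d j s \<noteq> e j\<close> is at least
  \<open>card S\<close>: fewer linear conditions would have a common nonzero solution. With \<open>e j = d j t\<close>, summed
  over \<open>t \<in> T\<close>, this gives at least \<open>card S * card T\<close> triples, and also \<open>card S \<ge> 2\<close> and \<open>card T \<ge> 2\<close>.

  Second, equality is impossible. It forces (\<open>few_distinct_pairs_imp_two_valued\<close>) that on the
  coordinate space of \<open>S\<close> only two of the matrices with \<open>j \<ge> 2\<close> fail to be scalar, and that these two
  have two eigenvalues each. Two such quadratic operators always leave a line or a plane invariant,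
  which yields a relation with \<open>N \<le> 2 \<le> n / 2\<close> and contradicts 3-genericity.\<close>

section \<open>Homogeneous linear systems and entries of products\<close>

text \<open>Gaussian elimination of one unknown per equation. The dimension counts below are applications of
  this lemma, with equations and unknowns indexed by pairs and triples; hence the arbitrary finite
  index sets.\<close>

lemma homogeneous_system_nontrivial_solution:
  fixes c :: "'i \<Rightarrow> 'j \<Rightarrow> 'a::field"
  assumes "finite I" "finite J" "card I < card J"
  shows "\<exists>x. (\<exists>j\<in>J. x j \<noteq> 0) \<and> (\<forall>i\<in>I. (\<Sum>j\<in>J. c i j * x j) = 0)"
  using assms
proof (induction I arbitrary: J c rule: finite_induct)
  case empty
  then have "J \<noteq> {}" by auto
  then show ?case by (intro exI[of _ "\<lambda>_. 1"]) auto
next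
  case (insert e I)
  show ?case
  proof (cases "\<forall>j\<in>J. c e j = 0")
    case True
    have "card I < card J" using insert.hyps insert.prems by simp
    then obtain x where "\<exists>j\<in>J. x j \<noteq> 0" "\<forall>i\<in>I. (\<Sum>j\<in>J. c i j * x j) = 0"
      using insert.IH[OF insert.prems(1)] by blast
    with True show ?thesis by (intro exI[of _ x]) (simp add: sum.neutral)
  next
    case False
    then obtain j0 where j0: "j0 \<in> J" "c e j0 \<noteq> 0" by blast
    let ?K = "J - {j0}"
    let ?c = "\<lambda>i j. c i j - c i j0 * c e j / c e j0"
    have "card I < card ?K" using insert.hyps insert.prems j0(1) by simp
    then obtain x where x: "\<exists>j\<in>?K. x j \<noteq> 0" "\<forall>i\<in>I. (\<Sum>j\<in>?K. ?c i j * x j) = 0"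
      using insert.IH[of ?K ?c] insert.prems(1) by blast
    define s where "s = (\<Sum>j\<in>?K. c e j * x j)"
    define y where "y = x(j0 := - s / c e j0)"
    have split: "(\<Sum>j\<in>J. c i j * y j) = c i j0 * (- s / c e j0) + (\<Sum>j\<in>?K. c i j * x j)" for i
    proof -
      have "(\<Sum>j\<in>J. c i j * y j) = c i j0 * y j0 + (\<Sum>j\<in>?K. c i j * y j)"
        using insert.prems(1) j0(1) by (rule sum.remove)
      also have "(\<Sum>j\<in>?K. c i j * y j) = (\<Sum>j\<in>?K. c i j * x j)"
        by (rule sum.cong) (auto simp: y_def)
      finally show ?thesis by (simp add: y_def)
    qed
    have "(\<Sum>j\<in>J. c i j * y j) = 0" if "i \<in> I" for i
    proof -
      have "0 = (\<Sum>j\<in>?K. c i j * x j - (c i j0 / c e j0) * (c e j * x j))"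
        using x(2) that by (auto simp: algebra_simps)
      also have "\<dots> = (\<Sum>j\<in>?K. c i j * x j) - (c i j0 / c e j0) * s"
        by (simp add: sum_subtractf sum_distrib_left s_def)
      finally show ?thesis by (simp add: split)
    qed
    moreover have "(\<Sum>j\<in>J. c e j * y j) = 0"
      using j0(2) by (simp add: split s_def)
    moreover have "\<exists>j\<in>J. y j \<noteq> 0" using x(1) by (auto simp: y_def)
    ultimately show ?thesis by (intro exI[of _ y]) auto
  qed
qed

lemma mult_mat_entry:
  assumes "A \<in> carrier_mat a b" "B \<in> carrier_mat b c" "i < a" "k < c"
  shows "(A * B) $$ (i, k) = (\<Sum>l<b. A $$ (i, l) * B $$ (l, k))"
  using assms by (auto simp: scalar_prod_def atLeast0LessThan intro!: sum.cong)

lemma mult_mat_vec_entry: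
  assumes "A \<in> carrier_mat a b" "v \<in> carrier_vec b" "i < a"
  shows "(A *\<^sub>v v) $ i = (\<Sum>l<b. A $$ (i, l) * v $ l)"
  using assms by (auto simp: scalar_prod_def atLeast0LessThan intro!: sum.cong)

section \<open>Matrices respecting a splitting of the indices\<close>

text \<open>A matrix that splits along \<open>S\<close> is block diagonal for the decomposition of the index set into \<open>S\<close> and
  its complement; a corner matrix is one whose only nonzero block leads from the complement to
  \<open>S\<close>. The set \<open>S\<close> need not be an initial segment, because a nontrivial centralizer gives no control over
  which indices it separates.\<close>

definition splits_along :: "nat set \<Rightarrow> complex mat \<Rightarrow> bool" where
  "splits_along S A \<longleftrightarrow>
     (\<forall>i < dim_row A. \<forall>k < dim_col A. A $$ (i, k) \<noteq> 0 \<longrightarrow> (i \<in> S \<longleftrightarrow> k \<in> S))"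

definition corner_along :: "nat set \<Rightarrow> complex mat \<Rightarrow> bool" where
  "corner_along S A \<longleftrightarrow>
     (\<forall>i < dim_row A. \<forall>k < dim_col A. A $$ (i, k) \<noteq> 0 \<longrightarrow> i \<in> S \<and> k \<notin> S)"

abbreviation coord_proj :: "nat \<Rightarrow> nat set \<Rightarrow> complex mat" where
  "coord_proj n S \<equiv> mat_diag n (\<lambda>i. if i \<in> S then 1 else 0)"

lemma splits_along_iff_commutes:
  assumes "A \<in> carrier_mat n n"
  shows "splits_along S A \<longleftrightarrow> coord_proj n S * A = A * coord_proj n S"
proof -
  have "coord_proj n S * A = A * coord_proj n S \<longleftrightarrow>
    (\<forall>i<n. \<forall>k<n. (if i \<in> S then 1 else 0) * A $$ (i, k) = A $$ (i, k) * (if k \<in> S then 1 else 0))"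
    unfolding mat_diag_mult_left[OF assms] mat_diag_mult_right[OF assms] mat_eq_iff
    by simp
  also have "\<dots> \<longleftrightarrow> splits_along S A"
    using assms by (auto simp: splits_along_def)
  finally show ?thesis by simp
qed

lemma splits_along_mult:
  assumes "A \<in> carrier_mat n n" "B \<in> carrier_mat n n" "splits_along S A" "splits_along S B"
  shows "splits_along S (A * B)"
  unfolding splits_along_def
proof (intro allI impI)
  fix i k assume ik: "i < dim_row (A * B)" "k < dim_col (A * B)" "(A * B) $$ (i, k) \<noteq> 0"
  then have "(\<Sum>l<n. A $$ (i, l) * B $$ (l, k)) \<noteq> 0"
    using mult_mat_entry[OF assms(1,2)] assms(1,2) by auto
  then obtain l where "l < n" "A $$ (i, l) * B $$ (l, k) \<noteq> 0"
    by (meson lessThan_iff sum.neutral)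
  with ik assms show "i \<in> S \<longleftrightarrow> k \<in> S" by (auto simp: splits_along_def)
qed

lemma corner_along_mult_left:
  assumes "A \<in> carrier_mat n n" "X \<in> carrier_mat n n" "splits_along S A" "corner_along S X"
  shows "corner_along S (A * X)"
  unfolding corner_along_def
proof (intro allI impI)
  fix i k assume ik: "i < dim_row (A * X)" "k < dim_col (A * X)" "(A * X) $$ (i, k) \<noteq> 0"
  then have "(\<Sum>l<n. A $$ (i, l) * X $$ (l, k)) \<noteq> 0"
    using mult_mat_entry[OF assms(1,2)] assms(1,2) by auto
  then obtain l where "l < n" "A $$ (i, l) * X $$ (l, k) \<noteq> 0"
    by (meson lessThan_iff sum.neutral)
  with ik assms show "i \<in> S \<and> k \<notin> S" by (auto simp: splits_along_def corner_along_def)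
qed

lemma corner_along_mult_right:
  assumes "A \<in> carrier_mat n n" "X \<in> carrier_mat n n" "splits_along S A" "corner_along S X"
  shows "corner_along S (X * A)"
  unfolding corner_along_def
proof (intro allI impI)
  fix i k assume ik: "i < dim_row (X * A)" "k < dim_col (X * A)" "(X * A) $$ (i, k) \<noteq> 0"
  then have "(\<Sum>l<n. X $$ (i, l) * A $$ (l, k)) \<noteq> 0"
    using mult_mat_entry[OF assms(2,1)] assms(1,2) by auto
  then obtain l where "l < n" "X $$ (i, l) * A $$ (l, k) \<noteq> 0"
    by (meson lessThan_iff sum.neutral)
  with ik assms show "i \<in> S \<and> k \<notin> S" by (auto simp: splits_along_def corner_along_def)
qed

lemma corner_along_mult_corner:
  assumes "X \<in> carrier_mat n n" "Y \<in> carrier_mat n n" "corner_along S X" "corner_along S Y"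
  shows "X * Y = 0\<^sub>m n n"
proof (rule eq_matI)
  fix i k assume ik: "i < dim_row (0\<^sub>m n n :: complex mat)" "k < dim_col (0\<^sub>m n n :: complex mat)"
  have "(\<Sum>l<n. X $$ (i, l) * Y $$ (l, k)) = 0"
  proof (intro sum.neutral ballI)
    fix l assume "l \<in> {..<n}"
    then have "X $$ (i, l) \<noteq> 0 \<longrightarrow> l \<notin> S" "Y $$ (l, k) \<noteq> 0 \<longrightarrow> l \<in> S"
      using assms ik unfolding corner_along_def by auto
    then show "X $$ (i, l) * Y $$ (l, k) = 0" by auto
  qed
  then show "(X * Y) $$ (i, k) = 0\<^sub>m n n $$ (i, k)"
    using ik mult_mat_entry[OF assms(1,2)] by auto
qed (use assms in auto)

lemma splits_along_inverse:
  assumes "A \<in> carrier_mat n n" "B \<in> carrier_mat n n" "A * B = 1\<^sub>m n" "B * A = 1\<^sub>m n"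
    and "splits_along S A"
  shows "splits_along S B"
proof -
  let ?P = "coord_proj n S"
  have P: "?P \<in> carrier_mat n n" by simp
  note c = assms(1,2) P
  have "B * ?P = B * (?P * (A * B))"
    using assms(3) right_mult_one_mat[OF P] by simp
  also have "\<dots> = B * ((?P * A) * B)" by (simp add: assoc_mult_mat[OF P assms(1,2)])
  also have "?P * A = A * ?P" using splits_along_iff_commutes[OF assms(1)] assms(5) by simp
  also have "B * ((A * ?P) * B) = B * (A * (?P * B))"
    by (simp add: assoc_mult_mat[OF assms(1) P assms(2)])
  also have "\<dots> = (B * A) * (?P * B)"
    by (rule assoc_mult_mat[symmetric, OF assms(2,1)]) (rule mult_carrier_mat[OF P assms(2)])
  also have "\<dots> = ?P * B"
    unfolding assms(4) by (rule left_mult_one_mat) (rule mult_carrier_mat[OF P assms(2)])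
  finally show ?thesis using splits_along_iff_commutes[OF assms(2)] by simp
qed

section \<open>Traces\<close>

definition mat_trace :: "complex mat \<Rightarrow> complex" where
  "mat_trace A = (\<Sum>i<dim_row A. A $$ (i, i))"

lemma mat_trace_mult_commute:
  assumes "A \<in> carrier_mat a b" "B \<in> carrier_mat b a"
  shows "mat_trace (A * B) = mat_trace (B * A)"
proof -
  have "mat_trace (A * B) = (\<Sum>i<a. \<Sum>l<b. A $$ (i, l) * B $$ (l, i))"
    using assms mult_mat_entry[OF assms] by (simp add: mat_trace_def)
  also have "\<dots> = (\<Sum>l<b. \<Sum>i<a. B $$ (l, i) * A $$ (i, l))"
    by (subst sum.swap) (simp add: mult.commute)
  also have "\<dots> = mat_trace (B * A)"
    using assms mult_mat_entry[OF assms(2,1)] by (simp add: mat_trace_def)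
  finally show ?thesis .
qed

lemma mat_trace_similar:
  assumes "P \<in> carrier_mat n n" "B \<in> carrier_mat n n" "Q \<in> carrier_mat n n" "Q * P = 1\<^sub>m n"
  shows "mat_trace (P * B * Q) = mat_trace B"
proof -
  have "mat_trace (P * B * Q) = mat_trace (Q * (P * B))"
    by (rule mat_trace_mult_commute[of _ n n]) (use assms in auto)
  also have "Q * (P * B) = (Q * P) * B"
    by (rule assoc_mult_mat[symmetric]) (use assms in auto)
  finally show ?thesis using assms by simp
qed

text \<open>Read off from a Schur triangularization with the prescribed diagonal.\<close>

lemma trace_det_of_factored_char_poly:
  assumes "A \<in> carrier_mat n n" "char_poly A = (\<Prod>e\<leftarrow>es. [:- e, 1:])"
  shows "mat_trace A = sum_list es" "det A = prod_list es"
proof -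
  obtain B P Q where "schur_decomposition A es = (B, P, Q)" by (cases "schur_decomposition A es")
  then have *: "similar_mat_wit A B P Q" "upper_triangular B" "diag_mat B = es"
    using schur_decomposition[OF assms] by auto
  note w = similar_mat_witD2[OF assms(1) *(1)]
  have "mat_trace A = mat_trace B"
    using mat_trace_similar[OF w(6,5,7,2)] w(3) by simp
  also have "\<dots> = sum_list (diag_mat B)"
    using w(5) by (simp add: mat_trace_def diag_mat_def interv_sum_list_conv_sum_set_nat atLeast0LessThan)
  finally show "mat_trace A = sum_list es" using *(3) by simp
  have "det A = det B" using *(1) det_similar similar_mat_def by blast
  also have "\<dots> = prod_list (diag_mat B)" by (rule det_upper_triangular[OF *(2) w(5)])
  finally show "det A = prod_list es" using *(3) by simp
qed

lemma mat_trace_add: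
  assumes "A \<in> carrier_mat n n" "B \<in> carrier_mat n n"
  shows "mat_trace (A + B) = mat_trace A + mat_trace B"
  using assms by (auto simp: mat_trace_def sum.distrib)

lemma mat_trace_smult:
  assumes "A \<in> carrier_mat n n"
  shows "mat_trace (c \<cdot>\<^sub>m A) = c * mat_trace A"
  using assms by (auto simp: mat_trace_def sum_distrib_left)

section \<open>Diagonalization within a splitting\<close>

lemma smult_mat_mult_vec:
  fixes A :: "'a::comm_semiring_0 mat"
  assumes "A \<in> carrier_mat m n" "v \<in> carrier_vec n"
  shows "(a \<cdot>\<^sub>m A) *\<^sub>v v = a \<cdot>\<^sub>v (A *\<^sub>v v)"
  using assms by (intro eq_vecI) (auto simp: scalar_prod_def sum_distrib_left mult.assoc)

lemma det_nonzero_imp_inverse: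
  assumes "A \<in> carrier_mat n n" "det A \<noteq> (0::'a::field)"
  shows "\<exists>B \<in> carrier_mat n n. A * B = 1\<^sub>m n \<and> B * A = 1\<^sub>m n"
  using det_non_zero_imp_unit[OF assms, of "()"]
  by (auto simp: Units_def ring_mat_def)

text \<open>Expansion along the column in question: its cofactors do not see the column itself.\<close>

lemma det_add_in_column:
  fixes Q :: "'a::comm_ring_1 mat"
  assumes "Q \<in> carrier_mat n n" "Q1 \<in> carrier_mat n n" "Q2 \<in> carrier_mat n n" "k < n"
    and "\<And>i l. i < n \<Longrightarrow> l < n \<Longrightarrow> l \<noteq> k \<Longrightarrow>
           Q1 $$ (i, l) = Q $$ (i, l) \<and> Q2 $$ (i, l) = Q $$ (i, l)"
    and "\<And>i. i < n \<Longrightarrow> Q $$ (i, k) = Q1 $$ (i, k) + Q2 $$ (i, k)"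
  shows "det Q = det Q1 + det Q2"
proof -
  have del: "mat_delete Q1 i k = mat_delete Q i k" "mat_delete Q2 i k = mat_delete Q i k"
    if "i < n" for i
    using assms(1-5) that unfolding mat_delete_def by (auto intro!: cong_mat)
  have "det Q = (\<Sum>i<n. Q1 $$ (i, k) * cofactor Q i k + Q2 $$ (i, k) * cofactor Q i k)"
    using assms(6) by (subst laplace_expansion_column[OF assms(1,4)]) (simp add: algebra_simps)
  also have "\<dots> = det Q1 + det Q2"
    unfolding laplace_expansion_column[OF assms(2,4)] laplace_expansion_column[OF assms(3,4)]
      sum.distrib
    by (simp add: cofactor_def del)
  finally show ?thesis .
qed

text \<open>Each column is the sum of its part in \<open>S\<close> and its part outside \<open>S\<close>. By linearity of the
  determinant in that column, one of the two parts can replace the column without making the matrix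
  singular; do this for one column after the other.\<close>

lemma exists_column_selection_nonsingular:
  fixes Q :: "complex mat"
  assumes Q: "Q \<in> carrier_mat n n" and "det Q \<noteq> 0"
  shows "\<exists>I \<subseteq> {..<n}. det (mat n n (\<lambda>(i, k). if i \<in> S \<longleftrightarrow> k \<in> I then Q $$ (i, k) else 0)) \<noteq> 0"
proof -
  define R where
    "R m I = mat n n (\<lambda>(i, k). if k < m \<longrightarrow> (i \<in> S \<longleftrightarrow> k \<in> I) then Q $$ (i, k) else 0)"
    for m :: nat and I
  have "\<exists>I \<subseteq> {..<m}. det (R m I) \<noteq> 0" if "m \<le> n" for m
    using that
  proof (induction m)
    case 0
    have "R 0 {} = Q" using Q by (intro eq_matI) (auto simp: R_def)
    then show ?case using assms(2) by auto
  next
    case (Suc m)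
    then obtain I where I: "I \<subseteq> {..<m}" "det (R m I) \<noteq> 0" by auto
    have "m \<notin> I" using I by auto
    have "det (R m I) = det (R (Suc m) (insert m I)) + det (R (Suc m) I)"
      by (rule det_add_in_column[of _ n _ _ m])
        (use Suc.prems \<open>m \<notin> I\<close> in \<open>auto simp: R_def less_Suc_eq\<close>)
    then have "det (R (Suc m) (insert m I)) \<noteq> 0 \<or> det (R (Suc m) I) \<noteq> 0" using I(2) by auto
    moreover have "insert m I \<subseteq> {..<Suc m}" "I \<subseteq> {..<Suc m}" using I(1) by auto
    ultimately show ?case by blast
  qed
  from this[of n] obtain I where "I \<subseteq> {..<n}" "det (R n I) \<noteq> 0" by auto
  moreover have "R n I = mat n n (\<lambda>(i, k). if i \<in> S \<longleftrightarrow> k \<in> I then Q $$ (i, k) else 0)"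
    by (auto simp: R_def intro!: cong_mat)
  ultimately show ?thesis by auto
qed

lemma mat_trace_coord_proj:
  assumes "I \<subseteq> {..<n}"
  shows "mat_trace (coord_proj n I) = of_nat (card I)"
proof -
  have "mat_trace (coord_proj n I) = (\<Sum>i<n. if i \<in> I then 1 else 0)"
    by (simp add: mat_trace_def mat_diag_def)
  also have "\<dots> = of_nat (card ({..<n} \<inter> I))"
    by (simp add: sum.If_cases)
  also have "{..<n} \<inter> I = I" using assms by auto
  finally show ?thesis .
qed

text \<open>The two parts of an eigenvector of \<open>M\<close> with respect to the splitting are again fixed up to the same
  eigenvalue, because \<open>M\<close> respects the splitting. Selecting one part of each eigenvector so that
  the result stays a basis gives an eigenbasis adapted to the splitting; comparing the traces of
  the two conjugate coordinate projections shows that the right number of basis vectors lies in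
  each part.\<close>

lemma block_eigenbasis_exists:
  assumes M: "M \<in> carrier_mat n n" and "diagonalizable_mat M" and split: "splits_along S M"
    and S: "S \<subseteq> {..<n}"
  shows "\<exists>R R' d I. R \<in> carrier_mat n n \<and> R' \<in> carrier_mat n n \<and> R * R' = 1\<^sub>m n \<and> R' * R = 1\<^sub>m n \<and>
    M * R = R * mat_diag n d \<and> coord_proj n S * R = R * coord_proj n I \<and> I \<subseteq> {..<n} \<and> card I = card S"
proof -
  obtain D Q Q' where D: "diagonal_mat D" and w: "similar_mat_wit M D Q Q'"
    using assms(2) unfolding diagonalizable_mat_def similar_mat_def by blast
  note w = similar_mat_witD2[OF M w]
  define d where "d k = D $$ (k, k)" for k
  have Dd: "D = mat_diag n d"
    using D w(5) by (intro eq_matI) (auto simp: diagonal_mat_def mat_diag_def d_def)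
  have "det Q \<noteq> 0" using w(1) det_mult[OF w(6,7)] by auto
  from exists_column_selection_nonsingular[OF w(6) this, of S] obtain I where
    I: "I \<subseteq> {..<n}"
      "det (mat n n (\<lambda>(i, k). if i \<in> S \<longleftrightarrow> k \<in> I then Q $$ (i, k) else 0)) \<noteq> 0" by blast
  define R where "R = mat n n (\<lambda>(i, k). if i \<in> S \<longleftrightarrow> k \<in> I then Q $$ (i, k) else 0)"
  have R: "R \<in> carrier_mat n n" by (simp add: R_def)
  obtain R' where R': "R' \<in> carrier_mat n n" "R * R' = 1\<^sub>m n" "R' * R = 1\<^sub>m n"
    using det_nonzero_imp_inverse[OF R] I(2) unfolding R_def by blast
  have MQ: "M * Q = Q * mat_diag n d"
  proof -
    have "M * Q = Q * D * (Q' * Q)"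
      using w(3) assoc_mult_mat[of "Q * D" n n Q' n Q n] w(5-7) by simp
    then show ?thesis using w(2,5,6) Dd right_mult_one_mat[of "Q * D" n n] by simp
  qed
  have "M * R = R * mat_diag n d"
  proof (rule eq_matI)
    fix i k assume ik: "i < dim_row (R * mat_diag n d)" "k < dim_col (R * mat_diag n d)"
    then have ik: "i < n" "k < n" using R by (auto simp: mat_diag_def)
    have "(M * R) $$ (i, k) = (\<Sum>l<n. M $$ (i, l) * R $$ (l, k))"
      by (rule mult_mat_entry[OF M R ik])
    also have "\<dots> = (\<Sum>l<n. (if i \<in> S \<longleftrightarrow> k \<in> I then 1 else 0) * (M $$ (i, l) * Q $$ (l, k)))"
    proof (rule sum.cong)
      fix l assume "l \<in> {..<n}"
      then have "M $$ (i, l) \<noteq> 0 \<Longrightarrow> i \<in> S \<longleftrightarrow> l \<in> S"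
        using split M ik by (auto simp: splits_along_def)
      then show "M $$ (i, l) * R $$ (l, k) =
          (if i \<in> S \<longleftrightarrow> k \<in> I then 1 else 0) * (M $$ (i, l) * Q $$ (l, k))"
        using \<open>l \<in> {..<n}\<close> ik by (cases "M $$ (i, l) = 0") (auto simp: R_def)
    qed simp
    also have "\<dots> = (if i \<in> S \<longleftrightarrow> k \<in> I then 1 else 0) * (M * Q) $$ (i, k)"
      by (simp add: mult_mat_entry[OF M w(6) ik] sum_distrib_left)
    also have "\<dots> = (R * mat_diag n d) $$ (i, k)"
      unfolding MQ mat_diag_mult_right[OF R] mat_diag_mult_right[OF w(6)]
      using ik by (auto simp: R_def)
    finally show "(M * R) $$ (i, k) = (R * mat_diag n d) $$ (i, k)" .
  qed (use M R in \<open>auto simp: mat_diag_def\<close>)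
  moreover have PR: "coord_proj n S * R = R * coord_proj n I"
    unfolding mat_diag_mult_left[OF R] mat_diag_mult_right[OF R]
    by (rule cong_mat) (auto simp: R_def)
  moreover have "card I = card S"
  proof -
    have P: "coord_proj n S \<in> carrier_mat n n" "coord_proj n I \<in> carrier_mat n n" by auto
    have "coord_proj n S = coord_proj n S * (R * R')"
      using right_mult_one_mat[OF P(1)] R'(2) by simp
    also have "\<dots> = R * coord_proj n I * R'"
      using assoc_mult_mat[OF P(1) R R'(1)] PR by simp
    finally have "mat_trace (coord_proj n S) = mat_trace (coord_proj n I)"
      using mat_trace_similar[OF R P(2) R'(1,3)] by simp
    then show ?thesis
      using mat_trace_coord_proj[OF S] mat_trace_coord_proj[OF I(1)] by simp
  qed
  ultimately show ?thesis using R R' I(1) by blast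
qed

lemma bij_betw_matching_subset:
  assumes "finite A" "S \<subseteq> A" "I \<subseteq> A" "card I = card S"
  shows "\<exists>f. bij_betw f A A \<and> (\<forall>k\<in>A. f k \<in> I \<longleftrightarrow> k \<in> S)"
proof -
  have fin: "finite S" "finite I" using assms finite_subset by auto
  obtain g where g: "bij_betw g S I"
    using finite_same_card_bij[OF fin] assms(4) by auto
  have "card (A - S) = card (A - I)" using assms fin by (simp add: card_Diff_subset)
  then obtain h where h: "bij_betw h (A - S) (A - I)"
    using finite_same_card_bij[of "A - S" "A - I"] assms(1) by auto
  define f where "f k = (if k \<in> S then g k else h k)" for k
  have "bij_betw f S I" using g by (subst bij_betw_cong[of _ _ g]) (auto simp: f_def)
  moreover have "bij_betw f (A - S) (A - I)"
    using h by (subst bij_betw_cong[of _ _ h]) (auto simp: f_def)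
  ultimately have "bij_betw f (S \<union> (A - S)) (I \<union> (A - I))"
    by (rule bij_betw_combine) auto
  moreover have "S \<union> (A - S) = A" "I \<union> (A - I) = A" using assms by auto
  moreover have "\<forall>k\<in>A. f k \<in> I \<longleftrightarrow> k \<in> S"
    using g h by (auto simp: f_def bij_betw_def)
  ultimately show ?thesis by auto
qed

text \<open>Reordering the adapted eigenbasis so that the basis vectors lying in the coordinate space of \<open>S\<close> get
  the indices of \<open>S\<close>.\<close>

lemma splitting_diagonalization:
  assumes M: "M \<in> carrier_mat n n" and "diagonalizable_mat M" and "splits_along S M"
    and S: "S \<subseteq> {..<n}"
  shows "\<exists>U U' d. U \<in> carrier_mat n n \<and> U' \<in> carrier_mat n n \<and> U * U' = 1\<^sub>m n \<and> U' * U = 1\<^sub>m n \<and>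
    splits_along S U \<and> splits_along S U' \<and> M = U * mat_diag n d * U'"
proof -
  obtain R R' d I where R: "R \<in> carrier_mat n n" "R' \<in> carrier_mat n n" "R * R' = 1\<^sub>m n"
    and MR: "M * R = R * mat_diag n d" and PR: "coord_proj n S * R = R * coord_proj n I"
    and I: "I \<subseteq> {..<n}" "card I = card S"
    using block_eigenbasis_exists[OF assms] by blast
  obtain f where f: "bij_betw f {..<n} {..<n}" "\<And>k. k < n \<Longrightarrow> f k \<in> I \<longleftrightarrow> k \<in> S"
    using bij_betw_matching_subset[of "{..<n}" S I] S I by auto
  have fn: "f k < n" if "k < n" for k using f(1) that by (auto simp: bij_betw_def)
  define U where "U = mat n n (\<lambda>(i, k). R $$ (i, f k))"
  define U' where "U' = mat n n (\<lambda>(i, k). R' $$ (f i, k))"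
  have U: "U \<in> carrier_mat n n" "U' \<in> carrier_mat n n" by (auto simp: U_def U'_def)
  have UU': "U * U' = 1\<^sub>m n"
  proof (rule eq_matI)
    fix i k assume "i < dim_row (1\<^sub>m n :: complex mat)" "k < dim_col (1\<^sub>m n :: complex mat)"
    then have ik: "i < n" "k < n" by auto
    have "(U * U') $$ (i, k) = (\<Sum>l<n. R $$ (i, f l) * R' $$ (f l, k))"
      unfolding mult_mat_entry[OF U ik] by (rule sum.cong) (use ik in \<open>auto simp: U_def U'_def\<close>)
    also have "\<dots> = (\<Sum>l<n. R $$ (i, l) * R' $$ (l, k))"
      by (rule sum.reindex_bij_betw[OF f(1)])
    also have "\<dots> = 1\<^sub>m n $$ (i, k)"
      using mult_mat_entry[OF R(1,2) ik] R(3) by simp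
    finally show "(U * U') $$ (i, k) = 1\<^sub>m n $$ (i, k)" .
  qed (use U in auto)
  have U'U: "U' * U = 1\<^sub>m n" using mat_mult_left_right_inverse[OF U UU'] .
  have sU: "splits_along S U"
    unfolding splits_along_def
  proof (intro allI impI)
    fix i k assume ik: "i < dim_row U" "k < dim_col U" "U $$ (i, k) \<noteq> 0"
    then have ik': "i < n" "k < n" using U by auto
    have "(coord_proj n S * R) $$ (i, f k) = (R * coord_proj n I) $$ (i, f k)" using PR by simp
    then have "(if i \<in> S then 1 else 0) * R $$ (i, f k) = R $$ (i, f k) * (if f k \<in> I then 1 else 0)"
      unfolding mat_diag_mult_left[OF R(1)] mat_diag_mult_right[OF R(1)] using ik' fn by simp
    then show "i \<in> S \<longleftrightarrow> k \<in> S"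
      using ik ik' f(2) by (auto simp: U_def split: if_splits)
  qed
  have MU: "M * U = U * mat_diag n (d \<circ> f)"
  proof (rule eq_matI)
    fix i k assume ik: "i < dim_row (U * mat_diag n (d \<circ> f))" "k < dim_col (U * mat_diag n (d \<circ> f))"
    then have ik: "i < n" "k < n" using U by (auto simp: mat_diag_def)
    have "(M * U) $$ (i, k) = (\<Sum>l<n. M $$ (i, l) * R $$ (l, f k))"
      unfolding mult_mat_entry[OF M U(1) ik] by (rule sum.cong) (use ik in \<open>auto simp: U_def\<close>)
    also have "\<dots> = (M * R) $$ (i, f k)"
      using ik fn by (simp add: mult_mat_entry[OF M R(1)])
    also have "\<dots> = (U * mat_diag n (d \<circ> f)) $$ (i, k)"
      unfolding MR mat_diag_mult_right[OF R(1)] mat_diag_mult_right[OF U(1)]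
      using ik fn by (simp add: U_def)
    finally show "(M * U) $$ (i, k) = (U * mat_diag n (d \<circ> f)) $$ (i, k)" .
  qed (use M U in \<open>auto simp: mat_diag_def\<close>)
  have "M = M * (U * U')" using UU' right_mult_one_mat[OF M] by simp
  also have "\<dots> = U * mat_diag n (d \<circ> f) * U'"
    using assoc_mult_mat[OF M U] MU by simp
  finally show ?thesis
    using U UU' U'U sU splits_along_inverse[OF U UU' U'U sU] by blast
qed

text \<open>An operator on the range of a projection \<open>F\<close> has an eigenvector. To find one without choosing a basis
  of the range, consider \<open>K s = C + s (1 - F)\<close>, which has the eigenvalues of \<open>C\<close> on the range of \<open>F\<close>
  and \<open>s\<close> on its kernel. If no value \<open>s\<close> allowed an eigenvalue of \<open>K s\<close> different from \<open>s\<close>, the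
  trace of \<open>K s\<close> would be \<open>n s\<close> for all \<open>s\<close>, and comparing \<open>s = 0\<close> with \<open>s = 1\<close> would give \<open>F\<close> trace 0.\<close>

lemma eigenvector_in_range_of_projection:
  assumes F: "F \<in> carrier_mat n n" and C: "C \<in> carrier_mat n n"
    and FF: "F * F = F" and FC: "F * C = C" and CF: "C * F = C" and tr: "mat_trace F \<noteq> 0"
  shows "\<exists>v t. v \<in> carrier_vec n \<and> v \<noteq> 0\<^sub>v n \<and> F *\<^sub>v v = v \<and> C *\<^sub>v v = t \<cdot>\<^sub>v v"
proof -
  define K where "K s = C + s \<cdot>\<^sub>m (1\<^sub>m n + (- 1) \<cdot>\<^sub>m F)" for s :: complex
  have K: "K s \<in> carrier_mat n n" for s using F C by (auto simp: K_def)
  have trK: "mat_trace (K s) = mat_trace C + s * (of_nat n - mat_trace F)" for s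
  proof -
    have "mat_trace (K s) = mat_trace C + s * (mat_trace (1\<^sub>m n) + (- 1) * mat_trace F)"
      unfolding K_def using F C
      by (simp add: mat_trace_add[of _ n] mat_trace_smult[of _ n])
    then show ?thesis by (simp add: mat_trace_def)
  qed
  have "\<exists>s e. eigenvalue (K s) e \<and> e \<noteq> s"
  proof (rule ccontr)
    assume neg: "\<not> ?thesis"
    have "mat_trace (K s) = of_nat n * s" for s
    proof -
      obtain es where es: "char_poly (K s) = (\<Prod>e\<leftarrow>es. [:- e, 1:])" "length es = n"
        using char_poly_factorized[OF K] by blast
      have "poly (char_poly (K s)) e = 0" if "e \<in> set es" for e
        using that by (auto simp: es(1) poly_prod_list prod_list_zero_iff)
      then have "\<forall>e\<in>set es. e = s"
        using neg eigenvalue_root_char_poly[OF K] by blast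
      then have "es = replicate n s" using es(2) by (metis replicate_eqI)
      then show ?thesis
        using trace_det_of_factored_char_poly(1)[OF K es(1)] by (simp add: sum_list_replicate)
    qed
    from this[of 0] this[of 1] show False using tr by (simp add: trK)
  qed
  then obtain s e v where e: "e \<noteq> s" and v: "v \<in> carrier_vec n" "v \<noteq> 0\<^sub>v n"
    "K s *\<^sub>v v = e \<cdot>\<^sub>v v"
    using K unfolding eigenvalue_def eigenvector_def by (metis carrier_matD(1))
  have Fv: "F *\<^sub>v v \<in> carrier_vec n" and Cv: "C *\<^sub>v v \<in> carrier_vec n" using F C v by auto
  have FK: "F * K s = C"
  proof -
    have "F * K s = F * C + s \<cdot>\<^sub>m (F * 1\<^sub>m n + (- 1) \<cdot>\<^sub>m (F * F))"
      unfolding K_def using F C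
      by (simp add: mult_add_distrib_mat[of _ n n _ n] mult_smult_distrib[of _ n n _ n])
    also have "\<dots> = C"
      using F C FC FF by (intro eq_matI) auto
    finally show ?thesis .
  qed
  have CeF: "C *\<^sub>v v = e \<cdot>\<^sub>v (F *\<^sub>v v)"
  proof -
    have "C *\<^sub>v v = F *\<^sub>v (K s *\<^sub>v v)" using FK F K v assoc_mult_mat_vec by metis
    also have "\<dots> = e \<cdot>\<^sub>v (F *\<^sub>v v)" using v F by (simp add: mult_mat_vec[of _ n n])
    finally show ?thesis .
  qed
  have "F *\<^sub>v v = v"
  proof (rule eq_vecI)
    fix i assume i: "i < dim_vec v"
    have Kv: "K s *\<^sub>v v = C *\<^sub>v v + s \<cdot>\<^sub>v (v + (- 1) \<cdot>\<^sub>v (F *\<^sub>v v))"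
    proof -
      have c: "s \<cdot>\<^sub>m (1\<^sub>m n + (- 1) \<cdot>\<^sub>m F) \<in> carrier_mat n n" "(- 1) \<cdot>\<^sub>m F \<in> carrier_mat n n"
        "1\<^sub>m n + (- 1) \<cdot>\<^sub>m F \<in> carrier_mat n n"
        using F by auto
      have "(- 1) \<cdot>\<^sub>m F *\<^sub>v v = (- 1) \<cdot>\<^sub>v (F *\<^sub>v v)"
        by (rule smult_mat_mult_vec[OF F v(1)])
      moreover have "s \<cdot>\<^sub>m (1\<^sub>m n + (- 1) \<cdot>\<^sub>m F) *\<^sub>v v = s \<cdot>\<^sub>v ((1\<^sub>m n + (- 1) \<cdot>\<^sub>m F) *\<^sub>v v)"
        by (rule smult_mat_mult_vec[OF c(3) v(1)])
      ultimately show ?thesis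
        unfolding K_def using add_mult_distrib_mat_vec[OF C c(1) v(1)]
          add_mult_distrib_mat_vec[OF one_carrier_mat c(2) v(1)] v(1) by simp
    qed
    have "(C *\<^sub>v v + s \<cdot>\<^sub>v (v + (- 1) \<cdot>\<^sub>v (F *\<^sub>v v))) $ i = (e \<cdot>\<^sub>v v) $ i"
      using Kv v(3) by simp
    then have "(e - s) * ((F *\<^sub>v v) $ i - v $ i) = 0"
      unfolding CeF using v(1) Fv F i by (simp add: algebra_simps)
    then show "(F *\<^sub>v v) $ i = v $ i" using e by simp
  qed (use F v in auto)
  then show ?thesis using CeF v by auto
qed

section \<open>Counting pairs of distinct eigenvalues\<close>

lemma card_pairs_eq_sum:
  assumes "finite S" "finite T"
  shows "card {(s, t). s \<in> S \<and> t \<in> T \<and> P s t} = (\<Sum>t\<in>T. card {s\<in>S. P s t})"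
    and "card {(s, t). s \<in> S \<and> t \<in> T \<and> P s t} = (\<Sum>s\<in>S. card {t\<in>T. P s t})"
proof -
  have "{(s, t). s \<in> S \<and> t \<in> T \<and> P s t} = (SIGMA s:S. {t\<in>T. P s t})" by auto
  then show "card {(s, t). s \<in> S \<and> t \<in> T \<and> P s t} = (\<Sum>s\<in>S. card {t\<in>T. P s t})"
    using assms by simp
  have "{(s, t). s \<in> S \<and> t \<in> T \<and> P s t} = (\<lambda>(t, s). (s, t)) ` (SIGMA t:T. {s\<in>S. P s t})"
    by auto
  moreover have "inj_on (\<lambda>(t, s). (s, t)) (SIGMA t:T. {s\<in>S. P s t})"
    by (auto simp: inj_on_def)
  ultimately show "card {(s, t). s \<in> S \<and> t \<in> T \<and> P s t} = (\<Sum>t\<in>T. card {s\<in>S. P s t})"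
    using assms by (simp add: card_image)
qed

lemma sum_saturated:
  fixes f :: "'a \<Rightarrow> nat"
  assumes "finite T" "\<And>t. t \<in> T \<Longrightarrow> m \<le> f t" "(\<Sum>t\<in>T. f t) \<le> m * card T" "t \<in> T"
  shows "f t = m"
proof (rule ccontr)
  assume "f t \<noteq> m"
  then have "m < f t" using assms by (simp add: le_neq_implies_less)
  then have "(\<Sum>t\<in>T. m) < (\<Sum>t\<in>T. f t)"
    using assms by (intro sum_strict_mono_ex1) auto
  then show False using assms(3) by (simp add: mult.commute)
qed

text \<open>Otherwise changing the choice at the single place \<open>j\<close> would push the sum below its lower bound.\<close>

lemma saturated_choice_minimizes:
  fixes d :: "'j \<Rightarrow> 's \<Rightarrow> 'c"
  assumes "finite J" and lower: "\<And>e. m \<le> (\<Sum>j\<in>J. card {s\<in>S. d j s \<noteq> e j})"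
    and sat: "(\<Sum>j\<in>J. card {s\<in>S. d j s \<noteq> e0 j}) = m" and "j \<in> J"
  shows "card {s\<in>S. d j s \<noteq> e0 j} \<le> card {s\<in>S. d j s \<noteq> \<mu>}"
proof -
  let ?f = "\<lambda>e j. card {s\<in>S. d j s \<noteq> e j}"
  have "(\<Sum>i\<in>J. ?f e0 i) \<le> (\<Sum>i\<in>J. ?f (e0(j := \<mu>)) i)" using lower sat by simp
  then have "?f e0 j + (\<Sum>i\<in>J - {j}. ?f e0 i)
      \<le> ?f (e0(j := \<mu>)) j + (\<Sum>i\<in>J - {j}. ?f (e0(j := \<mu>)) i)"
    using sum.remove[OF assms(1,4), of "?f e0"] sum.remove[OF assms(1,4), of "?f (e0(j := \<mu>))"]
    by simp
  moreover have "(\<Sum>i\<in>J - {j}. ?f (e0(j := \<mu>)) i) = (\<Sum>i\<in>J - {j}. ?f e0 i)"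
    by (rule sum.cong) auto
  ultimately show ?thesis by simp
qed

lemma two_halves:
  fixes w :: "'j \<Rightarrow> nat"
  assumes "finite J" "0 < m" "(\<Sum>j\<in>J. w j) = m"
    and "\<And>j. j \<in> J \<Longrightarrow> w j < m" "\<And>j. j \<in> J \<Longrightarrow> w j \<noteq> 0 \<Longrightarrow> m \<le> 2 * w j"
  shows "\<exists>a\<in>J. \<exists>b\<in>J. 2 * w a = m \<and> 2 * w b = m \<and> (\<forall>j\<in>J - {a, b}. w j = 0)"
proof -
  obtain a where a: "a \<in> J" "w a \<noteq> 0" using assms(2,3) by (metis not_less_iff_gr_or_eq sum.neutral)
  have 1: "w a + (\<Sum>j\<in>J - {a}. w j) = m" using assms(1,3) a sum.remove by metis
  then have "(\<Sum>j\<in>J - {a}. w j) \<noteq> 0" using assms(4)[OF a(1)] by auto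
  then obtain b where b: "b \<in> J - {a}" "w b \<noteq> 0" by (metis sum.neutral)
  have 2: "(\<Sum>j\<in>J - {a}. w j) = w b + (\<Sum>j\<in>J - {a} - {b}. w j)"
    using assms(1) b by (meson finite_Diff sum.remove)
  have "m \<le> 2 * w a" "m \<le> 2 * w b" using assms(5) a b by auto
  then have "2 * w a = m" "2 * w b = m" "(\<Sum>j\<in>J - {a} - {b}. w j) = 0" using 1 2 by linarith+
  moreover have "J - {a, b} = J - {a} - {b}" by auto
  ultimately show ?thesis using a b assms(1) by (intro bexI[of _ a] bexI[of _ b]) auto
qed

text \<open>For fixed \<open>t\<close> the choice \<open>e j = d j t\<close> in the hypothesis on \<open>S\<close> bounds the number of pairs \<open>(j, s)\<close>
  below by \<open>card S\<close>; the sum over \<open>t\<close> is at most \<open>card S * card T\<close>, so each bound is attained, and likewise with the roles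
  of \<open>S\<close> and \<open>T\<close> exchanged. Hence every value that \<open>d j\<close> takes on \<open>T\<close> is a most frequent value of \<open>d j\<close>
  on \<open>S\<close>, and conversely, which makes all fibres of \<open>d j\<close> on \<open>S\<close> equally large. If \<open>w j\<close> is the size of the
  complement of a fibre, then \<open>w j\<close> is 0 or at least half of \<open>card S\<close>, it is less than \<open>card S\<close>, and the
  \<open>w j\<close> sum to \<open>card S\<close>: exactly two of them are nonzero, and these are halves.\<close>

lemma few_distinct_pairs_imp_two_valued:
  fixes d :: "'j \<Rightarrow> nat \<Rightarrow> 'c"
  assumes fin: "finite J" "finite S" "finite T" and ne: "S \<noteq> {}" "T \<noteq> {}"
    and S: "\<And>e. card S \<le> (\<Sum>j\<in>J. card {s\<in>S. d j s \<noteq> e j})"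
    and T: "\<And>e. card T \<le> (\<Sum>j\<in>J. card {t\<in>T. d j t \<noteq> e j})"
    and few: "(\<Sum>j\<in>J. card {(s, t). s \<in> S \<and> t \<in> T \<and> d j s \<noteq> d j t}) \<le> card S * card T"
  shows "\<exists>a\<in>J. \<exists>b\<in>J. (\<exists>\<alpha> \<alpha>'. d a ` S = {\<alpha>, \<alpha>'}) \<and> (\<exists>\<beta> \<beta>'. d b ` S = {\<beta>, \<beta>'}) \<and>
    (\<forall>j\<in>J - {a, b}. \<exists>e. d j ` S = {e})"
proof -
  let ?A = "\<lambda>j \<mu>. card {s\<in>S. d j s \<noteq> \<mu>}" and ?B = "\<lambda>j \<mu>. card {t\<in>T. d j t \<noteq> \<mu>}"
  have sumT: "(\<Sum>j\<in>J. ?A j (d j t)) = card S" if "t \<in> T" for t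
  proof (rule sum_saturated[OF fin(3) _ _ that])
    have "(\<Sum>t\<in>T. \<Sum>j\<in>J. ?A j (d j t))
        = (\<Sum>j\<in>J. card {(s, t). s \<in> S \<and> t \<in> T \<and> d j s \<noteq> d j t})"
      by (subst sum.swap) (simp add: card_pairs_eq_sum(1)[OF fin(2,3)])
    with few show "(\<Sum>t\<in>T. \<Sum>j\<in>J. ?A j (d j t)) \<le> card S * card T" by simp
  qed (rule S)
  have sumS: "(\<Sum>j\<in>J. ?B j (d j s)) = card T" if "s \<in> S" for s
  proof (rule sum_saturated[OF fin(2) _ _ that])
    have sym: "{t\<in>T. d j t \<noteq> d j s} = {t\<in>T. d j s \<noteq> d j t}" for j s by auto
    have "(\<Sum>s\<in>S. \<Sum>j\<in>J. ?B j (d j s))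
        = (\<Sum>j\<in>J. card {(s, t). s \<in> S \<and> t \<in> T \<and> d j s \<noteq> d j t})"
      by (subst sum.swap) (simp add: card_pairs_eq_sum(2)[OF fin(2,3)] sym)
    with few show "(\<Sum>s\<in>S. \<Sum>j\<in>J. ?B j (d j s)) \<le> card T * card S" by (simp add: mult.commute)
  qed (rule T)
  have minS: "?A j (d j t) \<le> ?A j \<mu>" if "t \<in> T" "j \<in> J" for j t \<mu>
    by (rule saturated_choice_minimizes[OF fin(1) S, of "\<lambda>j. d j t"]) (use sumT that in auto)
  have minT: "?B j (d j s) \<le> ?B j \<mu>" if "s \<in> S" "j \<in> J" for j s \<mu>
    by (rule saturated_choice_minimizes[OF fin(1) T, of "\<lambda>j. d j s"]) (use sumS that in auto)
  \<comment> \<open>All fibres of \<open>d j\<close> on \<open>S\<close> turn out to have the same size; \<open>w j\<close> is the size of their complements.\<close>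
  obtain t0 where t0: "t0 \<in> T" using ne by auto
  define w where "w j = ?A j (d j t0)" for j
  have w: "?A j (d j s) = w j" if "s \<in> S" "j \<in> J" for j s
  proof -
    have "?B j (d j s) \<le> ?B j (d j t0)" using minT that by blast
    also have "\<dots> < card T" using fin(3) t0 by (intro psubset_card_mono) auto
    finally have "{t\<in>T. d j t \<noteq> d j s} \<noteq> T" by (metis less_irrefl)
    then obtain t where "t \<in> T" "d j t = d j s" by blast
    then have "?A j (d j s) \<le> w j" using minS[of t j] that by (simp add: w_def)
    moreover have "w j \<le> ?A j (d j s)" using minS[OF t0] that by (simp add: w_def)
    ultimately show ?thesis by simp
  qed
  have fibre: "card {s'\<in>S. d j s' = d j s} + w j = card S" if "s \<in> S" "j \<in> J" for j s
  proof -
    have "card ({s'\<in>S. d j s' = d j s} \<union> {s'\<in>S. d j s' \<noteq> d j s})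
        = card {s'\<in>S. d j s' = d j s} + ?A j (d j s)"
      by (rule card_Un_disjoint) (use fin(2) in auto)
    moreover have "{s'\<in>S. d j s' = d j s} \<union> {s'\<in>S. d j s' \<noteq> d j s} = S" by blast
    ultimately have "card S = card {s'\<in>S. d j s' = d j s} + ?A j (d j s)" by simp
    then show ?thesis using w[OF that] by simp
  qed
  have two_classes: "card {s'\<in>S. d j s' = d j s1} + card {s'\<in>S. d j s' = d j s2}
      = card ({s'\<in>S. d j s' = d j s1} \<union> {s'\<in>S. d j s' = d j s2})"
    if "d j s1 \<noteq> d j s2" for j s1 s2
    by (rule card_Un_disjoint[symmetric]) (use fin(2) that in auto)
  obtain s0 where s0: "s0 \<in> S" using ne by auto
  have other: "\<exists>s\<in>S. d j s \<noteq> d j s0" if "j \<in> J" "w j \<noteq> 0" for j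
  proof (rule ccontr)
    assume "\<not> ?thesis"
    then have "{s\<in>S. d j s \<noteq> d j s0} = {}" by auto
    then have "?A j (d j s0) = 0" by (metis card.empty)
    then show False using w[OF s0 that(1)] that(2) by simp
  qed
  have "\<exists>a\<in>J. \<exists>b\<in>J. 2 * w a = card S \<and> 2 * w b = card S \<and> (\<forall>j\<in>J - {a, b}. w j = 0)"
  proof (rule two_halves[OF fin(1)])
    show "0 < card S" using ne fin by (simp add: card_gt_0_iff)
    show "(\<Sum>j\<in>J. w j) = card S" using sumT[OF t0] by (simp add: w_def)
    fix j assume j: "j \<in> J"
    have "0 < card {s'\<in>S. d j s' = d j s0}" using fin(2) s0 by (auto simp: card_gt_0_iff)
    then show "w j < card S" using fibre[OF s0 j] by simp
    assume "w j \<noteq> 0"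
    then obtain s1 where s1: "s1 \<in> S" "d j s1 \<noteq> d j s0" using other[OF j] by auto
    have "card {s'\<in>S. d j s' = d j s1} + card {s'\<in>S. d j s' = d j s0} \<le> card S"
      using two_classes[OF s1(2)] fin(2) by (simp add: card_mono)
    then show "card S \<le> 2 * w j" using fibre[OF s0 j] fibre[OF s1(1) j] by linarith
  qed
  then obtain a b where ab: "a \<in> J" "b \<in> J" "2 * w a = card S" "2 * w b = card S"
    and rest: "\<forall>j\<in>J - {a, b}. w j = 0" by blast
  have two: "\<exists>\<alpha> \<alpha>'. d j ` S = {\<alpha>, \<alpha>'}" if j: "j \<in> J" "2 * w j = card S" for j
  proof -
    have "w j \<noteq> 0" using j ne fin(2) by (metis card_0_eq mult_0_right)
    then obtain s1 where s1: "s1 \<in> S" "d j s1 \<noteq> d j s0" using other[OF j(1)] by auto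
    let ?U = "{s'\<in>S. d j s' = d j s1} \<union> {s'\<in>S. d j s' = d j s0}"
    have "card ?U = card S"
      using two_classes[OF s1(2)] fibre[OF s0 j(1)] fibre[OF s1(1) j(1)] j(2) by linarith
    then have "?U = S" using fin(2) by (intro card_subset_eq) auto
    then have "d j ` S = {d j s1, d j s0}" using s0 s1(1) by blast
    then show ?thesis by blast
  qed
  have "\<exists>e. d j ` S = {e}" if "j \<in> J - {a, b}" for j
  proof -
    have j: "w j = 0" "j \<in> J" using rest that by auto
    have "card {s\<in>S. d j s \<noteq> d j s0} = 0" using w[OF s0 j(2)] j(1) by simp
    then have "{s\<in>S. d j s \<noteq> d j s0} = {}" using fin(2) by simp
    then have "d j s = d j s0" if "s \<in> S" for s using that by blast
    then have "d j ` S = {d j s0}" using s0 by blast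
    then show ?thesis by blast
  qed
  then show ?thesis
    using two[OF ab(1,3)] two[OF ab(2,4)]
    by (intro bexI[OF _ ab(1)] bexI[OF _ ab(2)] conjI ballI)
qed

section \<open>Invariant lines and planes\<close>

text \<open>The columns of the injective matrix \<open>W\<close> form a basis of the invariant subspace, and \<open>T\<close> is the matrix of
  the restriction of \<open>M j\<close> in this basis.\<close>

definition carries_invariant_subspace ::
    "nat \<Rightarrow> 'j set \<Rightarrow> ('j \<Rightarrow> complex mat) \<Rightarrow> nat \<Rightarrow> bool" where
  "carries_invariant_subspace n J M N \<longleftrightarrow>
     (\<exists>W \<in> carrier_mat n N. (\<forall>v \<in> carrier_vec N. W *\<^sub>v v = 0\<^sub>v n \<longrightarrow> v = 0\<^sub>v N) \<and>
        (\<forall>j \<in> J. \<exists>T \<in> carrier_mat N N. M j * W = W * T))"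

lemma common_eigenvector_imp_invariant_line:
  assumes M: "\<And>j. j \<in> J \<Longrightarrow> M j \<in> carrier_mat n n"
    and v: "v \<in> carrier_vec n" "v \<noteq> 0\<^sub>v n"
    and eig: "\<And>j. j \<in> J \<Longrightarrow> \<exists>e. M j *\<^sub>v v = e \<cdot>\<^sub>v v"
  shows "carries_invariant_subspace n J M 1"
proof -
  define W where "W = mat n 1 (\<lambda>(i, _). v $ i)"
  have W: "W \<in> carrier_mat n 1" by (simp add: W_def)
  have "u = 0\<^sub>v 1" if u: "u \<in> carrier_vec 1" "W *\<^sub>v u = 0\<^sub>v n" for u
  proof -
    obtain i where i: "i < n" "v $ i \<noteq> 0" using v by (metis eq_vecI index_zero_vec carrier_vecD)
    have "0 = (W *\<^sub>v u) $ i" using u(2) i(1) by simp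
    also have "\<dots> = v $ i * u $ 0"
      unfolding mult_mat_vec_entry[OF W u(1) i(1)] using i(1) by (simp add: W_def)
    finally have "v $ i * u $ 0 = 0" by simp
    then show ?thesis using i u(1) by (intro eq_vecI) auto
  qed
  moreover have "\<exists>T \<in> carrier_mat 1 1. M j * W = W * T" if j: "j \<in> J" for j
  proof -
    obtain e where e: "M j *\<^sub>v v = e \<cdot>\<^sub>v v" using eig[OF j] by blast
    define T :: "complex mat" where "T = mat 1 1 (\<lambda>_. e)"
    have T: "T \<in> carrier_mat 1 1" by (simp add: T_def)
    have "M j * W = W * T"
    proof (rule eq_matI)
      fix i k assume "i < dim_row (W * T)" "k < dim_col (W * T)"
      then have ik: "i < n" "k < 1" using W T by auto
      have "(M j * W) $$ (i, k) = (M j *\<^sub>v v) $ i"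
        unfolding mult_mat_entry[OF M[OF j] W ik] mult_mat_vec_entry[OF M[OF j] v(1) ik(1)]
        by (rule sum.cong) (use ik in \<open>auto simp: W_def\<close>)
      also have "\<dots> = (W * T) $$ (i, k)"
        unfolding mult_mat_entry[OF W T ik] using ik e v by (simp add: W_def T_def)
      finally show "(M j * W) $$ (i, k) = (W * T) $$ (i, k)" .
    qed (use M[OF j] W T in auto)
    with T show ?thesis by blast
  qed
  ultimately show ?thesis using W unfolding carries_invariant_subspace_def by blast
qed

lemma invariant_pair_imp_invariant_plane:
  assumes M: "\<And>j. j \<in> J \<Longrightarrow> M j \<in> carrier_mat n n"
    and v: "v \<in> carrier_vec n" "w \<in> carrier_vec n"
    and ind: "\<And>a b. a \<cdot>\<^sub>v v + b \<cdot>\<^sub>v w = 0\<^sub>v n \<Longrightarrow> a = 0 \<and> b = 0"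
    and inv: "\<And>j. j \<in> J \<Longrightarrow> \<exists>a b c d. M j *\<^sub>v v = a \<cdot>\<^sub>v v + b \<cdot>\<^sub>v w \<and> M j *\<^sub>v w = c \<cdot>\<^sub>v v + d \<cdot>\<^sub>v w"
  shows "carries_invariant_subspace n J M 2"
proof -
  define W where "W = mat n 2 (\<lambda>(i, k). if k = 0 then v $ i else w $ i)"
  have W: "W \<in> carrier_mat n 2" by (simp add: W_def)
  have two: "(\<Sum>l<2. f l) = f 0 + f 1" for f :: "nat \<Rightarrow> complex" by (simp add: numeral_2_eq_2)
  have "u = 0\<^sub>v 2" if u: "u \<in> carrier_vec 2" "W *\<^sub>v u = 0\<^sub>v n" for u
  proof -
    have "u $ 0 \<cdot>\<^sub>v v + u $ 1 \<cdot>\<^sub>v w = 0\<^sub>v n"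
    proof (rule eq_vecI)
      fix i assume "i < dim_vec (0\<^sub>v n :: complex vec)"
      then have i: "i < n" by simp
      have "0 = (W *\<^sub>v u) $ i" using u(2) i by simp
      also have "\<dots> = v $ i * u $ 0 + w $ i * u $ 1"
        unfolding mult_mat_vec_entry[OF W u(1) i] two using i by (simp add: W_def)
      finally show "(u $ 0 \<cdot>\<^sub>v v + u $ 1 \<cdot>\<^sub>v w) $ i = 0\<^sub>v n $ i"
        using i v by (simp add: mult.commute)
    qed (use v in auto)
    from ind[OF this] show ?thesis using u(1)
      by (intro eq_vecI) (auto simp: numeral_2_eq_2 less_Suc_eq)
  qed
  moreover have "\<exists>T \<in> carrier_mat 2 2. M j * W = W * T" if j: "j \<in> J" for j
  proof -
    obtain a b c d where e: "M j *\<^sub>v v = a \<cdot>\<^sub>v v + b \<cdot>\<^sub>v w" "M j *\<^sub>v w = c \<cdot>\<^sub>v v + d \<cdot>\<^sub>v w"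
      using inv[OF j] by blast
    define T where "T = mat 2 2 (\<lambda>(i, k). if k = 0 then (if i = 0 then a else b)
      else (if i = (0::nat) then c else d))"
    have T: "T \<in> carrier_mat 2 2" by (simp add: T_def)
    have "M j * W = W * T"
    proof (rule eq_matI)
      fix i k assume "i < dim_row (W * T)" "k < dim_col (W * T)"
      then have ik: "i < n" "k < 2" using W T by auto
      have "(M j * W) $$ (i, k) = (M j *\<^sub>v (if k = 0 then v else w)) $ i"
        unfolding mult_mat_entry[OF M[OF j] W ik]
        by (subst mult_mat_vec_entry[OF M[OF j] _ ik(1)])
          (use v ik in \<open>auto simp: W_def intro!: sum.cong\<close>)
      also have "\<dots> = (W * T) $$ (i, k)"
        unfolding mult_mat_entry[OF W T ik] two
        using ik e v by (auto simp: W_def T_def mult.commute)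
      finally show "(M j * W) $$ (i, k) = (W * T) $$ (i, k)" .
    qed (use M[OF j] W T in auto)
    with T show ?thesis by blast
  qed
  ultimately show ?thesis using W unfolding carries_invariant_subspace_def by blast
qed

lemma conj_mult:
  fixes U :: "'a::comm_ring_1 mat"
  assumes "U \<in> carrier_mat n n" "U' \<in> carrier_mat n n" "U' * U = 1\<^sub>m n"
    and "A \<in> carrier_mat n n" "B \<in> carrier_mat n n"
  shows "(U * A * U') * (U * B * U') = U * (A * B) * U'"
proof -
  have UA: "U * A \<in> carrier_mat n n" and BU': "B * U' \<in> carrier_mat n n" using assms by auto
  have "(U * A * U') * (U * B * U') = (U * A) * (U' * (U * (B * U')))"
    using assms UA BU' by (simp add: assoc_mult_mat[of _ n n _ n _ n])
  also have "U' * (U * (B * U')) = (U' * U) * (B * U')"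
    by (rule assoc_mult_mat[symmetric, OF assms(2,1) BU'])
  also have "\<dots> = B * U'" using assms(3) left_mult_one_mat[OF BU'] by simp
  also have "(U * A) * (B * U') = U * (A * B) * U'"
    using assms by (simp add: assoc_mult_mat[of _ n n _ n _ n])
  finally show ?thesis .
qed

lemma conj_minus:
  fixes U :: "'a::comm_ring_1 mat"
  assumes "U \<in> carrier_mat n n" "U' \<in> carrier_mat n n" "A \<in> carrier_mat n n" "B \<in> carrier_mat n n"
  shows "U * A * U' - U * B * U' = U * (A - B) * U'"
  using assms by (simp add: mult_minus_distrib_mat[of _ n n _ n] minus_mult_distrib_mat[of _ n n _ _ n])

lemma triple_product_entry:
  fixes A B C :: "'a::comm_semiring_0 mat"
  assumes "A \<in> carrier_mat n n" "C \<in> carrier_mat n n" "B \<in> carrier_mat n n" "i < n" "k < n"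
  shows "(A * C * B) $$ (i, k)
    = (\<Sum>(s, t)\<in>{..<n} \<times> {..<n}. A $$ (i, s) * B $$ (t, k) * C $$ (s, t))"
proof -
  have AC: "A * C \<in> carrier_mat n n" using assms by simp
  have "(A * C * B) $$ (i, k) = (\<Sum>t<n. (\<Sum>s<n. A $$ (i, s) * C $$ (s, t)) * B $$ (t, k))"
    unfolding mult_mat_entry[OF AC assms(3-5)]
    by (rule sum.cong) (use assms mult_mat_entry[OF assms(1,2,4)] in auto)
  also have "\<dots> = (\<Sum>s<n. \<Sum>t<n. A $$ (i, s) * B $$ (t, k) * C $$ (s, t))"
    unfolding sum_distrib_right by (subst sum.swap) (intro sum.cong refl, simp add: mult_ac)
  finally show ?thesis by (simp add: sum.cartesian_product)
qed

section \<open>Solving the linearized condition in the corner\<close>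

text \<open>A tuple of matrices, each diagonalized by a basis adapted to the splitting. The vector
  \<open>U' j *\<^sub>v v\<close> consists of the coordinates of \<open>v\<close> in the eigenbasis of \<open>M j\<close>.\<close>

locale split_diagonalized_tuple =
  fixes n :: nat and S :: "nat set" and J :: "'j set"
    and M U U' :: "'j \<Rightarrow> complex mat" and d :: "'j \<Rightarrow> nat \<Rightarrow> complex"
  assumes finite_J: "finite J" and S_sub: "S \<subseteq> {..<n}"
    and U: "j \<in> J \<Longrightarrow> U j \<in> carrier_mat n n" and U': "j \<in> J \<Longrightarrow> U' j \<in> carrier_mat n n"
    and UU': "j \<in> J \<Longrightarrow> U j * U' j = 1\<^sub>m n" and U'U: "j \<in> J \<Longrightarrow> U' j * U j = 1\<^sub>m n"
    and split_U: "j \<in> J \<Longrightarrow> splits_along S (U j)" and split_U': "j \<in> J \<Longrightarrow> splits_along S (U' j)"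
    and M_eq: "j \<in> J \<Longrightarrow> M j = U j * mat_diag n (d j) * U' j"
begin

lemma M_carrier: "j \<in> J \<Longrightarrow> M j \<in> carrier_mat n n"
  using U U' M_eq by (metis mat_diag_dim mult_carrier_mat)

lemma finite_S: "finite S" using S_sub finite_subset by blast

definition supported :: "complex vec \<Rightarrow> bool" where
  "supported v \<longleftrightarrow> v \<in> carrier_vec n \<and> (\<forall>i<n. i \<notin> S \<longrightarrow> v $ i = 0)"

lemma supported_mult:
  assumes "A \<in> carrier_mat n n" "splits_along S A" "supported v"
  shows "supported (A *\<^sub>v v)"
  unfolding supported_def
proof (intro conjI allI impI)
  show "A *\<^sub>v v \<in> carrier_vec n" using assms by (auto simp: supported_def)
  fix i assume i: "i < n" "i \<notin> S"
  have v: "v \<in> carrier_vec n" using assms by (simp add: supported_def)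
  have "(\<Sum>l<n. A $$ (i, l) * v $ l) = 0"
  proof (intro sum.neutral ballI)
    fix l assume "l \<in> {..<n}"
    then show "A $$ (i, l) * v $ l = 0"
      using assms i unfolding supported_def splits_along_def by (cases "l \<in> S") auto
  qed
  then show "(A *\<^sub>v v) $ i = 0" using mult_mat_vec_entry[OF assms(1) v i(1)] by simp
qed

lemma U_U'_vec: "j \<in> J \<Longrightarrow> v \<in> carrier_vec n \<Longrightarrow> U j *\<^sub>v (U' j *\<^sub>v v) = v"
  using assoc_mult_mat_vec[OF U U'] UU' by (metis one_mult_mat_vec)

lemma U'_U_vec: "j \<in> J \<Longrightarrow> v \<in> carrier_vec n \<Longrightarrow> U' j *\<^sub>v (U j *\<^sub>v v) = v"
  using assoc_mult_mat_vec[OF U' U] U'U by (metis one_mult_mat_vec)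

lemma coord_carrier: "j \<in> J \<Longrightarrow> v \<in> carrier_vec n \<Longrightarrow> U' j *\<^sub>v v \<in> carrier_vec n"
  using mult_mat_vec_carrier[OF U'] .

lemma coord_conj:
  assumes "j \<in> J" "v \<in> carrier_vec n" "i < n"
  shows "(U' j *\<^sub>v ((U j * mat_diag n f * U' j) *\<^sub>v v)) $ i = f i * (U' j *\<^sub>v v) $ i"
proof -
  let ?D = "mat_diag n f"
  have D: "?D \<in> carrier_mat n n" by simp
  have x: "U' j *\<^sub>v v \<in> carrier_vec n" and Dx: "?D *\<^sub>v (U' j *\<^sub>v v) \<in> carrier_vec n"
    using coord_carrier[OF assms(1,2)] mult_mat_vec_carrier[OF D] by auto
  have "(U j * ?D * U' j) *\<^sub>v v = U j *\<^sub>v (?D *\<^sub>v (U' j *\<^sub>v v))"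
    using assoc_mult_mat_vec[OF mult_carrier_mat[OF U[OF assms(1)] D] U'[OF assms(1)] assms(2)]
      assoc_mult_mat_vec[OF U[OF assms(1)] D x] by simp
  then have "U' j *\<^sub>v ((U j * ?D * U' j) *\<^sub>v v) = ?D *\<^sub>v (U' j *\<^sub>v v)"
    using U'_U_vec[OF assms(1) Dx] by simp
  also have "(?D *\<^sub>v (U' j *\<^sub>v v)) $ i = (\<Sum>l<n. if l = i then f i * (U' j *\<^sub>v v) $ i else 0)"
    unfolding mult_mat_vec_entry[OF D x assms(3)]
    by (rule sum.cong) (use assms(3) in \<open>auto simp: mat_diag_def\<close>)
  finally show ?thesis using assms(3) by simp
qed

lemma coord_M:
  assumes "j \<in> J" "v \<in> carrier_vec n" "i < n"
  shows "(U' j *\<^sub>v (M j *\<^sub>v v)) $ i = d j i * (U' j *\<^sub>v v) $ i"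
  using coord_conj[OF assms] M_eq[OF assms(1)] by simp

lemma coord_eqI:
  assumes "j \<in> J" "v \<in> carrier_vec n" "w \<in> carrier_vec n"
    and "\<And>i. i < n \<Longrightarrow> (U' j *\<^sub>v v) $ i = (U' j *\<^sub>v w) $ i"
  shows "v = w"
proof -
  have "U' j *\<^sub>v v = U' j *\<^sub>v w"
    using assms(4) U'[OF assms(1)] by (intro eq_vecI) auto
  then show ?thesis using U_U'_vec[OF assms(1)] assms(2,3) by metis
qed

lemma coord_smult:
  assumes "j \<in> J" "v \<in> carrier_vec n" "i < n"
  shows "(U' j *\<^sub>v (c \<cdot>\<^sub>v v)) $ i = c * (U' j *\<^sub>v v) $ i"
  using mult_mat_vec[OF U'[OF assms(1)] assms(2)] carrier_matD(1)[OF U'[OF assms(1)]] assms(3)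
  by simp

lemma eigenvectorI:
  assumes "j \<in> J" "v \<in> carrier_vec n"
    and "\<And>i. i < n \<Longrightarrow> (U' j *\<^sub>v v) $ i \<noteq> 0 \<Longrightarrow> d j i = e"
  shows "M j *\<^sub>v v = e \<cdot>\<^sub>v v"
proof (rule coord_eqI[OF assms(1)])
  fix i assume i: "i < n"
  show "(U' j *\<^sub>v (M j *\<^sub>v v)) $ i = (U' j *\<^sub>v (e \<cdot>\<^sub>v v)) $ i"
    unfolding coord_M[OF assms(1,2) i] coord_smult[OF assms(1,2) i] using assms(3)[OF i] by auto
qed (use M_carrier[OF assms(1)] assms(2) in auto)

text \<open>A vector in the coordinate space of \<open>S\<close> has \<open>card S\<close> free coordinates. Being an eigenvector of \<open>M j\<close> with
  eigenvalue \<open>e j\<close> imposes one linear condition for each \<open>s \<in> S\<close> with \<open>d j s \<noteq> e j\<close>.\<close>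

lemma common_eigenvector_or_many_conditions:
  assumes "(\<Sum>j\<in>J. card {s\<in>S. d j s \<noteq> e j}) < card S"
  shows "carries_invariant_subspace n J M 1"
proof -
  define I where "I = (SIGMA j:J. {s\<in>S. d j s \<noteq> e j})"
  have "finite I" "card I < card S"
    using assms finite_J finite_S by (auto simp: I_def)
  from homogeneous_system_nontrivial_solution[OF this(1) finite_S this(2),
      of "\<lambda>(j, s) k. U' j $$ (s, k)"]
  obtain x where x: "\<exists>k\<in>S. x k \<noteq> 0" "\<forall>(j, s)\<in>I. (\<Sum>k\<in>S. U' j $$ (s, k) * x k) = 0"
    by (auto simp: case_prod_beta)
  define v where "v = vec n (\<lambda>i. if i \<in> S then x i else 0)"
  have v: "v \<in> carrier_vec n" "supported v" by (auto simp: v_def supported_def)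
  have "v \<noteq> 0\<^sub>v n"
  proof -
    obtain k where "k \<in> S" "x k \<noteq> 0" using x(1) by blast
    then have "k < n" "v $ k \<noteq> 0" using S_sub by (auto simp: v_def)
    then show ?thesis by auto
  qed
  moreover have "M j *\<^sub>v v = e j \<cdot>\<^sub>v v" if j: "j \<in> J" for j
  proof (rule eigenvectorI[OF j v(1)])
    fix i assume i: "i < n" "(U' j *\<^sub>v v) $ i \<noteq> 0"
    then have "i \<in> S"
      using supported_mult[OF U'[OF j] split_U'[OF j] v(2)] by (auto simp: supported_def)
    have "(U' j *\<^sub>v v) $ i = (\<Sum>k<n. if k \<in> S then U' j $$ (i, k) * x k else 0)"
      unfolding mult_mat_vec_entry[OF U'[OF j] v(1) i(1)]
      by (rule sum.cong) (auto simp: v_def)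
    also have "\<dots> = (\<Sum>k\<in>S. U' j $$ (i, k) * x k)"
      using S_sub by (simp add: sum.If_cases inf.absorb2)
    finally show "d j i = e j" using x(2) i(2) \<open>i \<in> S\<close> j by (force simp: I_def)
  qed
  ultimately show ?thesis
    by (intro common_eigenvector_imp_invariant_line[of J M n v]) (use M_carrier v in auto)
qed

text \<open>In the eigenbasis of \<open>M j\<close> the bracket with \<open>M j\<close> multiplies the entry \<open>(s, t)\<close> of a corner matrix by
  \<open>d j s - d j t\<close>. Hence the brackets are exactly the corner matrices supported on the pairs with
  \<open>d j s \<noteq> d j t\<close>. The entries at these pairs are the unknowns, and the entries in the corner of
  the sum of the \<open>L j * X j * R j\<close> are the equations.\<close>

lemma corner_deformation_exists:
  assumes many: "card S * card ({..<n} - S)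
      < (\<Sum>j\<in>J. card {(s, t). s \<in> S \<and> t \<in> {..<n} - S \<and> d j s \<noteq> d j t})"
    and L: "\<And>j. j \<in> J \<Longrightarrow> L j \<in> carrier_mat n n" "\<And>j. j \<in> J \<Longrightarrow> splits_along S (L j)"
    and R: "\<And>j. j \<in> J \<Longrightarrow> R j \<in> carrier_mat n n" "\<And>j. j \<in> J \<Longrightarrow> splits_along S (R j)"
  shows "\<exists>X Y. (\<forall>j\<in>J. X j \<in> carrier_mat n n \<and> Y j \<in> carrier_mat n n \<and> corner_along S (X j) \<and>
      corner_along S (Y j) \<and> X j = M j * Y j - Y j * M j) \<and> (\<exists>j\<in>J. X j \<noteq> 0\<^sub>m n n) \<and>
      (\<forall>i<n. \<forall>k<n. (\<Sum>j\<in>J. (L j * X j * R j) $$ (i, k)) = 0)"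
proof -
  let ?T = "{..<n} - S"
  define P where "P j = {(s, t). s \<in> S \<and> t \<in> ?T \<and> d j s \<noteq> d j t}" for j
  have P_sub: "P j \<subseteq> {..<n} \<times> {..<n}" for j using S_sub by (auto simp: P_def)
  have fin_P: "finite (P j)" for j using P_sub finite_subset by blast
  define K where "K = (SIGMA j:J. P j)"
  have "finite K" using finite_J fin_P by (auto simp: K_def)
  moreover have "card (S \<times> ?T) < card K"
    using many finite_J fin_P by (simp add: K_def P_def card_cartesian_product)
  moreover have "finite (S \<times> ?T)" using finite_S by simp
  ultimately obtain x where x: "\<exists>k\<in>K. x k \<noteq> 0"
    "\<forall>(a, b)\<in>S \<times> ?T. (\<Sum>(j, s, t)\<in>K. (L j * U j) $$ (a, s) * (U' j * R j) $$ (t, b) * x (j, s, t)) = 0"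
    using homogeneous_system_nontrivial_solution[of "S \<times> ?T" K
        "\<lambda>(a, b) (j, s, t). (L j * U j) $$ (a, s) * (U' j * R j) $$ (t, b)"]
    by (auto simp: case_prod_beta)
  define C where "C j = mat n n (\<lambda>(s, t). if (s, t) \<in> P j then x (j, s, t) else 0)" for j
  define E where "E j = mat n n (\<lambda>(s, t). if (s, t) \<in> P j then x (j, s, t) / (d j s - d j t) else 0)" for j
  have CE: "C j \<in> carrier_mat n n" "E j \<in> carrier_mat n n" for j by (auto simp: C_def E_def)
  have corner: "corner_along S (C j)" "corner_along S (E j)" for j
    by (auto simp: corner_along_def C_def E_def P_def)
  have C_in: "C j $$ (s, t) = x (j, s, t)" if "(s, t) \<in> P j" for j s t
    using that subsetD[OF P_sub that] by (simp add: C_def)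
  have C_out: "C j $$ (s, t) = 0" if "(s, t) \<notin> P j" "s < n" "t < n" for j s t
    using that by (simp add: C_def)
  define X where "X j = U j * C j * U' j" for j
  define Y where "Y j = U j * E j * U' j" for j
  have X: "X j \<in> carrier_mat n n" "Y j \<in> carrier_mat n n" if "j \<in> J" for j
    unfolding X_def Y_def
    by (intro mult_carrier_mat[OF mult_carrier_mat[OF U[OF that]] U'[OF that]] CE)+
  have corner_XY: "corner_along S (X j)" "corner_along S (Y j)" if j: "j \<in> J" for j
    unfolding X_def Y_def
    using corner_along_mult_right[OF U'[OF j] mult_carrier_mat[OF U[OF j] CE(1)] split_U'[OF j]
        corner_along_mult_left[OF U[OF j] CE(1) split_U[OF j] corner(1)]]
      corner_along_mult_right[OF U'[OF j] mult_carrier_mat[OF U[OF j] CE(2)] split_U'[OF j]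
        corner_along_mult_left[OF U[OF j] CE(2) split_U[OF j] corner(2)]] by auto
  have bracket: "X j = M j * Y j - Y j * M j" if j: "j \<in> J" for j
  proof -
    let ?D = "mat_diag n (d j)"
    have D: "?D \<in> carrier_mat n n" by simp
    have "?D * E j - E j * ?D = C j"
      unfolding mat_diag_mult_left[OF CE(2)] mat_diag_mult_right[OF CE(2)]
      by (rule eq_matI) (auto simp: C_def E_def P_def field_simps)
    moreover have "M j * Y j = U j * (?D * E j) * U' j"
      unfolding M_eq[OF j] Y_def by (rule conj_mult[OF U[OF j] U'[OF j] U'U[OF j] D CE(2)])
    moreover have "Y j * M j = U j * (E j * ?D) * U' j"
      unfolding M_eq[OF j] Y_def by (rule conj_mult[OF U[OF j] U'[OF j] U'U[OF j] CE(2) D])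
    moreover have "U j * (?D * E j) * U' j - U j * (E j * ?D) * U' j
        = U j * (?D * E j - E j * ?D) * U' j"
      by (rule conj_minus[OF U[OF j] U'[OF j] mult_carrier_mat[OF D CE(2)] mult_carrier_mat[OF CE(2) D]])
    ultimately show ?thesis by (simp add: X_def)
  qed
  have nz: "\<exists>j\<in>J. X j \<noteq> 0\<^sub>m n n"
  proof -
    obtain j s t where jst: "j \<in> J" "(s, t) \<in> P j" "x (j, s, t) \<noteq> 0" using x(1) by (auto simp: K_def)
    have st: "s < n" "t < n" using jst(2) P_sub by auto
    have "X j \<noteq> 0\<^sub>m n n"
    proof
      assume z: "X j = 0\<^sub>m n n"
      have "U' j * X j * U j = (U' j * U j) * C j * (U' j * U j)"
        unfolding X_def using U[OF jst(1)] U'[OF jst(1)] CE(1)[of j]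
        by (simp add: assoc_mult_mat[of _ n n _ n _ n])
      then have "C j = 0\<^sub>m n n"
        using z U[OF jst(1)] U'[OF jst(1)] CE(1)[of j] U'U[OF jst(1)] by simp
      then have "C j $$ (s, t) = 0" using st by simp
      then show False using jst st by (simp add: C_def)
    qed
    then show ?thesis using jst(1) by blast
  qed
  have "(\<Sum>j\<in>J. (L j * X j * R j) $$ (i, k)) = 0" if ik: "i < n" "k < n" for i k
  proof (cases "i \<in> S \<and> k \<notin> S")
    case True
    have "(L j * X j * R j) $$ (i, k)
        = (\<Sum>(s, t)\<in>P j. (L j * U j) $$ (i, s) * (U' j * R j) $$ (t, k) * x (j, s, t))"
      if j: "j \<in> J" for j
    proof -
      note c = L(1)[OF j] R(1)[OF j] U[OF j] U'[OF j] CE(1)[of j]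
      have "L j * X j * R j = (L j * U j) * C j * (U' j * R j)"
        unfolding X_def using c by (simp add: assoc_mult_mat[of _ n n _ n _ n])
      then have "(L j * X j * R j) $$ (i, k) = (\<Sum>(s, t)\<in>{..<n} \<times> {..<n}.
          (L j * U j) $$ (i, s) * (U' j * R j) $$ (t, k) * C j $$ (s, t))"
        using triple_product_entry[OF mult_carrier_mat[OF c(1,3)] c(5) mult_carrier_mat[OF c(4,2)] ik]
        by simp
      also have "\<dots> = (\<Sum>(s, t)\<in>P j. (L j * U j) $$ (i, s) * (U' j * R j) $$ (t, k) * x (j, s, t))"
        by (rule sum.mono_neutral_cong_right) (use P_sub in \<open>auto simp: C_in C_out\<close>)
      finally show ?thesis .
    qed
    then have "(\<Sum>j\<in>J. (L j * X j * R j) $$ (i, k))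
        = (\<Sum>j\<in>J. \<Sum>(s, t)\<in>P j. (L j * U j) $$ (i, s) * (U' j * R j) $$ (t, k) * x (j, s, t))"
      by simp
    also have "\<dots> = (\<Sum>(j, s, t)\<in>K. (L j * U j) $$ (i, s) * (U' j * R j) $$ (t, k) * x (j, s, t))"
      unfolding K_def using finite_J fin_P by (simp add: sum.Sigma)
    also have "\<dots> = 0" using x(2) True ik by auto
    finally show ?thesis .
  next
    case False
    have "(L j * X j * R j) $$ (i, k) = 0" if j: "j \<in> J" for j
    proof -
      have c: "L j * X j \<in> carrier_mat n n" using L(1)[OF j] X[OF j] by auto
      have "corner_along S (L j * X j * R j)"
        by (intro corner_along_mult_right[OF R(1)[OF j] c R(2)[OF j]]
            corner_along_mult_left[OF L(1)[OF j] X(1)[OF j] L(2)[OF j] corner_XY(1)[OF j]])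
      moreover have "L j * X j * R j \<in> carrier_mat n n" using c R(1)[OF j] by (rule mult_carrier_mat)
      ultimately show ?thesis using False ik unfolding corner_along_def
        by (metis carrier_matD)
    qed
    then show ?thesis by simp
  qed
  then show ?thesis using X corner_XY bracket nz by (intro exI[of _ X] exI[of _ Y]) auto
qed

end

context split_diagonalized_tuple
begin

text \<open>On the coordinate space of \<open>S\<close> the operator \<open>G = (M a - \<alpha>') (M b - \<beta>)\<close> maps the \<open>\<alpha>\<close>-eigenspace of
  \<open>M a\<close> into itself, because \<open>(M a - \<alpha>) (M a - \<alpha>')\<close> vanishes there. Let \<open>v\<close> be an eigenvector of \<open>G\<close>
  in this eigenspace and \<open>w = (M b - \<beta>) v\<close>. Then \<open>M a\<close> maps \<open>w\<close> to \<open>\<alpha>' w + t v\<close> and \<open>M b\<close> maps \<open>w\<close> to \<open>\<beta>' w\<close>,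
  so the span of \<open>v\<close> and \<open>w\<close> is invariant under both; all other matrices are scalar there.\<close>

lemma two_valued_imp_small_invariant_subspace:
  assumes ab: "a \<in> J" "b \<in> J"
    and a: "d a ` S = {\<alpha>, \<alpha>'}" and b: "d b ` S = {\<beta>, \<beta>'}"
    and rest: "\<And>j. j \<in> J - {a, b} \<Longrightarrow> \<exists>e. d j ` S = {e}"
  shows "carries_invariant_subspace n J M 1 \<or> carries_invariant_subspace n J M 2"
proof -
  let ?A = "M a" and ?B = "M b"
  note A = M_carrier[OF ab(1)] and B = M_carrier[OF ab(2)]
  \<comment> \<open>\<open>F\<close> projects onto the \<open>\<alpha>\<close>-eigenspace of \<open>M a\<close> inside the coordinate space of \<open>S\<close>.\<close>
  define E where "E = {s\<in>S. d a s = \<alpha>}"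
  have "\<alpha> \<in> d a ` S" using a by simp
  then have "E \<noteq> {}" by (auto simp: E_def)
  have E_sub: "E \<subseteq> {..<n}" using S_sub by (auto simp: E_def)
  define F where "F = U a * coord_proj n E * U' a"
  have D: "coord_proj n E \<in> carrier_mat n n" by simp
  have F: "F \<in> carrier_mat n n" using U[OF ab(1)] U'[OF ab(1)] D unfolding F_def by auto
  have "coord_proj n E * coord_proj n E = coord_proj n E"
    unfolding mat_diag_diag by (rule arg_cong[of _ _ "mat_diag n"]) auto
  then have FF: "F * F = F"
    unfolding F_def using conj_mult[OF U[OF ab(1)] U'[OF ab(1)] U'U[OF ab(1)] D D] by simp
  have "mat_trace F = of_nat (card E)"
    unfolding F_def using mat_trace_similar[OF U[OF ab(1)] D U'[OF ab(1)] U'U[OF ab(1)]]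
      mat_trace_coord_proj[OF E_sub] by simp
  then have tr: "mat_trace F \<noteq> 0"
    using \<open>E \<noteq> {}\<close> finite_subset[OF E_sub] by simp
  define GA where "GA = ?A + (- \<alpha>') \<cdot>\<^sub>m 1\<^sub>m n"
  define GB where "GB = ?B + (- \<beta>) \<cdot>\<^sub>m 1\<^sub>m n"
  have GAB: "GA \<in> carrier_mat n n" "GB \<in> carrier_mat n n" using A B by (auto simp: GA_def GB_def)
  have GA_vec: "GA *\<^sub>v u = ?A *\<^sub>v u + (- \<alpha>') \<cdot>\<^sub>v u"
    and GB_vec: "GB *\<^sub>v u = ?B *\<^sub>v u + (- \<beta>) \<cdot>\<^sub>v u" if "u \<in> carrier_vec n" for u
    unfolding GA_def GB_def
    using add_mult_distrib_mat_vec[OF A _ that] add_mult_distrib_mat_vec[OF B _ that]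
      smult_mat_mult_vec[OF one_carrier_mat that] that by auto
  define G where "G = GA * GB"
  have G: "G \<in> carrier_mat n n" using GAB by (simp add: G_def)
  define C where "C = F * G * F"
  have FG: "F * G \<in> carrier_mat n n" using F G by simp
  have C: "C \<in> carrier_mat n n" using F FG by (simp add: C_def)
  have "F * C = (F * (F * G)) * F" unfolding C_def by (rule assoc_mult_mat[symmetric, OF F FG F])
  also have "F * (F * G) = (F * F) * G" by (rule assoc_mult_mat[symmetric, OF F F G])
  finally have FC: "F * C = C" by (simp add: FF C_def)
  have CF: "C * F = C" unfolding C_def using assoc_mult_mat[OF FG F F] FF by simp
  obtain v t where v: "v \<in> carrier_vec n" "v \<noteq> 0\<^sub>v n" and Fv: "F *\<^sub>v v = v" and Cv: "C *\<^sub>v v = t \<cdot>\<^sub>v v"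
    using eigenvector_in_range_of_projection[OF F C FF FC CF tr] by blast
  have xE: "i \<in> E" if "i < n" "(U' a *\<^sub>v v) $ i \<noteq> 0" for i
    using coord_conj[OF ab(1) v(1) that(1), of "\<lambda>i. if i \<in> E then 1 else 0"] Fv that(2)
    unfolding F_def by (auto split: if_splits)
  have Av: "?A *\<^sub>v v = \<alpha> \<cdot>\<^sub>v v"
    by (rule eigenvectorI[OF ab(1) v(1)]) (use xE in \<open>auto simp: E_def\<close>)
  have "supported (U' a *\<^sub>v v)"
    unfolding supported_def using coord_carrier[OF ab(1) v(1)] xE by (auto simp: E_def)
  then have supp_v: "supported v"
    using supported_mult[OF U[OF ab(1)] split_U[OF ab(1)]] U_U'_vec[OF ab(1) v(1)] by metis
  have supp_coord: "i \<in> S" if "j \<in> J" "supported u" "i < n" "(U' j *\<^sub>v u) $ i \<noteq> 0" for i j u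
    using supported_mult[OF U'[OF that(1)] split_U'[OF that(1)] that(2)] that(3,4)
    by (auto simp: supported_def)
  define w where "w = GB *\<^sub>v v"
  have w: "w \<in> carrier_vec n" unfolding w_def using GAB(2) v(1) by (rule mult_mat_vec_carrier)
  have coord_GB: "(U' b *\<^sub>v w) $ i = (d b i - \<beta>) * (U' b *\<^sub>v v) $ i" if i: "i < n" for i
  proof -
    have Bv: "?B *\<^sub>v v \<in> carrier_vec n" using B v(1) by (rule mult_mat_vec_carrier)
    have sv: "(- \<beta>) \<cdot>\<^sub>v v \<in> carrier_vec n" using v(1) by simp
    have "U' b *\<^sub>v w = U' b *\<^sub>v (?B *\<^sub>v v) + U' b *\<^sub>v ((- \<beta>) \<cdot>\<^sub>v v)"
      unfolding w_def GB_vec[OF v(1)] by (rule mult_add_distrib_mat_vec[OF U'[OF ab(2)] Bv sv])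
    then show ?thesis
      using coord_M[OF ab(2) v(1) i] coord_smult[OF ab(2) v(1) i, of "- \<beta>"] i
        carrier_vecD[OF coord_carrier[OF ab(2) sv]] carrier_vecD[OF coord_carrier[OF ab(2) Bv]]
      by (simp add: algebra_simps)
  qed
  have "supported (U' b *\<^sub>v w)"
    unfolding supported_def
    using coord_carrier[OF ab(2) w] coord_GB supp_coord[OF ab(2) supp_v] by auto
  then have supp_w: "supported w"
    using supported_mult[OF U[OF ab(2)] split_U[OF ab(2)]] U_U'_vec[OF ab(2) w] by metis
  define y where "y = GA *\<^sub>v w"
  have y: "y \<in> carrier_vec n" unfolding y_def using GAB(1) w by (rule mult_mat_vec_carrier)
  have coord_GA: "(U' a *\<^sub>v y) $ i = (d a i - \<alpha>') * (U' a *\<^sub>v w) $ i" if i: "i < n" for i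
  proof -
    have Aw: "?A *\<^sub>v w \<in> carrier_vec n" using A w by (rule mult_mat_vec_carrier)
    have sw: "(- \<alpha>') \<cdot>\<^sub>v w \<in> carrier_vec n" using w by simp
    have "U' a *\<^sub>v y = U' a *\<^sub>v (?A *\<^sub>v w) + U' a *\<^sub>v ((- \<alpha>') \<cdot>\<^sub>v w)"
      unfolding y_def GA_vec[OF w] by (rule mult_add_distrib_mat_vec[OF U'[OF ab(1)] Aw sw])
    then show ?thesis
      using coord_M[OF ab(1) w i] coord_smult[OF ab(1) w i, of "- \<alpha>'"] i
        carrier_vecD[OF coord_carrier[OF ab(1) sw]] carrier_vecD[OF coord_carrier[OF ab(1) Aw]]
      by (simp add: algebra_simps)
  qed
  have "F *\<^sub>v y = y"
  proof (rule coord_eqI[OF ab(1) _ y])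
    fix i assume i: "i < n"
    have "i \<in> E" if "(U' a *\<^sub>v y) $ i \<noteq> 0"
    proof -
      have "(U' a *\<^sub>v w) $ i \<noteq> 0" "d a i \<noteq> \<alpha>'" using that coord_GA[OF i] by auto
      moreover from this have "i \<in> S" using supp_coord[OF ab(1) supp_w i] by blast
      ultimately show ?thesis using a by (auto simp: E_def)
    qed
    then show "(U' a *\<^sub>v (F *\<^sub>v y)) $ i = (U' a *\<^sub>v y) $ i"
      unfolding F_def using coord_conj[OF ab(1) y i, of "\<lambda>i. if i \<in> E then 1 else 0"] by auto
  qed (use F y in \<open>auto intro: mult_mat_vec_carrier\<close>)
  moreover have "C *\<^sub>v v = F *\<^sub>v y"
  proof -
    have "C *\<^sub>v v = F *\<^sub>v (G *\<^sub>v v)"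
      unfolding C_def using assoc_mult_mat_vec[OF FG F v(1)] assoc_mult_mat_vec[OF F G v(1)] Fv by simp
    also have "G *\<^sub>v v = y"
      unfolding G_def y_def w_def by (rule assoc_mult_mat_vec[OF GAB v(1)])
    finally show ?thesis .
  qed
  ultimately have "y = t \<cdot>\<^sub>v v" using Cv by simp
  have shift: "p = e \<cdot>\<^sub>v u + q" if "p + (- e) \<cdot>\<^sub>v u = q" "p \<in> carrier_vec n" "u \<in> carrier_vec n"
    for p q u :: "complex vec" and e
    using that by (intro eq_vecI) auto
  have Aw: "?A *\<^sub>v w = \<alpha>' \<cdot>\<^sub>v w + t \<cdot>\<^sub>v v"
    by (rule shift) (use \<open>y = t \<cdot>\<^sub>v v\<close> GA_vec[OF w] A w in \<open>auto simp: y_def\<close>)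
  have Bv: "?B *\<^sub>v v = \<beta> \<cdot>\<^sub>v v + w"
    by (rule shift) (use GB_vec[OF v(1)] B v in \<open>auto simp: w_def\<close>)
  have Bw: "?B *\<^sub>v w = \<beta>' \<cdot>\<^sub>v w"
  proof (rule eigenvectorI[OF ab(2) w])
    fix i assume i: "i < n" "(U' b *\<^sub>v w) $ i \<noteq> 0"
    then have "i \<in> S" "d b i \<noteq> \<beta>"
      using supp_coord[OF ab(2) supp_w] coord_GB[OF i(1)] by auto
    then show "d b i = \<beta>'" using b by auto
  qed
  have scalar: "\<exists>e. \<forall>u. supported u \<longrightarrow> M j *\<^sub>v u = e \<cdot>\<^sub>v u" if j: "j \<in> J" "j \<noteq> a" "j \<noteq> b" for j
  proof -
    obtain e where e: "d j ` S = {e}" using rest j by blast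
    have "M j *\<^sub>v u = e \<cdot>\<^sub>v u" if u: "supported u" for u
      by (rule eigenvectorI[OF j(1)]) (use u e supp_coord[OF j(1) u] in \<open>auto simp: supported_def\<close>)
    then show ?thesis by blast
  qed
  show ?thesis
  proof (cases "\<exists>c. w = c \<cdot>\<^sub>v v")
    case True
    then obtain c where c: "w = c \<cdot>\<^sub>v v" by blast
    have "\<exists>e. M j *\<^sub>v v = e \<cdot>\<^sub>v v" if j: "j \<in> J" for j
    proof -
      consider "j = a" | "j = b" | "j \<noteq> a" "j \<noteq> b" by blast
      then show ?thesis
      proof cases
        case 2
        have "M j *\<^sub>v v = (\<beta> + c) \<cdot>\<^sub>v v" using Bv v(1) unfolding 2 c by (simp add: add_smult_distrib_vec)
        then show ?thesis by blast
      qed (use Av scalar[OF j] supp_v in blast)+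
    qed
    then have "carries_invariant_subspace n J M 1"
      by (intro common_eigenvector_imp_invariant_line[of J M n v]) (use M_carrier v in auto)
    then show ?thesis ..
  next
    case False
    have ind: "p = 0 \<and> q = 0" if pq: "p \<cdot>\<^sub>v v + q \<cdot>\<^sub>v w = 0\<^sub>v n" for p q
    proof -
      have e: "p * v $ i + q * w $ i = 0" if "i < n" for i
        using arg_cong[OF pq, of "\<lambda>u. u $ i"] that v w by simp
      have "q = 0"
      proof (rule ccontr)
        assume "q \<noteq> 0"
        then have "w $ i = (- p / q) * v $ i" if "i < n" for i
          using e[OF that] by (simp add: field_simps add_eq_0_iff)
        then have "w = (- p / q) \<cdot>\<^sub>v v" using v w by (intro eq_vecI) auto
        then show False using False by blast
      qed
      moreover have "\<exists>i<n. v $ i \<noteq> 0" using v by (metis eq_vecI index_zero_vec carrier_vecD)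
      ultimately show ?thesis using e by auto
    qed
    have "\<exists>p q r s. M j *\<^sub>v v = p \<cdot>\<^sub>v v + q \<cdot>\<^sub>v w \<and> M j *\<^sub>v w = r \<cdot>\<^sub>v v + s \<cdot>\<^sub>v w" if j: "j \<in> J" for j
    proof -
      consider "j = a" | "j = b" | "j \<noteq> a" "j \<noteq> b" by blast
      then show ?thesis
      proof cases
        case 1
        have "M j *\<^sub>v v = \<alpha> \<cdot>\<^sub>v v + 0 \<cdot>\<^sub>v w" "M j *\<^sub>v w = t \<cdot>\<^sub>v v + \<alpha>' \<cdot>\<^sub>v w"
          unfolding 1 Av Aw using v w by (auto intro!: eq_vecI)
        then show ?thesis by blast
      next
        case 2
        have "M j *\<^sub>v v = \<beta> \<cdot>\<^sub>v v + 1 \<cdot>\<^sub>v w" "M j *\<^sub>v w = 0 \<cdot>\<^sub>v v + \<beta>' \<cdot>\<^sub>v w"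
          unfolding 2 Bv Bw using v w by (auto intro!: eq_vecI)
        then show ?thesis by blast
      next
        case 3
        then obtain e where e: "\<forall>u. supported u \<longrightarrow> M j *\<^sub>v u = e \<cdot>\<^sub>v u" using scalar[OF j] by blast
        have "M j *\<^sub>v v = e \<cdot>\<^sub>v v + 0 \<cdot>\<^sub>v w" "M j *\<^sub>v w = 0 \<cdot>\<^sub>v v + e \<cdot>\<^sub>v w"
          unfolding e[rule_format, OF supp_v] e[rule_format, OF supp_w]
          using v w by (auto intro!: eq_vecI)
        then show ?thesis by blast
      qed
    qed
    then have "carries_invariant_subspace n J M 2"
      by (intro invariant_pair_imp_invariant_plane[of J M n v w]) (use M_carrier v w ind in auto)
    then show ?thesis ..
  qed
qed

end

text \<open>The dimension count. The absence of common eigenvectors gives the lower bound on both sides of the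
  splitting; it also excludes that one side has a single index, so that \<open>n \<ge> 4\<close> and the hypothesis on
  planes becomes available for the case of equality.\<close>

theorem split_tuple_corner_deformation:
  fixes M L R :: "'j \<Rightarrow> complex mat"
  assumes "finite J" and S: "S \<subseteq> {..<n}" "S \<noteq> {}" "S \<noteq> {..<n}"
    and M: "\<And>j. j \<in> J \<Longrightarrow> M j \<in> carrier_mat n n" "\<And>j. j \<in> J \<Longrightarrow> diagonalizable_mat (M j)"
      "\<And>j. j \<in> J \<Longrightarrow> splits_along S (M j)"
    and no_line: "\<not> carries_invariant_subspace n J M 1"
    and no_plane: "4 \<le> n \<Longrightarrow> \<not> carries_invariant_subspace n J M 2"
    and L: "\<And>j. j \<in> J \<Longrightarrow> L j \<in> carrier_mat n n" "\<And>j. j \<in> J \<Longrightarrow> splits_along S (L j)"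
    and R: "\<And>j. j \<in> J \<Longrightarrow> R j \<in> carrier_mat n n" "\<And>j. j \<in> J \<Longrightarrow> splits_along S (R j)"
  shows "\<exists>X Y. (\<forall>j\<in>J. X j \<in> carrier_mat n n \<and> Y j \<in> carrier_mat n n \<and> corner_along S (X j) \<and>
      corner_along S (Y j) \<and> X j = M j * Y j - Y j * M j) \<and> (\<exists>j\<in>J. X j \<noteq> 0\<^sub>m n n) \<and>
      (\<forall>i<n. \<forall>k<n. (\<Sum>j\<in>J. (L j * X j * R j) $$ (i, k)) = 0)"
proof -
  have "\<forall>j\<in>J. \<exists>U U' d. U \<in> carrier_mat n n \<and> U' \<in> carrier_mat n n \<and> U * U' = 1\<^sub>m n \<and>
      U' * U = 1\<^sub>m n \<and> splits_along S U \<and> splits_along S U' \<and> M j = U * mat_diag n d * U'"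
    using splitting_diagonalization[OF M S(1)] by blast
  then obtain U U' d where UU': "\<forall>j\<in>J. U j \<in> carrier_mat n n \<and> U' j \<in> carrier_mat n n \<and>
      U j * U' j = 1\<^sub>m n \<and> U' j * U j = 1\<^sub>m n \<and> splits_along S (U j) \<and> splits_along S (U' j) \<and>
      M j = U j * mat_diag n (d j) * U' j"
    by metis
  let ?T = "{..<n} - S"
  interpret S: split_diagonalized_tuple n S J M U U' d
    by unfold_locales (use UU' assms in auto)
  have comp: "splits_along ?T A" if "A \<in> carrier_mat n n" "splits_along S A" for A
    using that by (auto simp: splits_along_def)
  interpret T: split_diagonalized_tuple n ?T J M U U' d
    by unfold_locales (use UU' assms comp in auto)
  have condS: "card S \<le> (\<Sum>j\<in>J. card {s\<in>S. d j s \<noteq> e j})" for e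
    using S.common_eigenvector_or_many_conditions[of e] no_line by (meson not_le)
  have condT: "card ?T \<le> (\<Sum>j\<in>J. card {t\<in>?T. d j t \<noteq> e j})" for e
    using T.common_eigenvector_or_many_conditions[of e] no_line by (meson not_le)
  have two: "2 \<le> card Q" if Q: "finite Q" "Q \<noteq> {}"
    and cond: "\<And>e. card Q \<le> (\<Sum>j\<in>J. card {s\<in>Q. d j s \<noteq> e j})" for Q
  proof (rule ccontr)
    assume "\<not> 2 \<le> card Q"
    moreover have "card Q \<noteq> 0" using Q by simp
    ultimately have "card Q = 1" by linarith
    then obtain q where q: "Q = {q}" by (rule card_1_singletonE)
    have "{s\<in>Q. d j s \<noteq> d j q} = {}" for j using q by auto
    then have "(\<Sum>j\<in>J. card {s\<in>Q. d j s \<noteq> d j q}) = 0"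
      by (simp only: card.empty sum.neutral_const)
    then show False using cond[of "\<lambda>j. d j q"] \<open>card Q = 1\<close> by simp
  qed
  have finT: "finite ?T" and neT: "?T \<noteq> {}" using S by auto
  have "n = card S + card ?T"
    using S(1) S.finite_S card_mono[of "{..<n}" S] by (simp add: card_Diff_subset)
  then have n: "4 \<le> n"
    using two[OF S.finite_S S(2) condS] two[OF finT neT condT] by linarith
  show ?thesis
  proof (cases "card S * card ?T
      < (\<Sum>j\<in>J. card {(s, t). s \<in> S \<and> t \<in> ?T \<and> d j s \<noteq> d j t})")
    case True
    from S.corner_deformation_exists[OF True L R] show ?thesis .
  next
    case False
    then have few: "(\<Sum>j\<in>J. card {(s, t). s \<in> S \<and> t \<in> ?T \<and> d j s \<noteq> d j t}) \<le> card S * card ?T"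
      by simp
    obtain a b \<alpha> \<alpha>' \<beta> \<beta>' where "a \<in> J" "b \<in> J" "d a ` S = {\<alpha>, \<alpha>'}" "d b ` S = {\<beta>, \<beta>'}"
      "\<And>j. j \<in> J - {a, b} \<Longrightarrow> \<exists>e. d j ` S = {e}"
      using few_distinct_pairs_imp_two_valued[OF assms(1) S.finite_S finT S(2) neT condS condT few]
      by (elim bexE conjE exE) blast
    from S.two_valued_imp_small_invariant_subspace[OF this] no_line no_plane[OF n]
    show ?thesis by blast
  qed
qed

section \<open>From invariant subspaces to relations between eigenvalues\<close>

text \<open>As long as there are fewer than \<open>n\<close> columns, some nonzero \<open>y\<close> is annihilated by pairing it with
  all columns. Its complex conjugate is orthogonal to the columns, hence can be appended as a further
  independent column.\<close>

lemma injective_mat_extends_to_nonsingular: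
  fixes W :: "complex mat"
  assumes "W \<in> carrier_mat n N" "\<And>v. v \<in> carrier_vec N \<Longrightarrow> W *\<^sub>v v = 0\<^sub>v n \<Longrightarrow> v = 0\<^sub>v N"
  shows "N \<le> n \<and> (\<exists>Q \<in> carrier_mat n n. det Q \<noteq> 0 \<and> (\<forall>i<n. \<forall>k<N. Q $$ (i, k) = W $$ (i, k)))"
  using assms
proof (induction "n - N" arbitrary: N W rule: less_induct)
  case less
  note W = less.prems(1) and inj = less.prems(2)
  have "N \<le> n"
  proof (rule ccontr)
    assume "\<not> N \<le> n"
    then obtain x where x: "\<exists>k\<in>{..<N}. x k \<noteq> 0" "\<forall>i\<in>{..<n}. (\<Sum>k\<in>{..<N}. W $$ (i, k) * x k) = 0"
      using homogeneous_system_nontrivial_solution[of "{..<n}" "{..<N}" "\<lambda>i k. W $$ (i, k)"] by auto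
    have "vec N x = 0\<^sub>v N"
    proof (rule inj)
      show "W *\<^sub>v vec N x = 0\<^sub>v n"
      proof (rule eq_vecI)
        fix i assume "i < dim_vec (0\<^sub>v n :: complex vec)"
        then have i: "i < n" by simp
        show "(W *\<^sub>v vec N x) $ i = 0\<^sub>v n $ i"
          unfolding mult_mat_vec_entry[OF W vec_carrier i] using x(2) i by simp
      qed (use W in auto)
    qed simp
    then show False using x(1) by (metis index_vec index_zero_vec(1) lessThan_iff)
  qed
  moreover have "\<exists>Q \<in> carrier_mat n n. det Q \<noteq> 0 \<and> (\<forall>i<n. \<forall>k<N. Q $$ (i, k) = W $$ (i, k))"
  proof (cases "N = n")
    case True
    then have "det W \<noteq> 0" using det_0_iff_vec_prod_zero_field[of W n] W inj by blast
    then show ?thesis using W True by blast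
  next
    case False
    with \<open>N \<le> n\<close> have "N < n" by simp
    then obtain y where y: "\<exists>i\<in>{..<n}. y i \<noteq> 0" "\<forall>k\<in>{..<N}. (\<Sum>i\<in>{..<n}. W $$ (i, k) * y i) = 0"
      using homogeneous_system_nontrivial_solution[of "{..<N}" "{..<n}" "\<lambda>k i. W $$ (i, k)"] by auto
    define W' where "W' = mat n (Suc N) (\<lambda>(i, k). if k < N then W $$ (i, k) else cnj (y i))"
    have W': "W' \<in> carrier_mat n (Suc N)" by (simp add: W'_def)
    have inj': "u = 0\<^sub>v (Suc N)" if u: "u \<in> carrier_vec (Suc N)" "W' *\<^sub>v u = 0\<^sub>v n" for u
    proof -
      have eq: "(\<Sum>k<N. W $$ (i, k) * u $ k) + cnj (y i) * u $ N = 0" if i: "i < n" for i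
      proof -
        have "0 = (W' *\<^sub>v u) $ i" using u(2) i by simp
        also have "\<dots> = (\<Sum>k<N. W $$ (i, k) * u $ k) + cnj (y i) * u $ N"
          unfolding mult_mat_vec_entry[OF W' u(1) i] using i by (simp add: W'_def)
        finally show ?thesis by simp
      qed
      have "(\<Sum>i<n. y i * cnj (y i)) * u $ N = 0"
      proof -
        have "0 = (\<Sum>i<n. y i * ((\<Sum>k<N. W $$ (i, k) * u $ k) + cnj (y i) * u $ N))"
          using eq by simp
        also have "\<dots> = (\<Sum>i<n. \<Sum>k<N. u $ k * (W $$ (i, k) * y i)) + (\<Sum>i<n. y i * cnj (y i)) * u $ N"
          by (simp add: algebra_simps sum.distrib sum_distrib_left sum_distrib_right)
        also have "(\<Sum>i<n. \<Sum>k<N. u $ k * (W $$ (i, k) * y i)) = (\<Sum>k<N. u $ k * (\<Sum>i<n. W $$ (i, k) * y i))"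
          by (subst sum.swap) (simp add: sum_distrib_left)
        finally show ?thesis using y(2) by simp
      qed
      moreover have "(\<Sum>i<n. y i * cnj (y i)) \<noteq> 0"
      proof
        assume "(\<Sum>i<n. y i * cnj (y i)) = 0"
        then have "complex_of_real (\<Sum>i<n. (cmod (y i))\<^sup>2) = 0"
          by (simp only: of_real_sum complex_norm_square)
        then have "(\<Sum>i<n. (cmod (y i))\<^sup>2) = 0" by (simp only: of_real_eq_0_iff)
        then show False using y(1) by (simp add: sum_nonneg_eq_0_iff)
      qed
      ultimately have uN: "u $ N = 0" by simp
      have "vec N (($) u) = 0\<^sub>v N"
      proof (rule inj)
        show "W *\<^sub>v vec N (($) u) = 0\<^sub>v n"
        proof (rule eq_vecI)
          fix i assume "i < dim_vec (0\<^sub>v n :: complex vec)"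
          then have i: "i < n" by simp
          show "(W *\<^sub>v vec N (($) u)) $ i = 0\<^sub>v n $ i"
            unfolding mult_mat_vec_entry[OF W vec_carrier i] using eq[OF i] uN i by simp
        qed (use W in auto)
      qed simp
      then have "u $ k = 0" if "k < N" for k using that by (metis index_vec index_zero_vec(1))
      then show ?thesis using u(1) uN by (intro eq_vecI) (auto simp: less_Suc_eq)
    qed
    have "n - Suc N < n - N" using \<open>N < n\<close> by simp
    from less.hyps[OF this W' inj'] obtain Q where Q: "Q \<in> carrier_mat n n" "det Q \<noteq> 0"
      "\<forall>i<n. \<forall>k<Suc N. Q $$ (i, k) = W' $$ (i, k)" by blast
    moreover have "\<forall>i<n. \<forall>k<N. Q $$ (i, k) = W $$ (i, k)" using Q(3) by (simp add: W'_def)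
    ultimately show ?thesis by blast
  qed
  ultimately show ?case by blast
qed

text \<open>In a basis extending the columns of \<open>W\<close> the matrix \<open>M\<close> is block upper triangular with \<open>T\<close> as its first
  block.\<close>

lemma char_poly_on_invariant_subspace_dvd:
  fixes M W T :: "complex mat"
  assumes M: "M \<in> carrier_mat n n" and W: "W \<in> carrier_mat n N" and T: "T \<in> carrier_mat N N"
    and inj: "\<And>v. v \<in> carrier_vec N \<Longrightarrow> W *\<^sub>v v = 0\<^sub>v n \<Longrightarrow> v = 0\<^sub>v N" and MW: "M * W = W * T"
  shows "char_poly T dvd char_poly M"
proof -
  obtain Q where N: "N \<le> n" and Q: "Q \<in> carrier_mat n n" "det Q \<noteq> 0"
    and QW: "\<And>i k. i < n \<Longrightarrow> k < N \<Longrightarrow> Q $$ (i, k) = W $$ (i, k)"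
    using injective_mat_extends_to_nonsingular[OF W inj] by blast
  obtain Q' where Q': "Q' \<in> carrier_mat n n" "Q * Q' = 1\<^sub>m n" "Q' * Q = 1\<^sub>m n"
    using det_nonzero_imp_inverse[OF Q] by blast
  define B where "B = Q' * M * Q"
  have B: "B \<in> carrier_mat n n" using Q Q' M by (auto simp: B_def)
  have "B = Q' * (M * Q)" unfolding B_def using assoc_mult_mat[OF Q'(1) M Q(1)] .
  have MQ: "(M * Q) $$ (i, k) = (\<Sum>l<N. Q $$ (i, l) * T $$ (l, k))" if ik: "i < n" "k < N" for i k
  proof -
    have "(M * Q) $$ (i, k) = (\<Sum>l<n. M $$ (i, l) * W $$ (l, k))"
      using ik N mult_mat_entry[OF M Q(1) ik(1)] QW by simp
    also have "\<dots> = (W * T) $$ (i, k)" unfolding MW[symmetric] using mult_mat_entry[OF M W ik] by simp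
    also have "\<dots> = (\<Sum>l<N. Q $$ (i, l) * T $$ (l, k))"
      unfolding mult_mat_entry[OF W T ik] using QW[OF ik(1)] by simp
    finally show ?thesis .
  qed
  have Bik: "B $$ (i, k) = (if i < N then T $$ (i, k) else 0)" if ik: "i < n" "k < N" for i k
  proof -
    have kn: "k < n" using ik N by simp
    have MQc: "M * Q \<in> carrier_mat n n" using M Q by simp
    have "B $$ (i, k) = (\<Sum>h<n. Q' $$ (i, h) * (\<Sum>l<N. Q $$ (h, l) * T $$ (l, k)))"
      unfolding \<open>B = Q' * (M * Q)\<close> mult_mat_entry[OF Q'(1) MQc ik(1) kn] using MQ ik by simp
    also have "\<dots> = (\<Sum>l<N. (\<Sum>h<n. Q' $$ (i, h) * Q $$ (h, l)) * T $$ (l, k))"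
      unfolding sum_distrib_left sum_distrib_right by (subst sum.swap) (simp add: mult.assoc)
    also have "\<dots> = (\<Sum>l<N. (if l = i then T $$ (i, k) else 0))"
    proof (rule sum.cong)
      fix l assume "l \<in> {..<N}"
      then have l: "l < n" using N by simp
      have "(\<Sum>h<n. Q' $$ (i, h) * Q $$ (h, l)) = (if i = l then 1 else 0)"
        using mult_mat_entry[OF Q'(1) Q(1) ik(1) l] Q'(3) ik l by simp
      then show "(\<Sum>h<n. Q' $$ (i, h) * Q $$ (h, l)) * T $$ (l, k) = (if l = i then T $$ (i, k) else 0)"
        by auto
    qed simp
    finally show ?thesis by simp
  qed
  define C where "C = mat N (n - N) (\<lambda>(i, k). B $$ (i, k + N))"
  define D where "D = mat (n - N) (n - N) (\<lambda>(i, k). B $$ (i + N, k + N))"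
  have CD: "C \<in> carrier_mat N (n - N)" "D \<in> carrier_mat (n - N) (n - N)" by (auto simp: C_def D_def)
  have "B = four_block_mat T C (0\<^sub>m (n - N) N) D"
  proof (rule eq_matI)
    fix i k assume "i < dim_row (four_block_mat T C (0\<^sub>m (n - N) N) D)"
      "k < dim_col (four_block_mat T C (0\<^sub>m (n - N) N) D)"
    then have "i < n" "k < n" using T CD N by auto
    then show "B $$ (i, k) = four_block_mat T C (0\<^sub>m (n - N) N) D $$ (i, k)"
      using T CD N Bik by (auto simp: C_def D_def)
  qed (use B T CD N in auto)
  then have "char_poly B = char_poly T * char_poly D"
    by (rule char_poly_0_block) (use char_poly_factorized[OF T] char_poly_factorized[OF CD(2)] T CD in auto)
  moreover have "similar_mat B M"
    unfolding similar_mat_def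
    by (intro exI, rule similar_mat_witI[OF Q'(3,2) B_def B M Q'(1) Q(1)])
  ultimately show ?thesis by (metis char_poly_similar dvd_triv_left)
qed

lemma monic_divisor_of_linear_product:
  fixes p :: "'a::field poly"
  assumes "finite K" "lead_coeff p = 1" "p dvd (\<Prod>k\<in>K. [:- l k, 1:])"
  shows "\<exists>\<Phi>\<subseteq>K. p = (\<Prod>k\<in>\<Phi>. [:- l k, 1:])"
  using assms
proof (induction K arbitrary: p rule: finite_induct)
  case empty
  then have "is_unit p" by simp
  then obtain c where "p = [:c:]" unfolding is_unit_poly_iff by blast
  then have "p = 1" using empty.prems(1) by (auto simp: one_pCons)
  then show ?case by auto
next
  case (insert k K)
  obtain s where s: "[:- l k, 1:] * (\<Prod>k\<in>K. [:- l k, 1:]) = p * s"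
    using insert.prems(2) unfolding prod.insert[OF insert.hyps] dvd_def by blast
  show ?case
  proof (cases "poly p (l k) = 0")
    case True
    then obtain q where q: "p = [:- l k, 1:] * q" unfolding poly_eq_0_iff_dvd dvd_def by blast
    have "lead_coeff q = 1" using insert.prems(1) unfolding q lead_coeff_mult by simp
    moreover have "[:- l k, 1:] * (\<Prod>k\<in>K. [:- l k, 1:]) = [:- l k, 1:] * (q * s)"
      using s unfolding q by (simp only: mult.assoc)
    then have "(\<Prod>k\<in>K. [:- l k, 1:]) = q * s" by (subst (asm) mult_left_cancel) auto
    then have "q dvd (\<Prod>k\<in>K. [:- l k, 1:])" by simp
    ultimately obtain \<Phi> where \<Phi>: "\<Phi> \<subseteq> K" "q = (\<Prod>k\<in>\<Phi>. [:- l k, 1:])"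
      using insert.IH by blast
    have "k \<notin> \<Phi>" "finite \<Phi>" using \<Phi>(1) insert.hyps finite_subset by auto
    then have "p = (\<Prod>k\<in>insert k \<Phi>. [:- l k, 1:])" unfolding q \<Phi>(2) by (rule prod.insert[symmetric, rotated])
    then show ?thesis using \<Phi>(1) by blast
  next
    case False
    have "poly (p * s) (l k) = 0" unfolding s[symmetric] by simp
    then have "poly s (l k) = 0" using False by simp
    then obtain q where q: "s = [:- l k, 1:] * q" unfolding poly_eq_0_iff_dvd dvd_def by blast
    have "[:- l k, 1:] * (\<Prod>k\<in>K. [:- l k, 1:]) = [:- l k, 1:] * (p * q)"
      using s unfolding q by (simp only: mult.left_commute)
    then have "(\<Prod>k\<in>K. [:- l k, 1:]) = p * q" by (subst (asm) mult_left_cancel) auto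
    then have "p dvd (\<Prod>k\<in>K. [:- l k, 1:])" by simp
    then show ?thesis using insert.IH[OF insert.prems(1)] by blast
  qed
qed

text \<open>The characteristic polynomial of the restriction is a monic divisor of \<open>\<Prod>k = 1..n. [:- l k, 1:]\<close>,
  hence the product of some of these linear factors.\<close>

lemma eigenvalues_on_invariant_subspace:
  fixes M W T :: "complex mat"
  assumes M: "M \<in> carrier_mat n n" and W: "W \<in> carrier_mat n N" and T: "T \<in> carrier_mat N N"
    and inj: "\<And>v. v \<in> carrier_vec N \<Longrightarrow> W *\<^sub>v v = 0\<^sub>v n \<Longrightarrow> v = 0\<^sub>v N" and MW: "M * W = W * T"
    and l: "lists_eigenvalues n M l"
  shows "\<exists>\<Phi>\<subseteq>{1..n}. card \<Phi> = N \<and> mat_trace T = (\<Sum>k\<in>\<Phi>. l k) \<and> det T = (\<Prod>k\<in>\<Phi>. l k)"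
proof -
  have "char_poly T dvd (\<Prod>k = 1..n. [:- l k, 1:])"
    using char_poly_on_invariant_subspace_dvd[OF M W T inj MW] l by (simp add: lists_eigenvalues_def)
  moreover have monic: "lead_coeff (char_poly T) = 1" "degree (char_poly T) = N"
    using degree_monic_char_poly[OF T] by auto
  ultimately obtain \<Phi> where \<Phi>: "\<Phi> \<subseteq> {1..n}" "char_poly T = (\<Prod>k\<in>\<Phi>. [:- l k, 1:])"
    using monic_divisor_of_linear_product[of "{1..n}"] by blast
  have fin: "finite \<Phi>" using \<Phi>(1) finite_subset by blast
  define es where "es = map l (sorted_list_of_set \<Phi>)"
  have es: "char_poly T = (\<Prod>e\<leftarrow>es. [:- e, 1:])"
    unfolding \<Phi>(2) es_def map_map using fin
    by (subst prod.distinct_set_conv_list[symmetric]) (auto simp: comp_def prod.distinct_set_conv_list[symmetric])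
  have "card \<Phi> = degree (char_poly T)"
    unfolding \<Phi>(2) by (subst degree_prod_eq_sum_degree) auto
  moreover have "sum_list es = (\<Sum>k\<in>\<Phi>. l k)"
    unfolding es_def using fin by (subst sum_list_distinct_conv_sum_set) auto
  moreover have "prod_list es = (\<Prod>k\<in>\<Phi>. l k)"
    unfolding es_def using fin by (subst prod.distinct_set_conv_list[symmetric]) auto
  ultimately show ?thesis
    using trace_det_of_factored_char_poly[OF T es] monic(2) \<Phi>(1) by (intro exI[of _ \<Phi>]) auto
qed

lemma relation_indices_of_invariant_subspace:
  assumes W: "W \<in> carrier_mat n N"
    and inj: "\<And>v. v \<in> carrier_vec N \<Longrightarrow> W *\<^sub>v v = 0\<^sub>v n \<Longrightarrow> v = 0\<^sub>v N"
    and "\<And>j. j \<in> {1..m} \<Longrightarrow> B j \<in> carrier_mat n n" "\<And>j. j \<in> {1..m} \<Longrightarrow> T j \<in> carrier_mat N N"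
      "\<And>j. j \<in> {1..m} \<Longrightarrow> B j * W = W * T j"
      "\<And>j. j \<in> {1..m} \<Longrightarrow> lists_eigenvalues n (B j) (\<lambda>k. l k j)"
  shows "\<exists>\<Phi>. \<forall>j\<in>{1..m}. \<Phi> j \<subseteq> {1..n} \<and> card (\<Phi> j) = N \<and>
    mat_trace (T j) = (\<Sum>k\<in>\<Phi> j. l k j) \<and> det (T j) = (\<Prod>k\<in>\<Phi> j. l k j)"
proof -
  have "\<exists>\<Phi>. \<Phi> \<subseteq> {1..n} \<and> card \<Phi> = N \<and> mat_trace (T j) = (\<Sum>k\<in>\<Phi>. l k j) \<and>
      det (T j) = (\<Prod>k\<in>\<Phi>. l k j)" if j: "j \<in> {1..m}" for j
    using eigenvalues_on_invariant_subspace[OF assms(3)[OF j] W assms(4)[OF j] inj assms(5,6)[OF j]]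
    by blast
  then show ?thesis by (intro bchoice) blast
qed

section \<open>Removing all splittings by small deformations\<close>

text \<open>A matrix commuting with a diagonal matrix with distinct diagonal entries is diagonal, with
  diagonal \<open>x\<close> say. It commutes with \<open>B j\<close> only if \<open>B j\<close> has no nonzero entry at positions \<open>(i, k)\<close>
  with \<open>x i \<noteq> x k\<close>, so the level set of \<open>x\<close> through the index 0 splits the whole tuple.\<close>

lemma nontrivial_centralizer_imp_common_splitting:
  assumes B: "\<And>j. j \<in> {1..m} \<Longrightarrow> B j \<in> carrier_mat n n" and "1 \<le> m"
    and B1: "B 1 = mat_diag n f" and f: "inj_on f {..<n}"
    and nontriv: "\<not> trivial_centralizer n m B"
  shows "\<exists>S \<subseteq> {..<n}. S \<noteq> {} \<and> S \<noteq> {..<n} \<and> (\<forall>j \<in> {1..m}. splits_along S (B j))"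
proof -
  obtain X where X: "X \<in> carrier_mat n n" and comm: "\<And>j. j \<in> {1..m} \<Longrightarrow> X * B j = B j * X"
    and nonscalar: "\<And>c. X \<noteq> c \<cdot>\<^sub>m 1\<^sub>m n"
    using nontriv unfolding trivial_centralizer_def by blast
  have off: "X $$ (i, k) = 0" if "i < n" "k < n" "i \<noteq> k" for i k
  proof -
    have "X * mat_diag n f = mat_diag n f * X" using comm[of 1] assms(2) B1 by simp
    then have "(X * mat_diag n f) $$ (i, k) = (mat_diag n f * X) $$ (i, k)" by simp
    then have "X $$ (i, k) * f k = f i * X $$ (i, k)"
      unfolding mat_diag_mult_left[OF X] mat_diag_mult_right[OF X] using that by simp
    then have "X $$ (i, k) * (f k - f i) = 0" by (simp add: algebra_simps)
    moreover have "f k \<noteq> f i" using f that by (auto dest: inj_onD)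
    ultimately show ?thesis by simp
  qed
  define x where "x i = X $$ (i, i)" for i
  have Xd: "X = mat_diag n x"
    by (rule eq_matI) (use X off in \<open>auto simp: mat_diag_def x_def\<close>)
  define S where "S = {i. i < n \<and> x i = x 0}"
  have "S \<noteq> {..<n}"
  proof
    assume S: "S = {..<n}"
    have "X = x 0 \<cdot>\<^sub>m 1\<^sub>m n"
    proof (rule eq_matI)
      fix i k assume "i < dim_row (x 0 \<cdot>\<^sub>m 1\<^sub>m n)" "k < dim_col (x 0 \<cdot>\<^sub>m 1\<^sub>m n)"
      then have "i < n" "k < n" by auto
      moreover from this have "x i = x 0" using S by (auto simp: S_def)
      ultimately show "X $$ (i, k) = (x 0 \<cdot>\<^sub>m 1\<^sub>m n) $$ (i, k)"
        using off by (cases "i = k") (auto simp: x_def)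
    qed (use X in auto)
    then show False using nonscalar by blast
  qed
  moreover have "S \<noteq> {}"
  proof -
    have "n \<noteq> 0"
    proof
      assume "n = 0"
      then have "X = 0 \<cdot>\<^sub>m 1\<^sub>m n" using X by (intro eq_matI) auto
      then show False using nonscalar by blast
    qed
    then have "0 \<in> S" by (simp add: S_def)
    then show ?thesis by blast
  qed
  moreover have "splits_along S (B j)" if j: "j \<in> {1..m}" for j
    unfolding splits_along_def
  proof (intro allI impI)
    fix i k assume ik: "i < dim_row (B j)" "k < dim_col (B j)" "B j $$ (i, k) \<noteq> 0"
    then have ik': "i < n" "k < n" using B[OF j] by auto
    have "(mat_diag n x * B j) $$ (i, k) = (B j * mat_diag n x) $$ (i, k)"
      using comm[OF j] Xd by simp
    then have "x i * B j $$ (i, k) = B j $$ (i, k) * x k"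
      unfolding mat_diag_mult_left[OF B[OF j]] mat_diag_mult_right[OF B[OF j]] using ik' by simp
    then have "x i = x k" using ik(3) by simp
    then show "i \<in> S \<longleftrightarrow> k \<in> S" using ik' by (simp add: S_def)
  qed
  ultimately show ?thesis by (intro exI[of _ S]) (auto simp: S_def)
qed

lemma distinct_eigenvalues_diagonalization:
  assumes A: "A \<in> carrier_mat n n" and "diagonalizable_mat A" and "has_n_distinct_eigenvalues n A"
  shows "\<exists>P P' f. P \<in> carrier_mat n n \<and> P' \<in> carrier_mat n n \<and> P * P' = 1\<^sub>m n \<and> P' * P = 1\<^sub>m n \<and>
    A = P * mat_diag n f * P' \<and> inj_on f {..<n}"
proof -
  obtain D P P' where D: "diagonal_mat D" and sim: "similar_mat_wit A D P P'"
    using assms(2) unfolding diagonalizable_mat_def similar_mat_def by blast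
  note w = similar_mat_witD2[OF A sim]
  define f where "f k = D $$ (k, k)" for k
  have Dd: "D = mat_diag n f"
    using D w(5) by (intro eq_matI) (auto simp: diagonal_mat_def mat_diag_def f_def)
  have "upper_triangular D" using D w(5) by (auto simp: upper_triangular_def diagonal_mat_def)
  then have "char_poly A = (\<Prod>a\<leftarrow>diag_mat D. [:- a, 1:])"
    using char_poly_similar[of A D] char_poly_upper_triangular[OF w(5)] sim
    by (auto simp: similar_mat_def)
  then have "{e. eigenvalue A e} = set (diag_mat D)"
    unfolding eigenvalue_root_char_poly[OF A] by (auto simp: poly_prod_list prod_list_zero_iff)
  also have "\<dots> = f ` {..<n}" using w(5) by (auto simp: diag_mat_def f_def)
  finally have "card (f ` {..<n}) = card {..<n}"
    using assms(3) by (simp add: has_n_distinct_eigenvalues_def)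
  then have "inj_on f {..<n}" by (intro eq_card_imp_inj_on) auto
  then show ?thesis using w Dd by blast
qed

lemma common_small_parameter:
  fixes a b :: "'q \<Rightarrow> real"
  assumes "finite Q" "\<And>q. q \<in> Q \<Longrightarrow> a q < \<epsilon>" "\<And>q. q \<in> Q \<Longrightarrow> 0 \<le> b q"
  shows "\<exists>\<delta>>0. \<forall>q\<in>Q. a q + \<delta> * b q < \<epsilon>"
  using assms
proof (induction Q rule: finite_induct)
  case empty
  then show ?case by (intro exI[of _ 1]) auto
next
  case (insert q Q)
  then obtain \<delta> where \<delta>: "\<delta> > 0" "\<forall>q\<in>Q. a q + \<delta> * b q < \<epsilon>" by auto
  define \<eta> where "\<eta> = min \<delta> ((\<epsilon> - a q) / (b q + 1))"
  have bq: "0 \<le> b q" "a q < \<epsilon>" using insert.prems by auto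
  have "\<eta> > 0" using \<delta>(1) bq by (simp add: \<eta>_def)
  moreover have "a r + \<eta> * b r < \<epsilon>" if "r \<in> Q" for r
  proof -
    have "\<eta> * b r \<le> \<delta> * b r" using insert.prems(2)[of r] that by (intro mult_right_mono) (auto simp: \<eta>_def)
    then show ?thesis using \<delta>(2) that by fastforce
  qed
  moreover have "a q + \<eta> * b q < \<epsilon>"
  proof -
    have "\<eta> * b q \<le> (\<epsilon> - a q) / (b q + 1) * b q"
      using bq(1) by (intro mult_right_mono) (auto simp: \<eta>_def)
    also have "\<dots> < \<epsilon> - a q" using bq by (simp add: field_simps)
    finally show ?thesis by simp
  qed
  ultimately show ?case by auto
qed

lemma conj_add_smult_entry:
  fixes P P' B X :: "complex mat"
  assumes "P \<in> carrier_mat n n" "P' \<in> carrier_mat n n" "B \<in> carrier_mat n n" "X \<in> carrier_mat n n"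
    and ik: "i < n" "k < n"
  shows "(P * (B + \<delta> \<cdot>\<^sub>m X) * P') $$ (i, k) = (P * B * P') $$ (i, k) + \<delta> * (P * X * P') $$ (i, k)"
proof -
  have BX: "B + \<delta> \<cdot>\<^sub>m X \<in> carrier_mat n n" using assms by simp
  have "(P * (B + \<delta> \<cdot>\<^sub>m X) * P') $$ (i, k) =
      (\<Sum>(s, t)\<in>{..<n} \<times> {..<n}. P $$ (i, s) * P' $$ (t, k) * B $$ (s, t)
        + \<delta> * (P $$ (i, s) * P' $$ (t, k) * X $$ (s, t)))"
    unfolding triple_product_entry[OF assms(1) BX assms(2) ik]
    by (rule sum.cong) (use assms in \<open>auto simp: algebra_simps\<close>)
  also have "\<dots> = (P * B * P') $$ (i, k) + \<delta> * (P * X * P') $$ (i, k)"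
    unfolding triple_product_entry[OF assms(1,3,2) ik] triple_product_entry[OF assms(1,4,2) ik]
      sum_distrib_left sum.distrib[symmetric] by (rule sum.cong) auto
  finally show ?thesis .
qed

lemma trivial_centralizer_conj:
  assumes P: "P \<in> carrier_mat n n" "P' \<in> carrier_mat n n" "P * P' = 1\<^sub>m n" "P' * P = 1\<^sub>m n"
    and B: "\<And>j. j \<in> {1..m} \<Longrightarrow> B j \<in> carrier_mat n n"
    and triv: "trivial_centralizer n m B"
  shows "trivial_centralizer n m (\<lambda>j. P * B j * P')"
  unfolding trivial_centralizer_def
proof (intro ballI impI)
  fix X assume X: "X \<in> carrier_mat n n" and comm: "\<forall>j\<in>{1..m}. X * (P * B j * P') = P * B j * P' * X"
  define Z where "Z = P' * X * P"
  have Z: "Z \<in> carrier_mat n n" using P X by (simp add: Z_def)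
  have X_eq: "X = P * Z * P'"
  proof -
    have "P * Z * P' = (P * P') * X * (P * P')"
      unfolding Z_def using P(1,2) X by (simp add: assoc_mult_mat[of _ n n _ n _ n])
    then show ?thesis using P(3) X by simp
  qed
  have "Z * B j = B j * Z" if j: "j \<in> {1..m}" for j
  proof -
    have "P * (Z * B j) * P' = P * (B j * Z) * P'"
      using comm j X_eq conj_mult[OF P(1,2,4) Z B[OF j]] conj_mult[OF P(1,2,4) B[OF j] Z] by simp
    then have "P' * (P * (Z * B j) * P') * P = P' * (P * (B j * Z) * P') * P" by simp
    moreover have "P' * (P * Y * P') * P = Y" if Y: "Y \<in> carrier_mat n n" for Y
    proof -
      have "P' * (P * Y * P') * P = (P' * P) * Y * (P' * P)"
        using P(1,2) Y by (simp add: assoc_mult_mat[of _ n n _ n _ n])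
      then show ?thesis using P(4) Y by simp
    qed
    ultimately show ?thesis using Z B[OF j] by simp
  qed
  then obtain c where "Z = c \<cdot>\<^sub>m 1\<^sub>m n" using triv Z unfolding trivial_centralizer_def by blast
  then have "X = c \<cdot>\<^sub>m 1\<^sub>m n"
    using X_eq P mult_smult_distrib[OF P(1) one_carrier_mat] mult_smult_assoc_mat[OF P(1,2)] by simp
  then show "\<exists>c. X = c \<cdot>\<^sub>m 1\<^sub>m n" by blast
qed

text \<open>Here \<open>C\<close> stands for the sum or the product condition. Among the tuples satisfying \<open>C\<close>, close to \<open>A\<close>,
  in the same conjugacy classes and with diagonal first matrix (everything in an eigenbasis of
  \<open>A 1\<close>), take one with the largest number of nonzero entries. If its centralizer were
  nontrivial, the tuple would split, and the hypothesis \<open>step\<close> would fill an entry in the corner, where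
  all entries vanished before. Since \<open>X 1 = 0\<close>, the new tuple still has the same diagonal first matrix
  and competes for the maximum.\<close>

lemma deformation_principle:
  fixes C :: "(nat \<Rightarrow> complex mat) \<Rightarrow> bool"
  assumes A: "\<And>j. j \<in> {1..m} \<Longrightarrow> A j \<in> carrier_mat n n" and m: "1 \<le> m"
    and A1: "diagonalizable_mat (A 1)" "has_n_distinct_eigenvalues n (A 1)" and "C A"
    and conj: "\<And>P P' B. P \<in> carrier_mat n n \<Longrightarrow> P' \<in> carrier_mat n n \<Longrightarrow> P * P' = 1\<^sub>m n \<Longrightarrow>
        P' * P = 1\<^sub>m n \<Longrightarrow> (\<And>j. j \<in> {1..m} \<Longrightarrow> B j \<in> carrier_mat n n) \<Longrightarrow> C B \<Longrightarrow> C (\<lambda>j. P * B j * P')"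
    and step: "\<And>B S. (\<And>j. j \<in> {1..m} \<Longrightarrow> B j \<in> carrier_mat n n) \<Longrightarrow>
        (\<And>j. j \<in> {1..m} \<Longrightarrow> similar_mat (B j) (A j)) \<Longrightarrow> C B \<Longrightarrow> S \<subseteq> {..<n} \<Longrightarrow> S \<noteq> {} \<Longrightarrow>
        S \<noteq> {..<n} \<Longrightarrow> (\<And>j. j \<in> {1..m} \<Longrightarrow> splits_along S (B j)) \<Longrightarrow>
        \<exists>X. (\<forall>j \<in> {1..m}. X j \<in> carrier_mat n n \<and> corner_along S (X j)) \<and> X 1 = 0\<^sub>m n n \<and>
          (\<exists>j \<in> {1..m}. X j \<noteq> 0\<^sub>m n n) \<and>
          (\<forall>\<delta>. C (\<lambda>j. B j + \<delta> \<cdot>\<^sub>m X j) \<and> (\<forall>j \<in> {1..m}. similar_mat (B j + \<delta> \<cdot>\<^sub>m X j) (B j)))"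
  shows "can_be_deformed n m C (trivial_centralizer n m) A"
  unfolding can_be_deformed_def
proof (intro allI impI)
  fix \<epsilon> :: real assume "\<epsilon> > 0"
  have one: "1 \<in> {1..m}" using m by simp
  obtain P P' f where P: "P \<in> carrier_mat n n" "P' \<in> carrier_mat n n" "P * P' = 1\<^sub>m n" "P' * P = 1\<^sub>m n"
    and A1_eq: "A 1 = P * mat_diag n f * P'" and f: "inj_on f {..<n}"
    using distinct_eigenvalues_diagonalization[OF A[OF one] A1] by blast
  have unconj: "P * (P' * Y * P) * P' = Y" "P' * (P * Y * P') * P = Y" if Y: "Y \<in> carrier_mat n n" for Y
  proof -
    have "P * (P' * Y * P) * P' = (P * P') * Y * (P * P')" "P' * (P * Y * P') * P = (P' * P) * Y * (P' * P)"
      using P(1,2) Y by (simp_all add: assoc_mult_mat[of _ n n _ n _ n])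
    then show "P * (P' * Y * P) * P' = Y" "P' * (P * Y * P') * P = Y" using P Y by simp_all
  qed
  define good where "good B \<longleftrightarrow> (\<forall>j \<in> {1..m}. B j \<in> carrier_mat n n \<and> similar_mat (B j) (A j)) \<and> C B \<and>
    B 1 = mat_diag n f \<and> tuples_close n m \<epsilon> A (\<lambda>j. P * B j * P')" for B
  define supp where "supp B = {(j, i, k). j \<in> {1..m} \<and> i < n \<and> k < n \<and> B j $$ (i, k) \<noteq> 0}"
    for B :: "nat \<Rightarrow> complex mat"
  have supp_sub: "supp B \<subseteq> {1..m} \<times> {..<n} \<times> {..<n}" for B by (auto simp: supp_def)
  have supp_fin: "finite (supp B)" for B using finite_subset[OF supp_sub] by simp
  have start: "good (\<lambda>j. P' * A j * P)"
  proof -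
    have "similar_mat (P' * A j * P) (A j)" if "j \<in> {1..m}" for j
      unfolding similar_mat_def
      by (intro exI, rule similar_mat_witI[OF P(4,3) refl _ A[OF that] P(2,1)]) (use P A[OF that] in simp)
    moreover have "P' * A 1 * P = mat_diag n f" unfolding A1_eq by (rule unconj) simp
    moreover have "tuples_close n m \<epsilon> A (\<lambda>j. P * (P' * A j * P) * P')"
      using \<open>\<epsilon> > 0\<close> unconj A by (simp add: tuples_close_def)
    ultimately show ?thesis
      using P A \<open>C A\<close> conj[of P' P A, OF P(2,1,4,3) A] by (auto simp: good_def)
  qed
  have bound: "\<forall>B. good B \<longrightarrow> card (supp B) < Suc (card ({1..m} \<times> {..<n} \<times> {..<n}))"
    using supp_sub by (intro allI impI le_imp_less_Suc card_mono) auto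
  obtain B where B: "good B" and max: "\<forall>B'. good B' \<longrightarrow> card (supp B') \<le> card (supp B)"
    using ex_has_greatest_nat[of good _ "\<lambda>B. card (supp B)", OF start bound] by blast
  have Bc: "B j \<in> carrier_mat n n" and Bs: "similar_mat (B j) (A j)" if "j \<in> {1..m}" for j
    using B that by (auto simp: good_def)
  have "C B" and B1: "B 1 = mat_diag n f" and close: "tuples_close n m \<epsilon> A (\<lambda>j. P * B j * P')"
    using B by (auto simp: good_def)
  have triv: "trivial_centralizer n m B"
  proof (rule ccontr)
    assume "\<not> trivial_centralizer n m B"
    then obtain S where S: "S \<subseteq> {..<n}" "S \<noteq> {}" "S \<noteq> {..<n}"
      and split: "\<And>j. j \<in> {1..m} \<Longrightarrow> splits_along S (B j)"
      using nontrivial_centralizer_imp_common_splitting[of m B n f, OF Bc m B1 f] by blast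
    obtain X where X: "\<forall>j \<in> {1..m}. X j \<in> carrier_mat n n \<and> corner_along S (X j)" "X 1 = 0\<^sub>m n n"
      and nz: "\<exists>j \<in> {1..m}. X j \<noteq> 0\<^sub>m n n"
      and def: "\<And>\<delta>. C (\<lambda>j. B j + \<delta> \<cdot>\<^sub>m X j)"
        "\<And>\<delta> j. j \<in> {1..m} \<Longrightarrow> similar_mat (B j + \<delta> \<cdot>\<^sub>m X j) (B j)"
      using step[of B S, OF Bc Bs \<open>C B\<close> S split] by blast
    define a where "a = (\<lambda>(j, r, c). cmod ((P * B j * P') $$ (r, c) - A j $$ (r, c)))"
    define b where "b = (\<lambda>(j, r, c). cmod ((P * X j * P') $$ (r, c)))"
    have "\<exists>\<delta>>0. \<forall>q\<in>{1..m} \<times> {..<n} \<times> {..<n}. a q + \<delta> * b q < \<epsilon>"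
      by (rule common_small_parameter) (use close in \<open>auto simp: a_def b_def tuples_close_def\<close>)
    then obtain \<delta> where \<delta>: "\<delta> > 0" "\<forall>q\<in>{1..m} \<times> {..<n} \<times> {..<n}. a q + \<delta> * b q < \<epsilon>" by blast
    define B' where "B' j = B j + complex_of_real \<delta> \<cdot>\<^sub>m X j" for j
    have "good B'"
    proof -
      have "B' j \<in> carrier_mat n n \<and> similar_mat (B' j) (A j)" if "j \<in> {1..m}" for j
        using Bc[OF that] X(1) that similar_mat_trans[OF def(2)[OF that] Bs[OF that]]
        by (simp add: B'_def)
      moreover have "B' 1 = mat_diag n f" unfolding B'_def X(2) B1 by (rule eq_matI) auto
      moreover have "tuples_close n m \<epsilon> A (\<lambda>j. P * B' j * P')"
        unfolding tuples_close_def
      proof (intro ballI allI impI)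
        fix j r c assume j: "j \<in> {1..m}" and rc: "r < n" "c < n"
        have Xj: "X j \<in> carrier_mat n n" using X(1) j by blast
        have "cmod ((P * B' j * P') $$ (r, c) - A j $$ (r, c))
            = cmod (((P * B j * P') $$ (r, c) - A j $$ (r, c)) + complex_of_real \<delta> * (P * X j * P') $$ (r, c))"
          unfolding B'_def conj_add_smult_entry[OF P(1,2) Bc[OF j] Xj rc] by (simp add: algebra_simps)
        also have "\<dots> \<le> a (j, r, c) + \<delta> * b (j, r, c)"
          using norm_triangle_ineq[of "(P * B j * P') $$ (r, c) - A j $$ (r, c)"
              "complex_of_real \<delta> * (P * X j * P') $$ (r, c)"] \<delta>(1)
          by (simp add: a_def b_def norm_mult)
        also have "\<dots> < \<epsilon>" using \<delta>(2) j rc by auto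
        finally show "cmod ((P * B' j * P') $$ (r, c) - A j $$ (r, c)) < \<epsilon>" .
      qed
      moreover have "C B'" using def(1)[of "complex_of_real \<delta>"] unfolding B'_def[abs_def] .
      ultimately show ?thesis unfolding good_def by blast
    qed
    moreover have "supp B \<subset> supp B'"
    proof -
      have ent: "B' j $$ (i, k) = B j $$ (i, k) + \<delta> * X j $$ (i, k)" if "j \<in> {1..m}" "i < n" "k < n" for j i k
        using that(2,3) Bc[OF that(1)] bspec[OF X(1) that(1)] by (auto simp: B'_def)
      have disj: "B j $$ (i, k) = 0 \<or> X j $$ (i, k) = 0" if j: "j \<in> {1..m}" and "i < n" "k < n" for j i k
      proof -
        have "X j \<in> carrier_mat n n" "corner_along S (X j)" using X(1) j by blast+
        then have "X j $$ (i, k) \<noteq> 0 \<longrightarrow> i \<in> S \<and> k \<notin> S"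
          using that(2,3) unfolding corner_along_def by auto
        moreover have "B j $$ (i, k) \<noteq> 0 \<longrightarrow> (i \<in> S \<longleftrightarrow> k \<in> S)"
          using split[OF j] Bc[OF j] that(2,3) unfolding splits_along_def by auto
        ultimately show ?thesis by blast
      qed
      have "supp B \<subseteq> supp B'"
      proof
        fix q assume "q \<in> supp B"
        then obtain j i k where q: "q = (j, i, k)" "j \<in> {1..m}" "i < n" "k < n" "B j $$ (i, k) \<noteq> 0"
          by (auto simp: supp_def)
        then have "B' j $$ (i, k) \<noteq> 0" using ent[OF q(2-4)] disj[OF q(2-4)] by simp
        then show "q \<in> supp B'" using q by (simp add: supp_def)
      qed
      moreover obtain j where j: "j \<in> {1..m}" "X j \<noteq> 0\<^sub>m n n" using nz by blast
      then obtain i k where ik: "i < n" "k < n" "X j $$ (i, k) \<noteq> 0"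
      proof -
        have Xj: "X j \<in> carrier_mat n n" using X(1) j(1) by blast
        have "\<not> (\<forall>i<n. \<forall>k<n. X j $$ (i, k) = 0)"
        proof
          assume "\<forall>i<n. \<forall>k<n. X j $$ (i, k) = 0"
          then have "X j = 0\<^sub>m n n" using Xj by (intro eq_matI) auto
          then show False using j(2) by simp
        qed
        then show ?thesis using that by blast
      qed
      have "(j, i, k) \<in> supp B' - supp B"
        using ent[OF j(1) ik(1,2)] disj[OF j(1) ik(1,2)] ik j \<delta>(1) by (simp add: supp_def)
      ultimately show ?thesis by blast
    qed
    then have "card (supp B) < card (supp B')" using supp_fin by (intro psubset_card_mono)
    ultimately show False using max by (meson not_le)
  qed
  show "\<exists>B. (\<forall>j\<in>{1..m}. similar_mat (B j) (A j)) \<and> C B \<and> trivial_centralizer n m B \<and> tuples_close n m \<epsilon> A B"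
  proof (intro exI[of _ "\<lambda>j. P * B j * P'"] conjI ballI)
    fix j assume j: "j \<in> {1..m}"
    have "similar_mat (P * B j * P') (B j)"
      unfolding similar_mat_def
      by (intro exI, rule similar_mat_witI[OF P(3,4) refl _ Bc[OF j] P(1,2)]) (use P Bc[OF j] in simp)
    then show "similar_mat (P * B j * P') (A j)" using Bs[OF j] by (rule similar_mat_trans)
  qed (use conj[of P P' B, OF P Bc \<open>C B\<close>] trivial_centralizer_conj[of P n P' m B, OF P Bc triv] close in auto)
qed

text \<open>With \<open>Z = \<delta> Y\<close> the products \<open>Z * Z\<close> and \<open>Z * B * Z\<close> of corner matrices vanish. Hence \<open>1 - Z\<close> and \<open>1 + Z\<close> are
  inverse to each other and \<open>(1 - Z) * B * (1 + Z) = B + (B * Z - Z * B)\<close> without a quadratic term.\<close>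

lemma similar_mat_add_bracket_with_corner:
  assumes B: "B \<in> carrier_mat n n" "splits_along S B" and Y: "Y \<in> carrier_mat n n" "corner_along S Y"
  shows "similar_mat (B + \<delta> \<cdot>\<^sub>m (B * Y - Y * B)) B"
proof -
  define Z where "Z = \<delta> \<cdot>\<^sub>m Y"
  have Z: "Z \<in> carrier_mat n n" "corner_along S Z" using Y by (auto simp: Z_def corner_along_def)
  note ZZ = corner_along_mult_corner[OF Z(1) Z(1) Z(2) Z(2)]
  have BZ: "B * Z \<in> carrier_mat n n" and ZB: "Z * B \<in> carrier_mat n n" using B Z by auto
  have ZBZ: "Z * B * Z = 0\<^sub>m n n"
    using corner_along_mult_corner[OF ZB Z(1) corner_along_mult_right[OF B(1) Z(1) B(2) Z(2)] Z(2)] .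
  have minus_0: "D - 0\<^sub>m n n = D" if "D \<in> carrier_mat n n" for D :: "complex mat"
    using that by (intro eq_matI) auto
  let ?L = "1\<^sub>m n - Z" and ?R = "1\<^sub>m n + Z"
  have LR: "?L \<in> carrier_mat n n" "?R \<in> carrier_mat n n" using Z by auto
  have "?L * ?R = 1\<^sub>m n"
  proof -
    have "?L * ?R = ?L * 1\<^sub>m n + ?L * Z" by (rule mult_add_distrib_mat[OF LR(1) one_carrier_mat Z(1)])
    also have "?L * Z = Z" using minus_mult_distrib_mat[OF one_carrier_mat Z(1) Z(1)] Z ZZ by auto
    finally show ?thesis using Z by (intro eq_matI) auto
  qed
  moreover from this have "?R * ?L = 1\<^sub>m n" by (rule mat_mult_left_right_inverse[OF LR])
  moreover have "B + \<delta> \<cdot>\<^sub>m (B * Y - Y * B) = ?L * B * ?R"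
  proof -
    have LB: "?L * B = B - Z * B"
      using minus_mult_distrib_mat[OF one_carrier_mat Z(1) B(1)] left_mult_one_mat[OF B(1)] by simp
    have LBc: "B - Z * B \<in> carrier_mat n n" using ZB by (rule minus_carrier_mat)
    have "?L * B * ?R = (B - Z * B) * 1\<^sub>m n + (B - Z * B) * Z"
      unfolding LB by (rule mult_add_distrib_mat[OF LBc one_carrier_mat Z(1)])
    also have "(B - Z * B) * Z = B * Z"
      unfolding minus_mult_distrib_mat[OF B(1) ZB Z(1)] ZBZ by (rule minus_0[OF BZ])
    also have "(B - Z * B) * 1\<^sub>m n = B - Z * B" using LBc by (rule right_mult_one_mat)
    also have "B - Z * B + B * Z = B + \<delta> \<cdot>\<^sub>m (B * Y - Y * B)"
      unfolding Z_def mult_smult_distrib[OF B(1) Y(1)] mult_smult_assoc_mat[OF Y(1) B(1)]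
      using B Y by (intro eq_matI) (auto simp: algebra_simps)
    finally show ?thesis by simp
  qed
  moreover have "B + \<delta> \<cdot>\<^sub>m (B * Y - Y * B) \<in> carrier_mat n n" using B Y by auto
  ultimately have "similar_mat_wit (B + \<delta> \<cdot>\<^sub>m (B * Y - Y * B)) B ?L ?R"
    by (intro similar_mat_witI[of _ _ n]) (use B LR in auto)
  then show ?thesis unfolding similar_mat_def by blast
qed

lemma diagonalizable_mat_similar:
  "similar_mat B A \<Longrightarrow> diagonalizable_mat A \<Longrightarrow> diagonalizable_mat B"
  unfolding diagonalizable_mat_def using similar_mat_trans by blast

lemma lists_eigenvalues_similar:
  "similar_mat B A \<Longrightarrow> lists_eigenvalues n A l \<Longrightarrow> lists_eigenvalues n B l"
  unfolding lists_eigenvalues_def using char_poly_similar by metis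

lemma splits_along_one: "splits_along S (1\<^sub>m n)"
  by (auto simp: splits_along_def)

lemma corner_along_zero: "corner_along S (0\<^sub>m n n)"
  by (auto simp: corner_along_def)

lemma two_le_of_proper_nonempty_subset:
  fixes n :: nat
  assumes "S \<subseteq> {..<n}" "S \<noteq> {}" "S \<noteq> {..<n}"
  shows "2 \<le> n"
proof (rule ccontr)
  assume "\<not> 2 \<le> n"
  then have "{..<n} \<subseteq> {0}" by auto
  then show False using assms by blast
qed

text \<open>The first matrix is left unchanged; the factors \<open>L j\<close> and \<open>R j\<close> are identity matrices for the sum
  condition and partial products of the tuple for the product condition.\<close>

lemma corner_perturbation_of_split_tuple:
  fixes B L R :: "nat \<Rightarrow> complex mat"
  assumes B: "\<And>j. j \<in> {1..m} \<Longrightarrow> B j \<in> carrier_mat n n"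
    and diag: "\<And>j. j \<in> {1..m} \<Longrightarrow> diagonalizable_mat (B j)"
    and split: "\<And>j. j \<in> {1..m} \<Longrightarrow> splits_along S (B j)"
    and S: "S \<subseteq> {..<n}" "S \<noteq> {}" "S \<noteq> {..<n}"
    and no_line: "\<not> carries_invariant_subspace n {2..m} B 1"
    and no_plane: "4 \<le> n \<Longrightarrow> \<not> carries_invariant_subspace n {2..m} B 2"
    and L: "\<And>j. j \<in> {2..m} \<Longrightarrow> L j \<in> carrier_mat n n" "\<And>j. j \<in> {2..m} \<Longrightarrow> splits_along S (L j)"
    and R: "\<And>j. j \<in> {2..m} \<Longrightarrow> R j \<in> carrier_mat n n" "\<And>j. j \<in> {2..m} \<Longrightarrow> splits_along S (R j)"
  shows "\<exists>X. (\<forall>j. X j \<in> carrier_mat n n \<and> corner_along S (X j)) \<and> X 1 = 0\<^sub>m n n \<and>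
    (\<exists>j\<in>{1..m}. X j \<noteq> 0\<^sub>m n n) \<and> (\<forall>\<delta>. \<forall>j\<in>{1..m}. similar_mat (B j + \<delta> \<cdot>\<^sub>m X j) (B j)) \<and>
    (\<forall>i<n. \<forall>k<n. (\<Sum>j\<in>{2..m}. (L j * X j * R j) $$ (i, k)) = 0)"
proof -
  have sub: "j \<in> {1..m}" if "j \<in> {2..m}" for j using that by simp
  have "\<exists>X Y. (\<forall>j\<in>{2..m}. X j \<in> carrier_mat n n \<and> Y j \<in> carrier_mat n n \<and> corner_along S (X j) \<and>
      corner_along S (Y j) \<and> X j = B j * Y j - Y j * B j) \<and> (\<exists>j\<in>{2..m}. X j \<noteq> 0\<^sub>m n n) \<and>
      (\<forall>i<n. \<forall>k<n. (\<Sum>j\<in>{2..m}. (L j * X j * R j) $$ (i, k)) = 0)"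
    by (rule split_tuple_corner_deformation[OF _ S B[OF sub] diag[OF sub] split[OF sub] no_line no_plane L R])
      auto
  then obtain X Y where X: "\<And>j. j \<in> {2..m} \<Longrightarrow> X j \<in> carrier_mat n n"
      "\<And>j. j \<in> {2..m} \<Longrightarrow> corner_along S (X j)"
    and Y: "\<And>j. j \<in> {2..m} \<Longrightarrow> Y j \<in> carrier_mat n n" "\<And>j. j \<in> {2..m} \<Longrightarrow> corner_along S (Y j)"
    and XY: "\<And>j. j \<in> {2..m} \<Longrightarrow> X j = B j * Y j - Y j * B j"
    and nz: "\<exists>j\<in>{2..m}. X j \<noteq> 0\<^sub>m n n"
    and sum0: "\<forall>i<n. \<forall>k<n. (\<Sum>j\<in>{2..m}. (L j * X j * R j) $$ (i, k)) = 0" by blast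
  define X' where "X' j = (if j \<in> {2..m} then X j else 0\<^sub>m n n)" for j
  have X'_in: "X' j = X j" if "j \<in> {2..m}" for j using that by (simp add: X'_def)
  have X': "X' j \<in> carrier_mat n n \<and> corner_along S (X' j)" for j
    using X[of j] corner_along_zero by (cases "j \<in> {2..m}") (simp_all add: X'_def)
  moreover have "X' 1 = 0\<^sub>m n n" by (simp add: X'_def)
  moreover have "\<exists>j\<in>{1..m}. X' j \<noteq> 0\<^sub>m n n" using nz sub X'_in by metis
  moreover have "similar_mat (B j + \<delta> \<cdot>\<^sub>m X' j) (B j)" if j: "j \<in> {1..m}" for j \<delta>
  proof (cases "j \<in> {2..m}")
    case True
    show ?thesis unfolding X'_in[OF True] XY[OF True]
      by (rule similar_mat_add_bracket_with_corner[OF B[OF j] split[OF j] Y(1)[OF True] Y(2)[OF True]])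
  next
    case False
    have "B j + \<delta> \<cdot>\<^sub>m X' j = B j"
      unfolding X'_def if_not_P[OF False] using B[OF j] by (intro eq_matI) auto
    then show ?thesis using similar_mat_refl[OF B[OF j]] by simp
  qed
  moreover have "\<forall>i<n. \<forall>k<n. (\<Sum>j\<in>{2..m}. (L j * X' j * R j) $$ (i, k)) = 0"
    using sum0 X'_in by simp
  ultimately show ?thesis by (intro exI[of _ X']) blast
qed

section \<open>Tuples with zero sum\<close>

lemma tuple_sum_carrier_entry:
  assumes "\<And>j. j \<in> {1..m} \<Longrightarrow> A j \<in> carrier_mat n n"
  shows "tuple_sum n m A \<in> carrier_mat n n"
    and "i < n \<Longrightarrow> k < n \<Longrightarrow> tuple_sum n m A $$ (i, k) = (\<Sum>j\<in>{1..m}. A j $$ (i, k))"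
proof -
  have *: "foldr (+) (map A xs) (0\<^sub>m n n) \<in> carrier_mat n n \<and>
      (i < n \<longrightarrow> k < n \<longrightarrow> foldr (+) (map A xs) (0\<^sub>m n n) $$ (i, k) = (\<Sum>j\<leftarrow>xs. A j $$ (i, k)))"
    if "\<forall>j\<in>set xs. A j \<in> carrier_mat n n" for xs i k
    using that by (induction xs) auto
  have "set [1..<Suc m] = {1..m}" by auto
  then have **: "\<forall>j\<in>set [1..<Suc m]. A j \<in> carrier_mat n n" using assms by simp
  show "tuple_sum n m A \<in> carrier_mat n n" using *[OF **] by (simp only: tuple_sum_def)
  show "tuple_sum n m A $$ (i, k) = (\<Sum>j\<in>{1..m}. A j $$ (i, k))" if "i < n" "k < n"
    using *[OF **, of i k] that
    by (simp only: tuple_sum_def interv_sum_list_conv_sum_set_nat set_upt)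
       (simp add: atLeastLessThanSuc_atLeastAtMost)
qed

lemma sum_from_one: "1 \<le> m \<Longrightarrow> (\<Sum>j\<in>{1..m}. f j) = f 1 + (\<Sum>j\<in>{2..m}. f j)"
  for f :: "nat \<Rightarrow> 'a::comm_monoid_add"
  by (simp add: sum.atLeast_Suc_atMost numeral_2_eq_2)

lemma prod_from_one: "1 \<le> m \<Longrightarrow> (\<Prod>j\<in>{1..m}. f j) = f 1 * (\<Prod>j\<in>{2..m}. f j)"
  for f :: "nat \<Rightarrow> 'a::comm_monoid_mult"
  by (simp add: prod.atLeast_Suc_atMost numeral_2_eq_2)

lemma tuple_sum_eq_0_iff:
  assumes "\<And>j. j \<in> {1..m} \<Longrightarrow> A j \<in> carrier_mat n n"
  shows "tuple_sum n m A = 0\<^sub>m n n \<longleftrightarrow> (\<forall>i<n. \<forall>k<n. (\<Sum>j\<in>{1..m}. A j $$ (i, k)) = 0)"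
proof -
  note c = tuple_sum_carrier_entry[of m A n, OF assms]
  have "tuple_sum n m A = 0\<^sub>m n n \<longleftrightarrow> (\<forall>i<n. \<forall>k<n. tuple_sum n m A $$ (i, k) = 0)"
    using c(1) by (auto simp: mat_eq_iff)
  then show ?thesis using c(2) by simp
qed

text \<open>The first matrix is minus the sum of the others, so it leaves the subspace invariant as well, and the
  traces of the restrictions sum to 0. Each trace is a sum of \<open>N\<close> eigenvalues.\<close>

lemma additive_invariant_subspace_imp_relation:
  assumes B: "\<And>j. j \<in> {1..m} \<Longrightarrow> B j \<in> carrier_mat n n" and m: "1 \<le> m"
    and l: "\<And>j. j \<in> {1..m} \<Longrightarrow> lists_eigenvalues n (B j) (\<lambda>k. l k j)"
    and zero: "tuple_sum n m B = 0\<^sub>m n n"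
    and inv: "carries_invariant_subspace n {2..m} B N" and N: "0 < N" "N < n"
  shows "additive_relation n m l N"
proof -
  obtain W T where W: "W \<in> carrier_mat n N"
    and inj: "\<And>v. v \<in> carrier_vec N \<Longrightarrow> W *\<^sub>v v = 0\<^sub>v n \<Longrightarrow> v = 0\<^sub>v N"
    and T: "\<And>j. j \<in> {2..m} \<Longrightarrow> T j \<in> carrier_mat N N" "\<And>j. j \<in> {2..m} \<Longrightarrow> B j * W = W * T j"
    using inv unfolding carries_invariant_subspace_def by metis
  define T1 where "T1 = mat N N (\<lambda>(i, k). - (\<Sum>j\<in>{2..m}. T j $$ (i, k)))"
  have T1: "T1 \<in> carrier_mat N N" by (simp add: T1_def)
  have B1: "B 1 \<in> carrier_mat n n" using B m by simp
  have B1_entry: "B 1 $$ (i, k) = - (\<Sum>j\<in>{2..m}. B j $$ (i, k))" if "i < n" "k < n" for i k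
    using zero tuple_sum_eq_0_iff[of m B n, OF B] that sum_from_one[OF m, of "\<lambda>j. B j $$ (i, k)"]
    by (simp add: eq_neg_iff_add_eq_0)
  have "B 1 * W = W * T1"
  proof (rule eq_matI)
    fix i k assume "i < dim_row (W * T1)" "k < dim_col (W * T1)"
    then have ik: "i < n" "k < N" using W T1 by auto
    have "(B 1 * W) $$ (i, k) = - (\<Sum>j\<in>{2..m}. \<Sum>h<n. B j $$ (i, h) * W $$ (h, k))"
      unfolding mult_mat_entry[OF B1 W ik] using B1_entry[OF ik(1)]
      by (simp add: sum_negf sum_distrib_right) (rule sum.swap)
    also have "\<dots> = - (\<Sum>j\<in>{2..m}. \<Sum>h<N. W $$ (i, h) * T j $$ (h, k))"
    proof -
      have "(\<Sum>h<n. B j $$ (i, h) * W $$ (h, k)) = (\<Sum>h<N. W $$ (i, h) * T j $$ (h, k))"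
        if j: "j \<in> {2..m}" for j
      proof -
        have "B j \<in> carrier_mat n n" using B j by simp
        then show ?thesis
          using mult_mat_entry[OF _ W ik, of "B j"] mult_mat_entry[OF W T(1)[OF j] ik] T(2)[OF j] by simp
      qed
      then show ?thesis by simp
    qed
    also have "\<dots> = (W * T1) $$ (i, k)"
      unfolding mult_mat_entry[OF W T1 ik] using ik
      by (simp add: T1_def sum_negf sum_distrib_left) (rule sum.swap)
    finally show "(B 1 * W) $$ (i, k) = (W * T1) $$ (i, k)" .
  qed (use B1 W T1 in auto)
  define T' where "T' = T(1 := T1)"
  have T'c: "T' j \<in> carrier_mat N N" and T'W: "B j * W = W * T' j" if "j \<in> {1..m}" for j
    using that T T1 \<open>B 1 * W = W * T1\<close> by (auto simp: T'_def)
  obtain \<Phi> where \<Phi>: "\<forall>j\<in>{1..m}. \<Phi> j \<subseteq> {1..n} \<and> card (\<Phi> j) = N \<and>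
      mat_trace (T' j) = (\<Sum>k\<in>\<Phi> j. l k j) \<and> det (T' j) = (\<Prod>k\<in>\<Phi> j. l k j)"
    using relation_indices_of_invariant_subspace[of W n N m B T' l, OF W inj B T'c T'W l] by blast
  have "(\<Sum>j\<in>{1..m}. \<Sum>k\<in>\<Phi> j. l k j) = (\<Sum>j\<in>{1..m}. mat_trace (T' j))"
    using \<Phi> by simp
  also have "\<dots> = mat_trace T1 + (\<Sum>j\<in>{2..m}. mat_trace (T j))"
    unfolding sum_from_one[OF m] by (simp add: T'_def)
  also have "(\<Sum>j\<in>{2..m}. mat_trace (T j)) = (\<Sum>j\<in>{2..m}. \<Sum>i<N. T j $$ (i, i))"
    by (rule sum.cong) (use T(1) in \<open>auto simp: mat_trace_def\<close>)
  also have "\<dots> = (\<Sum>i<N. \<Sum>j\<in>{2..m}. T j $$ (i, i))" by (rule sum.swap)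
  also have "mat_trace T1 + \<dots> = 0" by (simp add: mat_trace_def T1_def sum_negf)
  finally show ?thesis using \<Phi> N unfolding additive_relation_def by auto
qed

theorem additive_deformation:
  assumes A: "\<And>j. j \<in> {1..m} \<Longrightarrow> A j \<in> carrier_mat n n"
    and diag: "\<And>j. j \<in> {1..m} \<Longrightarrow> diagonalizable_mat (A j)"
    and l: "\<And>j. j \<in> {1..m} \<Longrightarrow> lists_eigenvalues n (A j) (\<lambda>k. l k j)"
    and zero: "tuple_sum n m A = 0\<^sub>m n n" and m: "1 \<le> m"
    and A1: "has_n_distinct_eigenvalues n (A 1)" and generic: "additively_generic 3 n m l"
  shows "can_be_deformed n m (\<lambda>B. tuple_sum n m B = 0\<^sub>m n n) (trivial_centralizer n m) A"
proof (rule deformation_principle[of m A n "\<lambda>B. tuple_sum n m B = 0\<^sub>m n n", OF A m _ A1 zero])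
  show "diagonalizable_mat (A 1)" using diag m by simp
next
  fix P P' :: "complex mat" and B :: "nat \<Rightarrow> complex mat"
  assume P: "P \<in> carrier_mat n n" "P' \<in> carrier_mat n n" and B: "\<And>j. j \<in> {1..m} \<Longrightarrow> B j \<in> carrier_mat n n"
    and zero: "tuple_sum n m B = 0\<^sub>m n n"
  have c: "P * B j * P' \<in> carrier_mat n n" if "j \<in> {1..m}" for j
    using P B[OF that] by (meson mult_carrier_mat)
  have "(\<Sum>j\<in>{1..m}. (P * B j * P') $$ (i, k)) = 0" if ik: "i < n" "k < n" for i k
  proof -
    have "(\<Sum>j\<in>{1..m}. (P * B j * P') $$ (i, k))
        = (\<Sum>j\<in>{1..m}. \<Sum>(s, t)\<in>{..<n} \<times> {..<n}. P $$ (i, s) * P' $$ (t, k) * B j $$ (s, t))"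
      by (rule sum.cong) (use triple_product_entry[OF P(1) B P(2) ik] in auto)
    also have "\<dots> = (\<Sum>(s, t)\<in>{..<n} \<times> {..<n}. P $$ (i, s) * P' $$ (t, k) * (\<Sum>j\<in>{1..m}. B j $$ (s, t)))"
      by (subst sum.swap) (simp add: sum_distrib_left case_prod_beta)
    also have "\<dots> = 0"
      using zero tuple_sum_eq_0_iff[of m B n, OF B] by (intro sum.neutral) auto
    finally show ?thesis .
  qed
  then show "tuple_sum n m (\<lambda>j. P * B j * P') = 0\<^sub>m n n"
    using tuple_sum_eq_0_iff[of m "\<lambda>j. P * B j * P'" n, OF c] by blast
next
  fix B :: "nat \<Rightarrow> complex mat" and S
  assume B: "\<And>j. j \<in> {1..m} \<Longrightarrow> B j \<in> carrier_mat n n"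
    and sim: "\<And>j. j \<in> {1..m} \<Longrightarrow> similar_mat (B j) (A j)"
    and zero: "tuple_sum n m B = 0\<^sub>m n n" and S: "S \<subseteq> {..<n}" "S \<noteq> {}" "S \<noteq> {..<n}"
    and split: "\<And>j. j \<in> {1..m} \<Longrightarrow> splits_along S (B j)"
  have lB: "lists_eigenvalues n (B j) (\<lambda>k. l k j)" if "j \<in> {1..m}" for j
    using lists_eigenvalues_similar[OF sim[OF that] l[OF that]] .
  have dB: "diagonalizable_mat (B j)" if "j \<in> {1..m}" for j
    using diagonalizable_mat_similar[OF sim[OF that] diag[OF that]] .
  have n: "2 \<le> n" using two_le_of_proper_nonempty_subset[OF S] .
  have no: "\<not> carries_invariant_subspace n {2..m} B N" if "0 < N" "2 * N \<le> n" "N < 3" for N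
  proof
    assume "carries_invariant_subspace n {2..m} B N"
    then have "additive_relation n m l N"
      using additive_invariant_subspace_imp_relation[of m B n l N, OF B m lB zero] that by simp
    then show False using generic that unfolding additively_generic_def by fastforce
  qed
  have "\<exists>X. (\<forall>j. X j \<in> carrier_mat n n \<and> corner_along S (X j)) \<and> X 1 = 0\<^sub>m n n \<and>
      (\<exists>j\<in>{1..m}. X j \<noteq> 0\<^sub>m n n) \<and> (\<forall>\<delta>. \<forall>j\<in>{1..m}. similar_mat (B j + \<delta> \<cdot>\<^sub>m X j) (B j)) \<and>
      (\<forall>i<n. \<forall>k<n. (\<Sum>j\<in>{2..m}. (1\<^sub>m n * X j * 1\<^sub>m n) $$ (i, k)) = 0)"
    by (rule corner_perturbation_of_split_tuple[of m B n S "\<lambda>_. 1\<^sub>m n" "\<lambda>_. 1\<^sub>m n", OF B dB split S])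
      (use no[of 1] no[of 2] n splits_along_one in auto)
  then obtain X where X: "\<And>j. X j \<in> carrier_mat n n" "\<And>j. corner_along S (X j)" and X1: "X 1 = 0\<^sub>m n n"
    and nz: "\<exists>j\<in>{1..m}. X j \<noteq> 0\<^sub>m n n"
    and sim': "\<forall>\<delta>. \<forall>j\<in>{1..m}. similar_mat (B j + \<delta> \<cdot>\<^sub>m X j) (B j)"
    and sum0: "\<forall>i<n. \<forall>k<n. (\<Sum>j\<in>{2..m}. (1\<^sub>m n * X j * 1\<^sub>m n) $$ (i, k)) = 0" by blast
  have one: "1\<^sub>m n * X j * 1\<^sub>m n = X j" for j
    using left_mult_one_mat[OF X(1)] right_mult_one_mat[OF X(1)] by simp
  have "tuple_sum n m (\<lambda>j. B j + \<delta> \<cdot>\<^sub>m X j) = 0\<^sub>m n n" for \<delta>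
  proof -
    have c: "B j + \<delta> \<cdot>\<^sub>m X j \<in> carrier_mat n n" if "j \<in> {1..m}" for j using B[OF that] X(1)[of j] by simp
    have "(\<Sum>j\<in>{1..m}. (B j + \<delta> \<cdot>\<^sub>m X j) $$ (i, k)) = 0" if ik: "i < n" "k < n" for i k
    proof -
      have "(\<Sum>j\<in>{1..m}. (B j + \<delta> \<cdot>\<^sub>m X j) $$ (i, k)) = (\<Sum>j\<in>{1..m}. B j $$ (i, k) + \<delta> * X j $$ (i, k))"
        by (rule sum.cong) (use ik carrier_matD[OF X(1)] in auto)
      also have "\<dots> = (\<Sum>j\<in>{1..m}. B j $$ (i, k)) + \<delta> * (\<Sum>j\<in>{1..m}. X j $$ (i, k))"
        by (simp add: sum.distrib sum_distrib_left)
      also have "(\<Sum>j\<in>{1..m}. X j $$ (i, k)) = 0"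
        unfolding sum_from_one[OF m] X1 using sum0 ik by (simp add: one)
      finally show ?thesis using zero tuple_sum_eq_0_iff[of m B n, OF B] ik by simp
    qed
    then show ?thesis using tuple_sum_eq_0_iff[of m "\<lambda>j. B j + \<delta> \<cdot>\<^sub>m X j" n, OF c] by blast
  qed
  then show "\<exists>X. (\<forall>j \<in> {1..m}. X j \<in> carrier_mat n n \<and> corner_along S (X j)) \<and> X 1 = 0\<^sub>m n n \<and>
      (\<exists>j \<in> {1..m}. X j \<noteq> 0\<^sub>m n n) \<and> (\<forall>\<delta>. tuple_sum n m (\<lambda>j. B j + \<delta> \<cdot>\<^sub>m X j) = 0\<^sub>m n n \<and>
        (\<forall>j \<in> {1..m}. similar_mat (B j + \<delta> \<cdot>\<^sub>m X j) (B j)))"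
    using X X1 nz sim' by (intro exI[of _ X]) blast
qed

section \<open>Tuples with product one\<close>

definition list_mat_prod :: "nat \<Rightarrow> (nat \<Rightarrow> complex mat) \<Rightarrow> nat list \<Rightarrow> complex mat" where
  "list_mat_prod n M xs = foldr (*) (map M xs) (1\<^sub>m n)"

lemma list_mat_prod_simps [simp]:
  "list_mat_prod n M [] = 1\<^sub>m n"
  "list_mat_prod n M (x # xs) = M x * list_mat_prod n M xs"
  by (simp_all add: list_mat_prod_def)

lemma list_mat_prod_carrier:
  "(\<And>j. j \<in> set xs \<Longrightarrow> M j \<in> carrier_mat n n) \<Longrightarrow> list_mat_prod n M xs \<in> carrier_mat n n"
  by (induction xs) (simp_all add: mult_carrier_mat[of _ n n])

lemma list_mat_prod_append:
  assumes "\<And>j. j \<in> set xs \<union> set ys \<Longrightarrow> M j \<in> carrier_mat n n"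
  shows "list_mat_prod n M (xs @ ys) = list_mat_prod n M xs * list_mat_prod n M ys"
  using assms
proof (induction xs)
  case Nil
  have "list_mat_prod n M ys \<in> carrier_mat n n" by (rule list_mat_prod_carrier) (use Nil in auto)
  then show ?case by simp
next
  case (Cons x xs)
  have c: "M x \<in> carrier_mat n n" "list_mat_prod n M xs \<in> carrier_mat n n"
    "list_mat_prod n M ys \<in> carrier_mat n n"
    using Cons.prems by (auto intro: list_mat_prod_carrier)
  have "list_mat_prod n M (xs @ ys) = list_mat_prod n M xs * list_mat_prod n M ys"
    by (rule Cons.IH) (use Cons.prems in auto)
  then show ?case by (simp add: assoc_mult_mat[OF c])
qed

lemma list_mat_prod_upt_Suc:
  assumes "a \<le> b" "\<And>j. a \<le> j \<Longrightarrow> j \<le> b \<Longrightarrow> M j \<in> carrier_mat n n"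
  shows "list_mat_prod n M [a..<Suc b] = list_mat_prod n M [a..<b] * M b"
proof -
  have "list_mat_prod n M ([a..<b] @ [b]) = list_mat_prod n M [a..<b] * list_mat_prod n M [b]"
    by (rule list_mat_prod_append) (use assms in auto)
  moreover have "list_mat_prod n M [b] = M b" using right_mult_one_mat[OF assms(2)[of b]] assms(1) by simp
  ultimately show ?thesis using assms(1) by simp
qed

lemma splits_along_list_mat_prod:
  assumes "\<And>j. j \<in> set xs \<Longrightarrow> M j \<in> carrier_mat n n" "\<And>j. j \<in> set xs \<Longrightarrow> splits_along S (M j)"
  shows "splits_along S (list_mat_prod n M xs)"
  using assms
proof (induction xs)
  case Nil
  then show ?case by (simp add: splits_along_one)
next
  case (Cons x xs)
  have "splits_along S (list_mat_prod n M xs)" by (rule Cons.IH) (use Cons.prems in auto)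
  moreover have "list_mat_prod n M xs \<in> carrier_mat n n"
    by (rule list_mat_prod_carrier) (use Cons.prems in auto)
  ultimately show ?case using Cons.prems by (auto intro: splits_along_mult)
qed

lemma list_mat_prod_intertwine:
  assumes W: "W \<in> carrier_mat n N"
    and "\<And>j. j \<in> set xs \<Longrightarrow> M j \<in> carrier_mat n n" "\<And>j. j \<in> set xs \<Longrightarrow> T j \<in> carrier_mat N N"
    and "\<And>j. j \<in> set xs \<Longrightarrow> M j * W = W * T j"
  shows "list_mat_prod n M xs * W = W * list_mat_prod N T xs"
  using assms(2-)
proof (induction xs)
  case Nil
  then show ?case using left_mult_one_mat[OF W] right_mult_one_mat[OF W] by simp
next
  case (Cons x xs)
  have Mx: "M x \<in> carrier_mat n n" and Tx: "T x \<in> carrier_mat N N" and x: "M x * W = W * T x"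
    using Cons.prems by auto
  have Mxs: "list_mat_prod n M xs \<in> carrier_mat n n" and Txs: "list_mat_prod N T xs \<in> carrier_mat N N"
    using Cons.prems by (auto intro: list_mat_prod_carrier)
  have IH: "list_mat_prod n M xs * W = W * list_mat_prod N T xs"
    by (rule Cons.IH) (use Cons.prems in auto)
  have "list_mat_prod n M (x # xs) * W = M x * (W * list_mat_prod N T xs)"
    using assoc_mult_mat[OF Mx Mxs W] IH by simp
  also have "\<dots> = (W * T x) * list_mat_prod N T xs"
    using assoc_mult_mat[OF Mx W Txs] x by simp
  also have "\<dots> = W * list_mat_prod N T (x # xs)"
    using assoc_mult_mat[OF W Tx Txs] by simp
  finally show ?case .
qed

lemma det_list_mat_prod:
  assumes "\<And>j. j \<in> set xs \<Longrightarrow> T j \<in> carrier_mat N N"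
  shows "det (list_mat_prod N T xs) = (\<Prod>j\<leftarrow>xs. det (T j))"
  using assms
proof (induction xs)
  case (Cons x xs)
  have "list_mat_prod N T xs \<in> carrier_mat N N"
    by (rule list_mat_prod_carrier) (use Cons.prems in auto)
  then show ?case using Cons det_mult[of "T x" N] by simp
qed simp

lemma list_mat_prod_conj:
  assumes P: "P \<in> carrier_mat n n" "P' \<in> carrier_mat n n" "P * P' = 1\<^sub>m n" "P' * P = 1\<^sub>m n"
    and "\<And>j. j \<in> set xs \<Longrightarrow> M j \<in> carrier_mat n n"
  shows "list_mat_prod n (\<lambda>j. P * M j * P') xs = P * list_mat_prod n M xs * P'"
  using assms(5)
proof (induction xs)
  case Nil
  then show ?case using right_mult_one_mat[OF P(1)] P(3) by simp
next
  case (Cons x xs)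
  have c: "M x \<in> carrier_mat n n" "list_mat_prod n M xs \<in> carrier_mat n n"
    using Cons.prems by (auto intro: list_mat_prod_carrier)
  have "list_mat_prod n (\<lambda>j. P * M j * P') xs = P * list_mat_prod n M xs * P'"
    by (rule Cons.IH) (use Cons.prems in auto)
  then show ?case using conj_mult[OF P(1,2,4) c] by simp
qed

text \<open>A product containing two corner factors vanishes, because the factors between them respect the
  splitting. Hence only the first-order term of the perturbation survives.\<close>

lemma list_mat_prod_perturbed_by_corners:
  assumes "a \<le> b" and M: "\<And>j. j \<in> {a..<b} \<Longrightarrow> M j \<in> carrier_mat n n"
    "\<And>j. j \<in> {a..<b} \<Longrightarrow> splits_along S (M j)"
    and X: "\<And>j. X j \<in> carrier_mat n n" "\<And>j. corner_along S (X j)"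
    and ik: "i < n" "k < n"
  shows "list_mat_prod n (\<lambda>j. M j + \<delta> \<cdot>\<^sub>m X j) [a..<b] $$ (i, k) = list_mat_prod n M [a..<b] $$ (i, k)
    + \<delta> * (\<Sum>j\<in>{a..<b}. (list_mat_prod n M [a..<j] * X j * list_mat_prod n M [Suc j..<b]) $$ (i, k))"
  using assms(1) M ik
proof (induction b arbitrary: i k rule: dec_induct)
  case base
  then show ?case by simp
next
  case (step b)
  let ?M' = "\<lambda>j. M j + \<delta> \<cdot>\<^sub>m X j"
  let ?t = "\<lambda>c j. list_mat_prod n M [a..<j] * X j * list_mat_prod n M [Suc j..<c]"
  have Mc: "M j \<in> carrier_mat n n" "splits_along S (M j)" if "a \<le> j" "j < Suc b" for j
    using step.prems that by auto
  have M'c: "?M' j \<in> carrier_mat n n" if "a \<le> j" "j < Suc b" for j using Mc(1)[OF that] X(1) by simp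
  have Mb: "M b \<in> carrier_mat n n" and M'b: "?M' b \<in> carrier_mat n n"
    using Mc M'c step.hyps by auto
  have prodc: "list_mat_prod n M [c..<e] \<in> carrier_mat n n" "splits_along S (list_mat_prod n M [c..<e])"
    if "a \<le> c" "e \<le> Suc b" for c e
    using that Mc by (auto intro!: list_mat_prod_carrier splits_along_list_mat_prod)
  define s where "s = list_mat_prod n M [a..<b]"
  define s' where "s' = list_mat_prod n ?M' [a..<b]"
  have s: "s \<in> carrier_mat n n" unfolding s_def by (rule prodc) (use step.hyps in auto)
  have s': "s' \<in> carrier_mat n n"
    unfolding s'_def by (rule list_mat_prod_carrier) (use M'c in auto)
  define E where "E = mat n n (\<lambda>(r, c). \<Sum>j\<in>{a..<b}. ?t b j $$ (r, c))"
  have E: "E \<in> carrier_mat n n" by (simp add: E_def)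
  have tc: "?t b j \<in> carrier_mat n n" "corner_along S (?t b j)" if "j \<in> {a..<b}" for j
  proof -
    have l: "list_mat_prod n M [a..<j] \<in> carrier_mat n n" "splits_along S (list_mat_prod n M [a..<j])"
      and r: "list_mat_prod n M [Suc j..<b] \<in> carrier_mat n n" "splits_along S (list_mat_prod n M [Suc j..<b])"
      using prodc that by auto
    show "?t b j \<in> carrier_mat n n" using l(1) r(1) X(1) by (meson mult_carrier_mat)
    show "corner_along S (?t b j)"
      by (rule corner_along_mult_right[OF r(1) mult_carrier_mat[OF l(1) X(1)] r(2)
          corner_along_mult_left[OF l(1) X(1) l(2) X(2)]])
  qed
  have "corner_along S E"
    unfolding corner_along_def
  proof (intro allI impI)
    fix r c assume rc: "r < dim_row E" "c < dim_col E" "E $$ (r, c) \<noteq> 0"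
    then have rc': "r < n" "c < n" using E by auto
    then have "(\<Sum>j\<in>{a..<b}. ?t b j $$ (r, c)) \<noteq> 0" using rc(3) by (simp add: E_def)
    then obtain j where j: "j \<in> {a..<b}" "?t b j $$ (r, c) \<noteq> 0" by (meson sum.neutral)
    then show "r \<in> S \<and> c \<notin> S" using tc[OF j(1)] rc' unfolding corner_along_def by (metis carrier_matD)
  qed
  then have EX: "E * X b = 0\<^sub>m n n" using corner_along_mult_corner[OF E X(1) _ X(2)] by simp
  have s'_entry: "s' $$ (r, c) = s $$ (r, c) + \<delta> * E $$ (r, c)" if "r < n" "c < n" for r c
    unfolding s_def s'_def E_def using step.IH[OF _ _ that] Mc that by simp
  have last: "list_mat_prod n M [a..<Suc b] = s * M b"
    unfolding s_def by (rule list_mat_prod_upt_Suc) (use step.hyps Mc in auto)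
  have last': "list_mat_prod n ?M' [a..<Suc b] = s' * ?M' b"
    unfolding s'_def by (rule list_mat_prod_upt_Suc) (use step.hyps M'c in auto)
  have t_Suc: "?t (Suc b) j = ?t b j * M b" if j: "j \<in> {a..<b}" for j
  proof -
    have r: "list_mat_prod n M [Suc j..<Suc b] = list_mat_prod n M [Suc j..<b] * M b"
      by (rule list_mat_prod_upt_Suc) (use j Mc in auto)
    have c: "list_mat_prod n M [a..<j] * X j \<in> carrier_mat n n" "list_mat_prod n M [Suc j..<b] \<in> carrier_mat n n"
      using prodc[of a j] prodc[of "Suc j" b] X(1)[of j] j by auto
    show ?thesis unfolding r by (rule assoc_mult_mat[symmetric, OF c Mb])
  qed
  have t_b: "?t (Suc b) b = s * X b"
    using right_mult_one_mat[OF mult_carrier_mat[OF s X(1)]] by (simp add: s_def)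
  have EM: "(E * M b) $$ (i, k) = (\<Sum>j\<in>{a..<b}. ?t (Suc b) j $$ (i, k))"
  proof -
    have "(E * M b) $$ (i, k) = (\<Sum>h<n. \<Sum>j\<in>{a..<b}. ?t b j $$ (i, h) * M b $$ (h, k))"
      unfolding mult_mat_entry[OF E Mb step.prems(3,4)]
      by (rule sum.cong) (use step.prems in \<open>auto simp: E_def sum_distrib_right\<close>)
    also have "\<dots> = (\<Sum>j\<in>{a..<b}. \<Sum>h<n. ?t b j $$ (i, h) * M b $$ (h, k))" by (rule sum.swap)
    also have "\<dots> = (\<Sum>j\<in>{a..<b}. ?t (Suc b) j $$ (i, k))"
      by (rule sum.cong) (use t_Suc mult_mat_entry[OF tc(1) Mb step.prems(3,4)] in auto)
    finally show ?thesis .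
  qed
  have "(s' * ?M' b) $$ (i, k)
      = (\<Sum>h<n. (s $$ (i, h) + \<delta> * E $$ (i, h)) * (M b $$ (h, k) + \<delta> * X b $$ (h, k)))"
    unfolding mult_mat_entry[OF s' M'b step.prems(3,4)]
    by (rule sum.cong) (use s'_entry step.prems carrier_matD[OF X(1)[of b]] carrier_matD[OF Mb] in auto)
  also have "\<dots> = (\<Sum>h<n. s $$ (i, h) * M b $$ (h, k) + \<delta> * (s $$ (i, h) * X b $$ (h, k))
      + \<delta> * (E $$ (i, h) * M b $$ (h, k)) + \<delta> * \<delta> * (E $$ (i, h) * X b $$ (h, k)))"
    by (rule sum.cong) (simp_all add: algebra_simps)
  also have "\<dots> = (s * M b) $$ (i, k) + \<delta> * (s * X b) $$ (i, k) + \<delta> * (E * M b) $$ (i, k)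
      + \<delta> * \<delta> * (E * X b) $$ (i, k)"
    unfolding mult_mat_entry[OF s Mb step.prems(3,4)] mult_mat_entry[OF s X(1) step.prems(3,4)]
      mult_mat_entry[OF E Mb step.prems(3,4)] mult_mat_entry[OF E X(1) step.prems(3,4)]
    by (simp only: sum.distrib sum_distrib_left)
  also have "\<dots> = (s * M b) $$ (i, k) + \<delta> * ((\<Sum>j\<in>{a..<b}. ?t (Suc b) j $$ (i, k)) + (s * X b) $$ (i, k))"
    unfolding EM EX using step.prems by (simp add: algebra_simps)
  also have "(\<Sum>j\<in>{a..<b}. ?t (Suc b) j $$ (i, k)) + (s * X b) $$ (i, k) = (\<Sum>j\<in>{a..<Suc b}. ?t (Suc b) j $$ (i, k))"
    unfolding sum.atLeastLessThan_Suc[OF step.hyps(1)] t_b ..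
  finally show ?case unfolding last last' .
qed

lemma tuple_prod_from_one:
  assumes "1 \<le> m"
  shows "tuple_prod n m M = M 1 * list_mat_prod n M [2..<Suc m]"
proof -
  have "[1..<Suc m] = 1 # [2..<Suc m]" using assms by (simp add: upt_conv_Cons numeral_2_eq_2 del: upt_Suc)
  then have "tuple_prod n m M = list_mat_prod n M (1 # [2..<Suc m])"
    unfolding tuple_prod_def list_mat_prod_def by (simp only:)
  then show ?thesis by simp
qed

text \<open>The first matrix is the inverse of the product of the others, so it leaves the subspace invariant as
  well, and the determinants of the restrictions have product 1. Each determinant is a product of \<open>N\<close>
  eigenvalues.\<close>

lemma multiplicative_invariant_subspace_imp_relation:
  assumes B: "\<And>j. j \<in> {1..m} \<Longrightarrow> B j \<in> carrier_mat n n" and m: "1 \<le> m"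
    and l: "\<And>j. j \<in> {1..m} \<Longrightarrow> lists_eigenvalues n (B j) (\<lambda>k. l k j)"
    and one: "tuple_prod n m B = 1\<^sub>m n"
    and inv: "carries_invariant_subspace n {2..m} B N" and N: "0 < N" "N < n"
  shows "multiplicative_relation n m l N"
proof -
  obtain W T where W: "W \<in> carrier_mat n N"
    and inj: "\<And>v. v \<in> carrier_vec N \<Longrightarrow> W *\<^sub>v v = 0\<^sub>v n \<Longrightarrow> v = 0\<^sub>v N"
    and T: "\<And>j. j \<in> {2..m} \<Longrightarrow> T j \<in> carrier_mat N N" "\<And>j. j \<in> {2..m} \<Longrightarrow> B j * W = W * T j"
    using inv unfolding carries_invariant_subspace_def by metis
  have set2: "set [2..<Suc m] = {2..m}" by auto
  define Bp where "Bp = list_mat_prod n B [2..<Suc m]"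
  define Tp where "Tp = list_mat_prod N T [2..<Suc m]"
  have B1: "B 1 \<in> carrier_mat n n" using B m by simp
  have Bp: "Bp \<in> carrier_mat n n" unfolding Bp_def by (rule list_mat_prod_carrier) (use B in auto)
  have Tp: "Tp \<in> carrier_mat N N" unfolding Tp_def by (rule list_mat_prod_carrier) (use T in auto)
  have BpW: "Bp * W = W * Tp"
    unfolding Bp_def Tp_def by (rule list_mat_prod_intertwine[OF W]) (use B T set2 in auto)
  have B1Bp: "B 1 * Bp = 1\<^sub>m n" using one unfolding tuple_prod_from_one[OF m] Bp_def .
  have "B 1 * (W * Tp) = (B 1 * Bp) * W"
    unfolding BpW[symmetric] by (rule assoc_mult_mat[symmetric, OF B1 Bp W])
  then have B1WTp: "B 1 * (W * Tp) = W" using B1Bp left_mult_one_mat[OF W] by simp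
  have "det Tp \<noteq> 0"
  proof
    assume "det Tp = 0"
    then obtain v where v: "v \<in> carrier_vec N" "v \<noteq> 0\<^sub>v N" "Tp *\<^sub>v v = 0\<^sub>v N"
      using det_0_iff_vec_prod_zero_field[OF Tp] by blast
    have WTp: "W * Tp \<in> carrier_mat n N" using W Tp by simp
    have "W *\<^sub>v v = B 1 *\<^sub>v (W *\<^sub>v (Tp *\<^sub>v v))"
      using assoc_mult_mat_vec[OF B1 WTp v(1)] assoc_mult_mat_vec[OF W Tp v(1)] B1WTp by simp
    also have "\<dots> = 0\<^sub>v n"
    proof -
      have "D *\<^sub>v 0\<^sub>v c = 0\<^sub>v r" if "D \<in> carrier_mat r c" for D :: "complex mat" and r c
        using that by (intro eq_vecI) auto
      then show ?thesis using v(3) W B1 by metis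
    qed
    finally show False using inj[OF v(1)] v(2) by blast
  qed
  then obtain T1 where T1: "T1 \<in> carrier_mat N N" "Tp * T1 = 1\<^sub>m N"
    using det_nonzero_imp_inverse[OF Tp] by blast
  have "W * T1 = B 1 * (W * Tp) * T1" using B1WTp by simp
  also have "\<dots> = B 1 * (W * (Tp * T1))"
    using assoc_mult_mat[OF B1 mult_carrier_mat[OF W Tp] T1(1)] assoc_mult_mat[OF W Tp T1(1)] by simp
  also have "\<dots> = B 1 * W" using T1(2) right_mult_one_mat[OF W] by simp
  finally have B1W: "B 1 * W = W * T1" by simp
  define T' where "T' = T(1 := T1)"
  have T'c: "T' j \<in> carrier_mat N N" and T'W: "B j * W = W * T' j" if "j \<in> {1..m}" for j
    using that T T1 B1W by (auto simp: T'_def)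
  obtain \<Phi> where \<Phi>: "\<forall>j\<in>{1..m}. \<Phi> j \<subseteq> {1..n} \<and> card (\<Phi> j) = N \<and>
      mat_trace (T' j) = (\<Sum>k\<in>\<Phi> j. l k j) \<and> det (T' j) = (\<Prod>k\<in>\<Phi> j. l k j)"
    using relation_indices_of_invariant_subspace[of W n N m B T' l, OF W inj B T'c T'W l] by blast
  have "(\<Prod>j\<in>{1..m}. \<Prod>k\<in>\<Phi> j. l k j) = (\<Prod>j\<in>{1..m}. det (T' j))"
    using \<Phi> by simp
  also have "\<dots> = det T1 * (\<Prod>j\<in>{2..m}. det (T j))"
    unfolding prod_from_one[OF m] by (simp add: T'_def)
  also have "(\<Prod>j\<in>{2..m}. det (T j)) = (\<Prod>j\<leftarrow>[2..<Suc m]. det (T j))"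
    by (subst prod.distinct_set_conv_list[symmetric]) (simp_all only: distinct_upt set2)
  also have "\<dots> = det Tp" unfolding Tp_def by (rule det_list_mat_prod[symmetric]) (use T in auto)
  also have "det T1 * det Tp = 1" using det_mult[OF Tp T1(1)] T1(2) by (simp add: mult.commute)
  finally show ?thesis using \<Phi> N unfolding multiplicative_relation_def by auto
qed

theorem multiplicative_deformation:
  assumes M: "\<And>j. j \<in> {1..m} \<Longrightarrow> M j \<in> carrier_mat n n"
    and diag: "\<And>j. j \<in> {1..m} \<Longrightarrow> diagonalizable_mat (M j)"
    and l: "\<And>j. j \<in> {1..m} \<Longrightarrow> lists_eigenvalues n (M j) (\<lambda>k. l k j)"
    and one: "tuple_prod n m M = 1\<^sub>m n" and m: "1 \<le> m"
    and M1: "has_n_distinct_eigenvalues n (M 1)" and generic: "multiplicatively_generic 3 n m l"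
  shows "can_be_deformed n m (\<lambda>B. tuple_prod n m B = 1\<^sub>m n) (trivial_centralizer n m) M"
proof (rule deformation_principle[of m M n "\<lambda>B. tuple_prod n m B = 1\<^sub>m n", OF M m _ M1 one])
  show "diagonalizable_mat (M 1)" using diag m by simp
next
  fix P P' :: "complex mat" and B :: "nat \<Rightarrow> complex mat"
  assume P: "P \<in> carrier_mat n n" "P' \<in> carrier_mat n n" "P * P' = 1\<^sub>m n" "P' * P = 1\<^sub>m n"
    and B: "\<And>j. j \<in> {1..m} \<Longrightarrow> B j \<in> carrier_mat n n" and one: "tuple_prod n m B = 1\<^sub>m n"
  have "list_mat_prod n (\<lambda>j. P * B j * P') [1..<Suc m] = P * list_mat_prod n B [1..<Suc m] * P'"
    by (rule list_mat_prod_conj[OF P]) (use B in auto)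
  also have "list_mat_prod n B [1..<Suc m] = 1\<^sub>m n"
    using one by (simp only: tuple_prod_def list_mat_prod_def)
  also have "P * 1\<^sub>m n * P' = 1\<^sub>m n" using right_mult_one_mat[OF P(1)] P(3) by simp
  finally show "tuple_prod n m (\<lambda>j. P * B j * P') = 1\<^sub>m n"
    by (simp only: tuple_prod_def list_mat_prod_def)
next
  fix B :: "nat \<Rightarrow> complex mat" and S
  assume B: "\<And>j. j \<in> {1..m} \<Longrightarrow> B j \<in> carrier_mat n n"
    and sim: "\<And>j. j \<in> {1..m} \<Longrightarrow> similar_mat (B j) (M j)"
    and one: "tuple_prod n m B = 1\<^sub>m n" and S: "S \<subseteq> {..<n}" "S \<noteq> {}" "S \<noteq> {..<n}"
    and split: "\<And>j. j \<in> {1..m} \<Longrightarrow> splits_along S (B j)"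
  have lB: "lists_eigenvalues n (B j) (\<lambda>k. l k j)" if "j \<in> {1..m}" for j
    using lists_eigenvalues_similar[OF sim[OF that] l[OF that]] .
  have dB: "diagonalizable_mat (B j)" if "j \<in> {1..m}" for j
    using diagonalizable_mat_similar[OF sim[OF that] diag[OF that]] .
  have n: "2 \<le> n" using two_le_of_proper_nonempty_subset[OF S] .
  have no: "\<not> carries_invariant_subspace n {2..m} B N" if "0 < N" "2 * N \<le> n" "N < 3" for N
  proof
    assume "carries_invariant_subspace n {2..m} B N"
    then have "multiplicative_relation n m l N"
      using multiplicative_invariant_subspace_imp_relation[of m B n l N, OF B m lB one] that by simp
    then show False using generic that unfolding multiplicatively_generic_def by fastforce
  qed
  let ?L = "\<lambda>j. list_mat_prod n B [2..<j]" and ?R = "\<lambda>j. list_mat_prod n B [Suc j..<Suc m]"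
  have L: "?L j \<in> carrier_mat n n" "splits_along S (?L j)"
    and R: "?R j \<in> carrier_mat n n" "splits_along S (?R j)" if "j \<in> {2..m}" for j
    using that B split
    by (auto intro!: list_mat_prod_carrier splits_along_list_mat_prod simp del: upt_Suc)
  have "\<exists>X. (\<forall>j. X j \<in> carrier_mat n n \<and> corner_along S (X j)) \<and> X 1 = 0\<^sub>m n n \<and>
      (\<exists>j\<in>{1..m}. X j \<noteq> 0\<^sub>m n n) \<and> (\<forall>\<delta>. \<forall>j\<in>{1..m}. similar_mat (B j + \<delta> \<cdot>\<^sub>m X j) (B j)) \<and>
      (\<forall>i<n. \<forall>k<n. (\<Sum>j\<in>{2..m}. (?L j * X j * ?R j) $$ (i, k)) = 0)"
    by (rule corner_perturbation_of_split_tuple[of m B n S ?L ?R, OF B dB split S _ _ L R])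
      (use no[of 1] no[of 2] n in auto)
  then obtain X where X: "\<And>j. X j \<in> carrier_mat n n" "\<And>j. corner_along S (X j)" and X1: "X 1 = 0\<^sub>m n n"
    and nz: "\<exists>j\<in>{1..m}. X j \<noteq> 0\<^sub>m n n"
    and sim': "\<forall>\<delta>. \<forall>j\<in>{1..m}. similar_mat (B j + \<delta> \<cdot>\<^sub>m X j) (B j)"
    and sum0: "\<forall>i<n. \<forall>k<n. (\<Sum>j\<in>{2..m}. (?L j * X j * ?R j) $$ (i, k)) = 0" by blast
  have B1: "B 1 \<in> carrier_mat n n" using B m by simp
  have "tuple_prod n m (\<lambda>j. B j + \<delta> \<cdot>\<^sub>m X j) = 1\<^sub>m n" for \<delta>
  proof -
    have c: "B j + \<delta> \<cdot>\<^sub>m X j \<in> carrier_mat n n" if "j \<in> {1..m}" for j using B[OF that] X(1)[of j] by simp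
    have Bp: "list_mat_prod n B [2..<Suc m] \<in> carrier_mat n n"
      and Bp': "list_mat_prod n (\<lambda>j. B j + \<delta> \<cdot>\<^sub>m X j) [2..<Suc m] \<in> carrier_mat n n"
      by (rule list_mat_prod_carrier, use B c in auto)+
    have "list_mat_prod n (\<lambda>j. B j + \<delta> \<cdot>\<^sub>m X j) [2..<Suc m] = list_mat_prod n B [2..<Suc m]"
    proof (rule eq_matI)
      fix i k assume "i < dim_row (list_mat_prod n B [2..<Suc m])" "k < dim_col (list_mat_prod n B [2..<Suc m])"
      then have ik: "i < n" "k < n" using Bp by auto
      have "list_mat_prod n (\<lambda>j. B j + \<delta> \<cdot>\<^sub>m X j) [2..<Suc m] $$ (i, k) = list_mat_prod n B [2..<Suc m] $$ (i, k)
          + \<delta> * (\<Sum>j\<in>{2..<Suc m}. (?L j * X j * ?R j) $$ (i, k))"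
        by (rule list_mat_prod_perturbed_by_corners[of 2 "Suc m" B n S X, OF _ _ _ X ik]) (use B split m in auto)
      then show "list_mat_prod n (\<lambda>j. B j + \<delta> \<cdot>\<^sub>m X j) [2..<Suc m] $$ (i, k) = list_mat_prod n B [2..<Suc m] $$ (i, k)"
        using sum0 ik unfolding atLeastLessThanSuc_atLeastAtMost by simp
    next
      show "dim_row (list_mat_prod n (\<lambda>j. B j + \<delta> \<cdot>\<^sub>m X j) [2..<Suc m]) = dim_row (list_mat_prod n B [2..<Suc m])"
        "dim_col (list_mat_prod n (\<lambda>j. B j + \<delta> \<cdot>\<^sub>m X j) [2..<Suc m]) = dim_col (list_mat_prod n B [2..<Suc m])"
        unfolding carrier_matD[OF Bp] carrier_matD[OF Bp'] by simp_all
    qed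
    moreover have "B 1 + \<delta> \<cdot>\<^sub>m X 1 = B 1" unfolding X1 using B1 by (intro eq_matI) auto
    ultimately show ?thesis using one unfolding tuple_prod_from_one[OF m] by (simp only:)
  qed
  then show "\<exists>X. (\<forall>j \<in> {1..m}. X j \<in> carrier_mat n n \<and> corner_along S (X j)) \<and> X 1 = 0\<^sub>m n n \<and>
      (\<exists>j \<in> {1..m}. X j \<noteq> 0\<^sub>m n n) \<and> (\<forall>\<delta>. tuple_prod n m (\<lambda>j. B j + \<delta> \<cdot>\<^sub>m X j) = 1\<^sub>m n \<and>
        (\<forall>j \<in> {1..m}. similar_mat (B j + \<delta> \<cdot>\<^sub>m X j) (B j)))"
    using X X1 nz sim' by (intro exI[of _ X]) blast
qed

section \<open>Deformation to a trivial centralizer\<close>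

theorem corollary24:
  fixes n p :: nat
  shows
    "(\<forall>(A :: nat \<Rightarrow> complex mat) (ls :: nat \<Rightarrow> nat \<Rightarrow> complex) (ns :: nat list).
        (\<forall>j \<in> {1..p+1}. A j \<in> carrier_mat n n \<and> diagonalizable_mat (A j) \<and>
           lists_eigenvalues n (A j) (\<lambda>k. ls k j) \<and> block_upper_triangular ns (A j)) \<and>
        tuple_sum n (p+1) A = 0\<^sub>m n n \<and>
        has_n_distinct_eigenvalues n (A 1) \<and>
        additively_generic 3 n (p+1) ls
        \<longrightarrow> can_be_deformed n (p+1) (\<lambda>B. tuple_sum n (p+1) B = 0\<^sub>m n n)
              (trivial_centralizer n (p+1)) A)
     \<and>
     (\<forall>(M :: nat \<Rightarrow> complex mat) (\<sigma> :: nat \<Rightarrow> nat \<Rightarrow> complex) (ns :: nat list).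
        (\<forall>j \<in> {1..p+1}. M j \<in> carrier_mat n n \<and> invertible_mat (M j) \<and> diagonalizable_mat (M j) \<and>
           lists_eigenvalues n (M j) (\<lambda>k. \<sigma> k j) \<and> block_upper_triangular ns (M j)) \<and>
        tuple_prod n (p+1) M = 1\<^sub>m n \<and>
        has_n_distinct_eigenvalues n (M 1) \<and>
        multiplicatively_generic 3 n (p+1) \<sigma>
        \<longrightarrow> can_be_deformed n (p+1) (\<lambda>B. tuple_prod n (p+1) B = 1\<^sub>m n)
              (trivial_centralizer n (p+1)) M)"
proof (intro conjI allI impI)
  fix A :: "nat \<Rightarrow> complex mat" and ls :: "nat \<Rightarrow> nat \<Rightarrow> complex" and ns :: "nat list"
  assume A: "(\<forall>j \<in> {1..p+1}. A j \<in> carrier_mat n n \<and> diagonalizable_mat (A j) \<and>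
           lists_eigenvalues n (A j) (\<lambda>k. ls k j) \<and> block_upper_triangular ns (A j)) \<and>
        tuple_sum n (p+1) A = 0\<^sub>m n n \<and> has_n_distinct_eigenvalues n (A 1) \<and>
        additively_generic 3 n (p+1) ls"
  show "can_be_deformed n (p+1) (\<lambda>B. tuple_sum n (p+1) B = 0\<^sub>m n n) (trivial_centralizer n (p+1)) A"
    by (rule additive_deformation[of "p+1" A n ls]) (use A in auto)
next
  fix M :: "nat \<Rightarrow> complex mat" and \<sigma> :: "nat \<Rightarrow> nat \<Rightarrow> complex" and ns :: "nat list"
  assume M: "(\<forall>j \<in> {1..p+1}. M j \<in> carrier_mat n n \<and> invertible_mat (M j) \<and> diagonalizable_mat (M j) \<and>
           lists_eigenvalues n (M j) (\<lambda>k. \<sigma> k j) \<and> block_upper_triangular ns (M j)) \<and>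
        tuple_prod n (p+1) M = 1\<^sub>m n \<and> has_n_distinct_eigenvalues n (M 1) \<and>
        multiplicatively_generic 3 n (p+1) \<sigma>"
  show "can_be_deformed n (p+1) (\<lambda>B. tuple_prod n (p+1) B = 1\<^sub>m n) (trivial_centralizer n (p+1)) M"
    by (rule multiplicative_deformation[of "p+1" M n \<sigma>]) (use M in auto)
qed

end
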